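(* Let $n\geqslant 3$. Every sign-changing solution $u\in D^{1,2}(\mathbb{R}^n_+)$ of $$\begin{cases}\Delta u=0 & \text{in } \mathbb{R}^n_+\\ \dfrac{\partial u}{\partial \nu}+|u|^{\frac{2}{n-2}}u=0 & \text{on } \partial\mathbb{R}^n_+\end{cases}$$ satisfies $$I(u)>\frac{1}{n-1}S_n^{n-1}.$$
   Context: $\mathbb{R}^n_+=\{(x_1,\dots,x_n)\in\mathbb{R}^n : x_n\geqslant 0\}$, $n\geqslant 3$, and $\nu$ is the inward-pointing unit normal on $\partial\mathbb{R}^n_+=\{x_n=0\}$. $D^{1,2}(\mathbb{R}^n_+)$ is the completion of the smooth functions with compact support in the closed half-space $\mathbb{R}^n_+$ (not required to vanish on $\partial\mathbb{R}^n_+$) with respect to $\|u\|_D=\left(\int_{\mathbb{R}^n_+}|\nabla u|^2\right)^{1/2}$. Set $2^*=\frac{2(n-1)}{n-2}$, and let $S_n$ be the best (largest) constant in the Sobolev trace inequality $\int_{\mathbb{R}^n_+}|\nabla u|^2\geqslant S_n\left(\int_{\partial\mathbb{R}^n_+}|u|^{2^*}\right)^{2/2^*}$, $u\in D^{1,2}(\mathbb{R}^n_+)$. The energy functional is $$I(u)=\frac12\int_{\mathbb{R}^n_+}|\nabla u|^2-\frac{1}{2^*}\int_{\partial\mathbb{R}^n_+}|u|^{2^*}.$$ Solutions in $D^{1,2}(\mathbb{R}^n_+)$ are understood in the weak sense, i.e. as critical points of $I$. A solution is sign-changing if both $u^+=\max\{u,0\}$ and $u^-=\max\{-u,0\}$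 are not identically zero. *)

theory Defs
  imports "HOL-Analysis.Analysis"
begin

text \<open>
  The Euclidean space of dimension n is rendered as the product of \<^typ>\<open>real^'m\<close> (the variables
  x_1, ..., x_{n-1}) and \<^typ>\<open>real\<close> (the variable x_n), so that n = CARD('m) + 1 and the boundary of
  the half-space is identified with \<^typ>\<open>real^'m\<close>, carrying its own Lebesgue measure.
\<close>

definition halfspace :: "((real^'m) \<times> real) set" where
  "halfspace = {x. 0 \<le> snd x}"

definition ambient_dim :: "'m::finite itself \<Rightarrow> nat" where
  "ambient_dim _ = DIM((real^'m) \<times> real)"

text \<open>The exponent 2^* of the trace inequality.\<close>

definition trace_exponent :: "'m::finite itself \<Rightarrow> real" where
  "trace_exponent T = 2 * (real (ambient_dim T) - 1) / (real (ambient_dim T) - 2)"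

text \<open>The exponent 2n/(n-2) of the Sobolev inequality in the half-space.\<close>

definition sobolev_exponent :: "'m::finite itself \<Rightarrow> real" where
  "sobolev_exponent T = 2 * real (ambient_dim T) / (real (ambient_dim T) - 2)"

primrec times_cont_diff :: "nat \<Rightarrow> ('a::euclidean_space \<Rightarrow> real) \<Rightarrow> bool" where
  "times_cont_diff 0 f \<longleftrightarrow> continuous_on UNIV f"
| "times_cont_diff (Suc k) f \<longleftrightarrow>
     (\<forall>x. f differentiable (at x)) \<and>
     (\<forall>b\<in>Basis. times_cont_diff k (\<lambda>x. frechet_derivative f (at x) b))"

definition gradient :: "('a::euclidean_space \<Rightarrow> real) \<Rightarrow> 'a \<Rightarrow> 'a" where
  "gradient f x = (\<Sum>b\<in>Basis. frechet_derivative f (at x) b *\<^sub>R b)"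

text \<open>
  Smooth functions with compact support in the closed half-space are the restrictions to it of
  smooth compactly supported functions on the whole space; only the values on
  \<^const>\<open>halfspace\<close> are used below.
\<close>

definition test_function :: "((real^'m) \<times> real \<Rightarrow> real) \<Rightarrow> bool" where
  "test_function \<phi> \<longleftrightarrow> (\<forall>k. times_cont_diff k \<phi>) \<and> compact (closure {x. \<phi> x \<noteq> 0})"

text \<open>
  By the Sobolev and the trace inequality, a sequence of test functions that is Cauchy for the
  Dirichlet norm converges in L^{2n/(n-2)} of the half-space, and its boundary values converge in
  L^{2^*} of the boundary. The completion is realised as the space of these limits u; G is then the
  gradient of u and \<tau> its trace, both determined by u up to null sets. Functions are
  representatives of classes modulo null sets, and their values outside the half-space are
  irrelevant.
\<close>

definition D12_limit ::
  "((real^'m) \<times> real \<Rightarrow> real) \<Rightarrow> ((real^'m) \<times> real \<Rightarrow> (real^'m) \<times> real) \<Rightarrow> (real^'m \<Rightarrow> real) \<Rightarrow> bool"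
where
  "D12_limit u G \<tau> \<longleftrightarrow>
     u \<in> borel_measurable (lebesgue_on halfspace) \<and>
     G \<in> borel_measurable (lebesgue_on halfspace) \<and>
     \<tau> \<in> borel_measurable lebesgue \<and>
     (\<exists>\<phi>. (\<forall>k::nat. test_function (\<phi> k)) \<and>
       (\<lambda>k. \<integral>\<^sup>+x. ennreal ((norm (gradient (\<phi> k) x - G x))\<^sup>2) \<partial>lebesgue_on halfspace)
          \<longlonglongrightarrow> 0 \<and>
       (\<lambda>k. \<integral>\<^sup>+x. ennreal (\<bar>\<phi> k x - u x\<bar> powr sobolev_exponent TYPE('m)) \<partial>lebesgue_on halfspace)
          \<longlonglongrightarrow> 0 \<and>
       (\<lambda>k. \<integral>\<^sup>+y. ennreal (\<bar>\<phi> k (y, 0) - \<tau> y\<bar> powr trace_exponent TYPE('m)) \<partial>lebesgue)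
          \<longlonglongrightarrow> 0)"

definition D12 :: "((real^'m) \<times> real \<Rightarrow> real) set" where
  "D12 = {u. \<exists>G \<tau>. D12_limit u G \<tau>}"

definition weak_gradient ::
  "((real^'m) \<times> real \<Rightarrow> real) \<Rightarrow> (real^'m) \<times> real \<Rightarrow> (real^'m) \<times> real" where
  "weak_gradient u = (SOME G. \<exists>\<tau>. D12_limit u G \<tau>)"

definition boundary_trace :: "((real^'m) \<times> real \<Rightarrow> real) \<Rightarrow> real^'m \<Rightarrow> real" where
  "boundary_trace u = (SOME \<tau>. \<exists>G. D12_limit u G \<tau>)"

definition dirichlet_integral :: "((real^'m) \<times> real \<Rightarrow> real) \<Rightarrow> real" where
  "dirichlet_integral u = (\<integral>x. (norm (weak_gradient u x))\<^sup>2 \<partial>lebesgue_on halfspace)"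

definition trace_integral :: "((real^'m) \<times> real \<Rightarrow> real) \<Rightarrow> real" where
  "trace_integral u = (\<integral>y. \<bar>boundary_trace u y\<bar> powr trace_exponent TYPE('m) \<partial>lebesgue)"

definition trace_constant :: "'m::finite itself \<Rightarrow> real" where
  "trace_constant T =
     Sup {S. \<forall>u\<in>(D12 :: ((real^'m) \<times> real \<Rightarrow> real) set).
       dirichlet_integral u \<ge> S * trace_integral u powr (2 / trace_exponent T)}"

definition energy :: "((real^'m) \<times> real \<Rightarrow> real) \<Rightarrow> real" where
  "energy u = 1 / 2 * dirichlet_integral u - 1 / trace_exponent TYPE('m) * trace_integral u"

text \<open>
  Critical points of the energy. The vanishing of the derivative in every direction v is the weak
  form of the boundary value problem with nonlinear flux condition
  du/d\<nu> + |u|^{2/(n-2)} u = 0, where \<nu> is the inward normal.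
\<close>

definition weak_solution :: "((real^'m) \<times> real \<Rightarrow> real) \<Rightarrow> bool" where
  "weak_solution u \<longleftrightarrow> u \<in> D12 \<and>
     (\<forall>v\<in>D12. ((\<lambda>t. energy (\<lambda>x. u x + t * v x)) has_real_derivative 0) (at 0))"

definition sign_changing :: "((real^'m) \<times> real \<Rightarrow> real) \<Rightarrow> bool" where
  "sign_changing u \<longleftrightarrow>
     \<not> (AE x in lebesgue_on halfspace. max (u x) 0 = 0) \<and>
     \<not> (AE x in lebesgue_on halfspace. max (- u x) 0 = 0)"

end

theory Submission
  imports Defs "HOL-Real_Asymp.Real_Asymp"
begin

text \<open>
  Write \<open>p = 2^*\<close>, \<open>D\<close> for the Dirichlet integral and \<open>T\<close> for the trace integral. Testing the equation
  for \<open>u\<close> with \<open>u\<^sup>+\<close> and \<open>u\<^sup>-\<close> gives \<open>D(u\<^sup>+) \<le> T(u\<^sup>+)\<close> and \<open>D(u\<^sup>-) \<le> T(u\<^sup>-)\<close>, so the trace inequality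
  yields \<open>T(u\<^sup>+), T(u\<^sup>-) \<ge> S^(n-1)\<close>, whence \<open>I(u) = (1/2 - 1/p) T(u) \<ge> S^(n-1) / (n-1)\<close>. The
  functions \<open>u\<^sup>+\<close> and \<open>u\<^sup>-\<close> also bound the set whose supremum is \<open>S\<close>, so that neither the Sobolev nor
  the trace inequality has to be proved.

  If equality held, \<open>u\<^sup>+\<close> would minimise the trace quotient and hence be a supersolution. Testing with
  \<open>\<psi>\<^sup>2 (1 - tanh (l u))\<close> then shows that the gradient of \<open>tanh (l u\<^sup>+)\<close> tends to zero locally in mean
  square as \<open>l\<close> tends to infinity. By the Poincare inequality the limit, the indicator of \<open>{u > 0}\<close>, is
  constant, which contradicts the change of sign. This replaces regularity theory and the strong
  maximum principle.
\<close>

section \<open>Convergence in mean\<close>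

text \<open>The gradient and the trace of an element of \<open>D12\<close> are fixed by choice
  operators, so the integrals in the statement can be computed only once both are unique up to null
  sets. Membership in \<open>D12\<close> is certified by test functions alone; hence |t| and the
  test direction are built from ln cosh and tanh, which map test functions to test functions. In the
  limit |u| gets the gradient sgn(u) \<open>G\<close>, and u^+ gets \<open>G\<close> with the weight
  (1 + sgn u) / 2, which is 1/2 where u = 0. Testing with u^+ integrates this weight, the Dirichlet
  integral of u^+ integrates its square. Hence only an inequality comes out at first, and equality
  in it is what makes \<open>G\<close> vanish on the zero set. In the equality case the
  supersolution inequality sees only {u > 0}, where 1 - tanh(l u) decays as l grows: the right-hand
  side of the resulting estimate tends to 0, while the left-hand side dominates the squared gradient
  of tanh(l u^+). Strictness is needed for one of the two parts only; u^- merely contributes its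
  weak bound.\<close>

abbreviation powr_norm_on :: "'a measure \<Rightarrow> real \<Rightarrow> ('a \<Rightarrow> 'b::real_normed_vector) \<Rightarrow> ennreal" where
  "powr_norm_on M p f \<equiv> \<integral>\<^sup>+x. ennreal (norm (f x) powr p) \<partial>M"

abbreviation L1_on :: "'a measure \<Rightarrow> 'a set \<Rightarrow> ('a \<Rightarrow> 'b::real_normed_vector) \<Rightarrow> ennreal" where
  "L1_on M A f \<equiv> \<integral>\<^sup>+x\<in>A. ennreal (norm (f x)) \<partial>M"

text \<open>The p-th power is kept without its root, and the integral is a nonnegative one:
  convergence then makes sense before any integrability is known, as in the three limits that define
  \<open>D12_limit\<close>.\<close>

definition Lp_tendsto ::
  "'a measure \<Rightarrow> real \<Rightarrow> (nat \<Rightarrow> 'a \<Rightarrow> 'b::euclidean_space) \<Rightarrow> ('a \<Rightarrow> 'b) \<Rightarrow> bool" where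
  "Lp_tendsto M p f g \<longleftrightarrow> (\<lambda>k. \<integral>\<^sup>+x. ennreal (norm (f k x - g x) powr p) \<partial>M) \<longlonglongrightarrow> 0"

definition Lp_fun :: "'a measure \<Rightarrow> real \<Rightarrow> ('a \<Rightarrow> 'b::euclidean_space) \<Rightarrow> bool" where
  "Lp_fun M p f \<longleftrightarrow> f \<in> borel_measurable M \<and> powr_norm_on M p f < \<infinity>"

lemma powr_norm_add_le:
  fixes a b :: "'b::real_normed_vector"
  assumes "0 < p"
  shows "norm (a + b) powr p \<le> 2 powr p * (norm a powr p + norm b powr p)"
proof -
  have "norm (a + b) powr p \<le> (2 * max (norm a) (norm b)) powr p"
    using assms norm_triangle_ineq[of a b] by (intro powr_mono2) auto
  also have "\<dots> = 2 powr p * max (norm a) (norm b) powr p"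
    by (simp add: powr_mult)
  also have "max (norm a) (norm b) powr p \<le> norm a powr p + norm b powr p"
    by (simp add: max_def)
  finally show ?thesis by simp
qed

lemma nn_integral_powr_norm_add_le:
  fixes f g :: "'a \<Rightarrow> 'b::euclidean_space"
  assumes "0 < p" and [measurable]: "f \<in> borel_measurable M" "g \<in> borel_measurable M"
  shows "powr_norm_on M p (\<lambda>x. f x + g x)
    \<le> ennreal (2 powr p) * (powr_norm_on M p f + powr_norm_on M p g)"
proof -
  have "powr_norm_on M p (\<lambda>x. f x + g x)
    \<le> (\<integral>\<^sup>+x. ennreal (2 powr p) * (ennreal (norm (f x) powr p) + ennreal (norm (g x) powr p)) \<partial>M)"
    by (intro nn_integral_mono)
      (simp add: powr_norm_add_le[OF assms(1)] flip: ennreal_plus ennreal_mult)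
  also have "\<dots> = ennreal (2 powr p) * (powr_norm_on M p f + powr_norm_on M p g)"
    by (simp add: nn_integral_cmult nn_integral_add)
  finally show ?thesis .
qed

lemma Lp_fun_measurable [measurable_dest]: "Lp_fun M p f \<Longrightarrow> f \<in> borel_measurable M"
  by (simp add: Lp_fun_def)

lemma Lp_fun_add:
  assumes "0 < p" "Lp_fun M p f" "Lp_fun M p g"
  shows "Lp_fun M p (\<lambda>x. f x + g x)"
proof -
  note [measurable] = Lp_fun_measurable[OF assms(2)] Lp_fun_measurable[OF assms(3)]
  have "powr_norm_on M p (\<lambda>x. f x + g x) < \<infinity>"
    using assms by (intro le_less_trans[OF nn_integral_powr_norm_add_le])
      (auto simp: Lp_fun_def ennreal_mult_less_top)
  then show ?thesis by (simp add: Lp_fun_def)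
qed

lemma powr_norm_on_le:
  fixes f :: "'a \<Rightarrow> 'b::euclidean_space" and g :: "'a \<Rightarrow> 'c::euclidean_space"
  assumes [measurable]: "f \<in> borel_measurable M" and "0 \<le> p"
    and "\<And>x. x \<in> space M \<Longrightarrow> norm (g x) \<le> c * norm (f x)"
  shows "powr_norm_on M p g \<le> ennreal (\<bar>c\<bar> powr p) * powr_norm_on M p f"
proof -
  have "powr_norm_on M p g \<le> (\<integral>\<^sup>+x. ennreal (\<bar>c\<bar> powr p) * ennreal (norm (f x) powr p) \<partial>M)"
  proof (intro nn_integral_mono)
    fix x assume "x \<in> space M"
    then have "norm (g x) \<le> \<bar>c\<bar> * norm (f x)"
      using assms(3)[of x] by (meson abs_ge_self mult_right_mono norm_ge_zero order_trans)
    then have "norm (g x) powr p \<le> (\<bar>c\<bar> * norm (f x)) powr p"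
      using assms(2) by (intro powr_mono2) auto
    then show "ennreal (norm (g x) powr p) \<le> ennreal (\<bar>c\<bar> powr p) * ennreal (norm (f x) powr p)"
      by (simp add: powr_mult flip: ennreal_mult)
  qed
  also have "\<dots> = ennreal (\<bar>c\<bar> powr p) * powr_norm_on M p f" by (simp add: nn_integral_cmult)
  finally show ?thesis .
qed

lemma Lp_fun_mono:
  fixes f :: "'a \<Rightarrow> 'b::euclidean_space" and g :: "'a \<Rightarrow> 'c::euclidean_space"
  assumes "Lp_fun M p f" "g \<in> borel_measurable M" "0 \<le> p"
    and "\<And>x. x \<in> space M \<Longrightarrow> norm (g x) \<le> c * norm (f x)"
  shows "Lp_fun M p g"
  using le_less_trans[OF powr_norm_on_le[OF Lp_fun_measurable[OF assms(1)] assms(3,4)], of \<infinity>] assms(1,2)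
  by (simp add: Lp_fun_def ennreal_mult_less_top)

lemma Lp_fun_scaleR: "Lp_fun M p f \<Longrightarrow> 0 \<le> p \<Longrightarrow> Lp_fun M p (\<lambda>x. c *\<^sub>R f x)"
  by (rule Lp_fun_mono[where c = "\<bar>c\<bar>"]) (auto simp: Lp_fun_def)

lemma Lp_fun_iff_integrable:
  assumes "f \<in> borel_measurable M"
  shows "Lp_fun M p f \<longleftrightarrow> integrable M (\<lambda>x. norm (f x) powr p)"
  using assms by (simp add: Lp_fun_def integrable_iff_bounded)

lemma Lp_fun_integrable: "Lp_fun M p f \<Longrightarrow> integrable M (\<lambda>x. norm (f x) powr p)"
  using Lp_fun_iff_integrable Lp_fun_def by blast

lemma Lp_fun_2_integrable: "Lp_fun M 2 f \<Longrightarrow> integrable M (\<lambda>x. (norm (f x))\<^sup>2)"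
  using Lp_fun_integrable[of M 2 f] by simp

lemma Lp_fun_2_integrable_inner:
  assumes "Lp_fun M 2 f" "Lp_fun M 2 g"
  shows "integrable M (\<lambda>x. f x \<bullet> g x)"
proof -
  note [measurable] = Lp_fun_measurable[OF assms(1)] Lp_fun_measurable[OF assms(2)]
  have "norm (f x \<bullet> g x) \<le> norm ((norm (f x))\<^sup>2 + (norm (g x))\<^sup>2)" for x
  proof -
    have "norm (f x \<bullet> g x) \<le> norm (f x) * norm (g x)" by (simp add: Cauchy_Schwarz_ineq2)
    moreover have "0 \<le> (norm (f x) - norm (g x))\<^sup>2" by simp
    moreover have "0 \<le> norm (f x) * norm (g x)" by simp
    ultimately show ?thesis by (simp add: power2_diff del: zero_le_power2)
  qed
  then show ?thesis
    by (intro Bochner_Integration.integrable_bound[OF Bochner_Integration.integrable_add[OF Lp_fun_2_integrable[OF assms(1)] Lp_fun_2_integrable[OF assms(2)]]]) auto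
qed

lemma Lp_tendsto_le:
  fixes f :: "nat \<Rightarrow> 'a \<Rightarrow> 'b::euclidean_space" and f' :: "nat \<Rightarrow> 'a \<Rightarrow> 'c::euclidean_space"
  assumes "Lp_tendsto M p f g" "0 \<le> p"
    and [measurable]: "\<And>k. f k \<in> borel_measurable M" "g \<in> borel_measurable M"
    and "\<And>k x. x \<in> space M \<Longrightarrow> norm (f' k x - g' x) \<le> c * norm (f k x - g x)"
  shows "Lp_tendsto M p f' g'"
proof -
  let ?I = "\<lambda>k. powr_norm_on M p (\<lambda>x. f k x - g x)"
  have lim: "(\<lambda>k. ennreal (\<bar>c\<bar> powr p) * ?I k) \<longlonglongrightarrow> ennreal (\<bar>c\<bar> powr p) * 0"
    using assms(1) by (intro ennreal_tendsto_cmult) (auto simp: Lp_tendsto_def)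
  have "powr_norm_on M p (\<lambda>x. f' k x - g' x) \<le> ennreal (\<bar>c\<bar> powr p) * ?I k" for k
    by (rule powr_norm_on_le[OF _ assms(2,5)]) measurable
  then show ?thesis unfolding Lp_tendsto_def
    using tendsto_sandwich[OF _ _ tendsto_const lim] by (auto simp: always_eventually)
qed

lemma Lp_tendsto_add:
  assumes "0 < p" "Lp_tendsto M p f g" "Lp_tendsto M p f' g'"
    and [measurable]: "\<And>k. f k \<in> borel_measurable M" "g \<in> borel_measurable M"
      "\<And>k. f' k \<in> borel_measurable M" "g' \<in> borel_measurable M"
  shows "Lp_tendsto M p (\<lambda>k x. f k x + f' k x) (\<lambda>x. g x + g' x)"
proof -
  let ?I = "\<lambda>f g k. \<integral>\<^sup>+x. ennreal (norm (f k x - g x) powr p) \<partial>M"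
  have lim: "(\<lambda>k. ennreal (2 powr p) * (?I f g k + ?I f' g' k)) \<longlonglongrightarrow> ennreal (2 powr p) * (0 + 0)"
    using assms(2,3) by (intro ennreal_tendsto_cmult tendsto_add) (auto simp: Lp_tendsto_def)
  have "powr_norm_on M p (\<lambda>x. f k x + f' k x - (g x + g' x))
     \<le> ennreal (2 powr p) * (?I f g k + ?I f' g' k)" for k
    using nn_integral_powr_norm_add_le[OF assms(1), of "\<lambda>x. f k x - g x" M "\<lambda>x. f' k x - g' x"]
    by (simp add: algebra_simps)
  then show ?thesis unfolding Lp_tendsto_def
    using tendsto_sandwich[OF _ _ tendsto_const lim] by (auto simp: always_eventually)
qed

lemma Lp_tendsto_scaleR:
  assumes "Lp_tendsto M p f g" "0 \<le> p"
    and "\<And>k. f k \<in> borel_measurable M" "g \<in> borel_measurable M"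
  shows "Lp_tendsto M p (\<lambda>k x. c *\<^sub>R f k x) (\<lambda>x. c *\<^sub>R g x)"
  by (rule Lp_tendsto_le[OF assms, where c = "\<bar>c\<bar>"]) (simp flip: scaleR_diff_right)

lemma Lp_tendsto_limit_Lp_fun:
  assumes "Lp_tendsto M p f g" "0 < p" "\<And>k. Lp_fun M p (f k)" "g \<in> borel_measurable M"
  shows "Lp_fun M p g"
proof -
  have "\<forall>\<^sub>F k in sequentially. (powr_norm_on M p (\<lambda>x. f k x - g x)) < \<infinity>"
    using assms(1) unfolding Lp_tendsto_def by (intro order_tendstoD) auto
  then obtain k where k: "powr_norm_on M p (\<lambda>x. f k x - g x) < \<infinity>"
    by (auto simp: eventually_sequentially)
  have "Lp_fun M p (\<lambda>x. f k x - g x)"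
    using k assms(3)[of k] assms(4) by (auto simp: Lp_fun_def)
  then have "Lp_fun M p (\<lambda>x. f k x + (- 1) *\<^sub>R (f k x - g x))"
    using assms by (intro Lp_fun_add Lp_fun_scaleR) auto
  then show ?thesis by simp
qed

lemma Lp_tendsto_subseq:
  assumes "Lp_tendsto M p f g" "strict_mono r"
  shows "Lp_tendsto M p (\<lambda>k. f (r k)) g"
  using LIMSEQ_subseq_LIMSEQ[OF assms(1)[unfolded Lp_tendsto_def] assms(2)]
  by (simp add: Lp_tendsto_def o_def)

lemma Lp_tendsto_AE_subseq:
  assumes "Lp_tendsto M p f g" "0 < p" "\<And>k. Lp_fun M p (f k)" "Lp_fun M p g"
  obtains r :: "nat \<Rightarrow> nat" where "strict_mono r" "AE x in M. (\<lambda>k. f (r k) x) \<longlonglongrightarrow> g x"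
proof -
  have d: "Lp_fun M p (\<lambda>x. f k x + (- 1) *\<^sub>R g x)" for k
    using assms by (intro Lp_fun_add Lp_fun_scaleR) auto
  have int: "integrable M (\<lambda>x. norm (f k x - g x) powr p)" for k
    using Lp_fun_integrable[OF d[of k]] by simp
  have "(\<lambda>k. ennreal (\<integral>x. norm (norm (f k x - g x) powr p) \<partial>M)) \<longlonglongrightarrow> ennreal 0"
    using assms(1) nn_integral_eq_integral[OF int] by (simp add: Lp_tendsto_def)
  then have "(\<lambda>k. (\<integral>x. norm (norm (f k x - g x) powr p) \<partial>M)) \<longlonglongrightarrow> 0"
    by (rule tendsto_ennrealD) auto
  from tendsto_L1_AE_subseq[OF int this] obtain r where r: "strict_mono r"
    "AE x in M. (\<lambda>k. norm (f (r k) x - g x) powr p) \<longlonglongrightarrow> 0" by blast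
  have "AE x in M. (\<lambda>k. f (r k) x) \<longlonglongrightarrow> g x"
    using r(2)
  proof eventually_elim
    case (elim x)
    then have "(\<lambda>k. (norm (f (r k) x - g x) powr p) powr (1 / p)) \<longlonglongrightarrow> 0 powr (1 / p)"
      using assms(2) by (intro tendsto_powr2) (auto simp: always_eventually)
    then have "(\<lambda>k. norm (f (r k) x - g x)) \<longlonglongrightarrow> 0"
      using assms(2) by (simp add: powr_powr)
    then show ?case using Lim_null tendsto_norm_zero_iff by blast
  qed
  with r(1) show ?thesis by (rule that)
qed

lemma Lp_tendsto_dominated:
  assumes "0 < p" "Lp_fun M p F"
    and [measurable]: "\<And>k. f k \<in> borel_measurable M" "g \<in> borel_measurable M"
    and "AE x in M. (\<lambda>k. f k x) \<longlonglongrightarrow> g x"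
    and "\<And>k x. x \<in> space M \<Longrightarrow> norm (f k x - g x) \<le> norm (F x)"
  shows "Lp_tendsto M p f g"
proof -
  note [measurable] = Lp_fun_measurable[OF assms(2)]
  have "(\<lambda>k. \<integral>\<^sup>+x. ennreal (norm (f k x - g x) powr p) \<partial>M) \<longlonglongrightarrow> (\<integral>\<^sup>+x. 0 \<partial>M)"
  proof (rule nn_integral_dominated_convergence[where w = "\<lambda>x. ennreal (norm (F x) powr p)"])
    show "AE x in M. ennreal (norm (f k x - g x) powr p) \<le> ennreal (norm (F x) powr p)" for k
      using assms(1,6) by (intro AE_I2 ennreal_leI powr_mono2) auto
    show "AE x in M. (\<lambda>k. ennreal (norm (f k x - g x) powr p)) \<longlonglongrightarrow> 0"
      using assms(5)
    proof eventually_elim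
      case (elim x)
      then have "(\<lambda>k. norm (f k x - g x)) \<longlonglongrightarrow> 0" using LIM_zero tendsto_norm_zero by blast
      then have "(\<lambda>k. norm (f k x - g x) powr p) \<longlonglongrightarrow> 0 powr p"
        using assms(1) by (intro tendsto_powr2) (auto simp: always_eventually)
      then show ?case using tendsto_ennrealI[of _ 0] by fastforce
    qed
    show "(\<integral>\<^sup>+ x. ennreal (norm (F x) powr p) \<partial>M) < \<infinity>"
      using assms(2) by (simp add: Lp_fun_def)
  qed auto
  then show ?thesis by (simp add: Lp_tendsto_def)
qed

text \<open>For t > e one has t = t^(1-p) t^p, and the exponent 1 - p is not positive. Integrated
  over a set of finite measure this bounds the L^1 norm by the integral of the p-th power and takes
  the place of Hoelder's inequality; a small e absorbs the measure.\<close>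

lemma le_plus_powr:
  fixes t e p :: real
  assumes "0 < e" "1 \<le> p" "0 \<le> t"
  shows "t \<le> e + e powr (1 - p) * t powr p"
proof (cases "t \<le> e")
  case True
  then show ?thesis by (simp add: add_increasing2)
next
  case False
  then have t: "t > e" "t > 0" using assms by auto
  have "t powr (1 - p) \<le> e powr (1 - p)"
    using assms t by (intro powr_mono2') auto
  then have "t powr (1 - p) * t powr p \<le> e powr (1 - p) * t powr p"
    by (intro mult_right_mono) auto
  then show ?thesis using t assms(1) by (simp flip: powr_add)
qed

lemma nn_integral_norm_le_powr:
  fixes f :: "'a \<Rightarrow> 'b::euclidean_space"
  assumes "0 < e" "1 \<le> p" and [measurable]: "A \<in> sets M" "f \<in> borel_measurable M"
  shows "L1_on M A f
    \<le> ennreal e * emeasure M A + ennreal (e powr (1 - p)) * (\<integral>\<^sup>+x\<in>A. ennreal (norm (f x) powr p) \<partial>M)"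
proof -
  have "L1_on M A f \<le> 
    (\<integral>\<^sup>+x. ennreal e * indicator A x + ennreal (e powr (1 - p)) * (ennreal (norm (f x) powr p) * indicator A x) \<partial>M)"
  proof (intro nn_integral_mono)
    fix x
    show "ennreal (norm (f x)) * indicator A x
      \<le> ennreal e * indicator A x + ennreal (e powr (1 - p)) * (ennreal (norm (f x) powr p) * indicator A x)"
      using le_plus_powr[OF assms(1,2), of "norm (f x)"] assms(1)
      by (auto simp: indicator_def simp flip: ennreal_plus ennreal_mult)
  qed
  also have "\<dots> = ennreal e * emeasure M A + ennreal (e powr (1 - p)) * (\<integral>\<^sup>+x\<in>A. ennreal (norm (f x) powr p) \<partial>M)"
    by (simp add: nn_integral_add nn_integral_cmult)
  finally show ?thesis .
qed

section \<open>Smooth functions and test functions\<close>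

abbreviation smooth :: "('a::euclidean_space \<Rightarrow> real) \<Rightarrow> bool" where
  "smooth f \<equiv> \<forall>k. times_cont_diff k f"

lemma times_cont_diff_decr: "times_cont_diff (Suc k) f \<Longrightarrow> times_cont_diff k f"
proof (induction k arbitrary: f)
  case 0
  then show ?case
    by (auto simp: continuous_on_eq_continuous_at intro: differentiable_imp_continuous_within)
next
  case (Suc k)
  then show ?case by (metis times_cont_diff.simps(2))
qed

lemma times_cont_diff_SucI:
  assumes "\<And>x. (f has_derivative f' x) (at x)"
    and "\<And>b. b \<in> Basis \<Longrightarrow> times_cont_diff k (\<lambda>x. f' x b)"
  shows "times_cont_diff (Suc k) f"
proof -
  have "frechet_derivative f (at x) = f' x" for x
    using frechet_derivative_at[OF assms(1)] by simp
  then show ?thesis using assms by (auto simp: differentiable_def)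
qed

lemma times_cont_diff_SucD:
  assumes "times_cont_diff (Suc k) f"
  shows "(f has_derivative frechet_derivative f (at x)) (at x)"
    and "b \<in> Basis \<Longrightarrow> times_cont_diff k (\<lambda>x. frechet_derivative f (at x) b)"
  using assms by (auto simp: frechet_derivative_works)

lemma times_cont_diff_const: "times_cont_diff k (\<lambda>x. c)"
proof (induction k arbitrary: c)
  case (Suc k)
  show ?case by (rule times_cont_diff_SucI[where f' = "\<lambda>_ _. 0"]) (auto intro: Suc)
qed simp

lemma times_cont_diff_add:
  "times_cont_diff k f \<Longrightarrow> times_cont_diff k g \<Longrightarrow> times_cont_diff k (\<lambda>x. f x + g x)"
proof (induction k arbitrary: f g)
  case 0
  then show ?case by (auto intro: continuous_intros)
next
  case (Suc k)
  note D = times_cont_diff_SucD[OF Suc.prems(1)] times_cont_diff_SucD[OF Suc.prems(2)]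
  show ?case
    by (rule times_cont_diff_SucI, rule has_derivative_add[OF D(1) D(3)], rule Suc.IH)
      (use D in auto)
qed

lemma times_cont_diff_mult:
  "times_cont_diff k f \<Longrightarrow> times_cont_diff k g \<Longrightarrow> times_cont_diff k (\<lambda>x. f x * g x)"
proof (induction k arbitrary: f g)
  case 0
  then show ?case by (auto intro: continuous_intros)
next
  case (Suc k)
  note D = times_cont_diff_SucD[OF Suc.prems(1)] times_cont_diff_SucD[OF Suc.prems(2)]
  show ?case
    by (rule times_cont_diff_SucI, rule has_derivative_mult[OF D(1) D(3)])
      (intro times_cont_diff_add Suc.IH D times_cont_diff_decr[OF Suc.prems(1)]
        times_cont_diff_decr[OF Suc.prems(2)])
qed

text \<open>Provides the zoom by which a cutoff is made out of an arbitrary nonzero test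
  function.\<close>

lemma times_cont_diff_affine:
  "times_cont_diff k f \<Longrightarrow> times_cont_diff k (\<lambda>x. f (a + r *\<^sub>R x))"
proof (induction k arbitrary: f)
  case 0
  then show ?case
    by (auto intro!: continuous_intros intro: continuous_on_compose2[of UNIV f])
next
  case (Suc k)
  note D = times_cont_diff_SucD[OF Suc.prems]
  have lin: "bounded_linear (frechet_derivative f (at x))" for x
    using D(1) by (rule has_derivative_bounded_linear)
  have *: "((\<lambda>x. f (a + r *\<^sub>R x)) has_derivative
      (\<lambda>h. r * frechet_derivative f (at (a + r *\<^sub>R x)) h)) (at x)" for x
  proof -
    have "((\<lambda>x. f (a + r *\<^sub>R x)) has_derivative
      (\<lambda>h. frechet_derivative f (at (a + r *\<^sub>R x)) (0 + r *\<^sub>R h))) (at x)"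
      by (rule has_derivative_compose[OF _ D(1)]) (auto intro!: derivative_eq_intros)
    then show ?thesis
      by (simp add: linear_scale[OF bounded_linear.linear[OF lin]])
  qed
  show ?case
    by (rule times_cont_diff_SucI, rule *, rule times_cont_diff_mult)
      (auto intro!: times_cont_diff_const Suc.IH D)
qed

text \<open>The derivative 1 - tanh^2 is a polynomial in tanh, so the induction on the order closes
  on tanh itself. It is spelled with sums and products only, to which the closure rules
  apply.\<close>

lemma times_cont_diff_tanh:
  fixes f :: "'a::euclidean_space \<Rightarrow> real"
  shows "times_cont_diff k f \<Longrightarrow> times_cont_diff k (\<lambda>x. tanh (f x))"
proof (induction k)
  case 0
  then show ?case by (auto intro!: continuous_intros)
next
  case (Suc k)
  note D = times_cont_diff_SucD[OF Suc.prems]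
  have *: "((\<lambda>x. tanh (f x)) has_derivative
      (\<lambda>h. (1 + (- 1) * (tanh (f x) * tanh (f x))) * frechet_derivative f (at x) h)) (at x)" for x
  proof -
    have "(tanh has_field_derivative 1 - (tanh (f x))\<^sup>2) (at (f x))"
      by (auto intro!: derivative_eq_intros)
    then show ?thesis
      using has_derivative_compose[OF D(1), of tanh "(*) (1 - (tanh (f x))\<^sup>2)" x]
      by (simp add: power2_eq_square has_field_derivative_def)
  qed
  have "times_cont_diff k (\<lambda>x. tanh (f x))"
    by (rule Suc.IH[OF times_cont_diff_decr[OF Suc.prems]])
  then show ?case
    by (intro times_cont_diff_SucI[OF *] times_cont_diff_add times_cont_diff_mult
        times_cont_diff_const D)
qed

lemma has_derivative_ln_cosh:
  assumes "(f has_derivative f') (at x)"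
  shows "((\<lambda>x. ln (cosh (f x :: real))) has_derivative (\<lambda>h. tanh (f x) * f' h)) (at x)"
proof -
  have "((\<lambda>t. ln (cosh t)) has_field_derivative tanh t) (at t)" for t :: real
    by (auto intro!: derivative_eq_intros simp: tanh_def)
  then show ?thesis
    using has_derivative_compose[OF assms, of "\<lambda>t. ln (cosh t)" "(*) (tanh (f x))"]
    by (simp add: has_field_derivative_def)
qed

lemma times_cont_diff_ln_cosh:
  fixes f :: "'a::euclidean_space \<Rightarrow> real"
  assumes "times_cont_diff k f"
  shows "times_cont_diff k (\<lambda>x. ln (cosh (f x)))"
proof (cases k)
  case 0
  then show ?thesis using assms by (auto intro!: continuous_intros)
next
  case (Suc j)
  note D = times_cont_diff_SucD[OF assms[unfolded Suc]]
  show ?thesis unfolding Suc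
    by (rule times_cont_diff_SucI, rule has_derivative_ln_cosh[OF D(1)])
      (intro times_cont_diff_mult times_cont_diff_tanh D
        times_cont_diff_decr[OF assms[unfolded Suc]])
qed

lemma gradient_eqI:
  assumes "(f has_derivative f') (at x)" "\<And>h. f' h = g \<bullet> h"
  shows "gradient f x = g"
  using frechet_derivative_at[OF assms(1), symmetric] unfolding gradient_def
  by (simp add: assms(2) euclidean_representation)

lemma smooth_has_derivative:
  assumes "smooth f"
  shows "(f has_derivative (\<lambda>h. gradient f x \<bullet> h)) (at x)"
proof -
  have D: "(f has_derivative frechet_derivative f (at x)) (at x)"
    using times_cont_diff_SucD(1) assms by blast
  then have lin: "linear (frechet_derivative f (at x))"
    by (rule has_derivative_linear)
  have "frechet_derivative f (at x) h = gradient f x \<bullet> h" for h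
  proof -
    have "frechet_derivative f (at x) h = frechet_derivative f (at x) (\<Sum>b\<in>Basis. (h \<bullet> b) *\<^sub>R b)"
      by (simp add: euclidean_representation)
    also have "\<dots> = (\<Sum>b\<in>Basis. (h \<bullet> b) * frechet_derivative f (at x) b)"
      using lin by (simp add: linear_sum linear_scale)
    finally show ?thesis
      by (simp add: gradient_def inner_sum_left inner_sum_right inner_commute mult.commute)
  qed
  then have "frechet_derivative f (at x) = (\<lambda>h. gradient f x \<bullet> h)" by (rule ext)
  then show ?thesis using D by simp
qed

lemma smooth_continuous_on_gradient:
  assumes "smooth f"
  shows "continuous_on S (gradient f)"
proof -
  have "continuous_on UNIV (\<lambda>x. frechet_derivative f (at x) b)" if "b \<in> Basis" for b
    using times_cont_diff_SucD(2)[of 0 f b] assms that by auto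
  then have "continuous_on UNIV (\<lambda>x. \<Sum>b\<in>Basis. frechet_derivative f (at x) b *\<^sub>R b)"
    by (intro continuous_intros)
  then have "continuous_on UNIV (gradient f)"
    by (simp add: gradient_def[abs_def])
  then show ?thesis by (rule continuous_on_subset) simp
qed

lemma smooth_continuous_on: "smooth f \<Longrightarrow> continuous_on S f"
  using times_cont_diff.simps(1) continuous_on_subset by blast

lemma gradient_add:
  assumes "smooth f" "smooth g"
  shows "gradient (\<lambda>x. f x + g x) x = gradient f x + gradient g x"
  by (rule gradient_eqI, rule has_derivative_add[OF smooth_has_derivative smooth_has_derivative])
    (use assms in \<open>auto simp: inner_add_left\<close>)

lemma gradient_mult:
  assumes "smooth f" "smooth g"
  shows "gradient (\<lambda>x. f x * g x) x = f x *\<^sub>R gradient g x + g x *\<^sub>R gradient f x"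
  by (rule gradient_eqI, rule has_derivative_mult[OF smooth_has_derivative smooth_has_derivative])
    (use assms in \<open>auto simp: inner_add_left mult.commute\<close>)

lemma gradient_const: "gradient (\<lambda>x. c) x = 0"
  by (rule gradient_eqI, rule has_derivative_const) simp

lemma gradient_compose:
  assumes "smooth f" "(g has_real_derivative d) (at (f x))"
  shows "gradient (\<lambda>x. g (f x)) x = d *\<^sub>R gradient f x"
  by (rule gradient_eqI, rule has_derivative_compose[OF smooth_has_derivative[OF assms(1)]
      assms(2)[unfolded has_field_derivative_def]]) simp

lemma compact_closure_subset:
  assumes "compact (closure {x. f x \<noteq> 0})" "{x. g x \<noteq> 0} \<subseteq> {x. f x \<noteq> 0}"
  shows "compact (closure {x. g x \<noteq> 0})"
  using compact_Int_closed[OF assms(1) closed_closure[of "{x. g x \<noteq> 0}"]]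
    closure_mono[OF assms(2)] by (simp add: inf.absorb2)

lemma continuous_compact_support_Lp_fun:
  fixes f :: "'a::euclidean_space \<Rightarrow> 'b::euclidean_space"
  assumes "continuous_on UNIV f" "compact K" "\<And>x. x \<notin> K \<Longrightarrow> f x = 0" "0 < p"
  shows "Lp_fun lebesgue p f"
proof -
  obtain B where B: "0 < B" "\<And>x. x \<in> K \<Longrightarrow> norm (f x) \<le> B"
  proof -
    have "compact (f ` K)"
      by (intro compact_continuous_image continuous_on_subset[OF assms(1)] assms(2)) simp
    then obtain B where "0 < B" "\<forall>y\<in>f ` K. norm y \<le> B"
      using compact_imp_bounded bounded_pos by metis
    then show ?thesis using that by blast
  qed
  have m: "f \<in> borel_measurable lebesgue"
    by (rule measurable_completion) (use borel_measurable_continuous_onI[OF assms(1)] in simp)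
  have "powr_norm_on lebesgue p f \<le> (\<integral>\<^sup>+x. ennreal (B powr p) * indicator K x \<partial>lebesgue)"
  proof (intro nn_integral_mono)
    fix x
    show "ennreal (norm (f x) powr p) \<le> ennreal (B powr p) * indicator K x"
      using B assms(3,4) by (cases "x \<in> K") (auto intro!: ennreal_leI powr_mono2)
  qed
  also have "\<dots> = ennreal (B powr p) * emeasure lebesgue K"
    using assms(2) by (intro nn_integral_cmult_indicator) (simp add: lmeasurable_compact fmeasurableD)
  also have "\<dots> < \<infinity>"
    using assms(2) lmeasurable_compact by (auto simp: ennreal_mult_less_top fmeasurable_def)
  finally show ?thesis using m by (simp add: Lp_fun_def)
qed

lemma Lp_fun_lebesgue_on:
  assumes "Lp_fun lebesgue p f" "S \<in> sets lebesgue"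
  shows "Lp_fun (lebesgue_on S) p f"
proof -
  have "powr_norm_on (lebesgue_on S) p f \<le> powr_norm_on lebesgue p f"
    using assms(2) by (subst nn_integral_restrict_space)
      (auto intro!: nn_integral_mono simp: indicator_def)
  then show ?thesis using assms
    by (auto simp: Lp_fun_def measurable_restrict_space1 intro: le_less_trans)
qed

lemma test_functionD:
  assumes "test_function \<phi>"
  shows "smooth \<phi>" "compact (closure {x. \<phi> x \<noteq> 0})"
  using assms by (auto simp: test_function_def)

lemma halfspace_measurable [measurable]: "(halfspace :: ((real^'m) \<times> real) set) \<in> sets lebesgue"
proof -
  have "closed (halfspace :: ((real^'m) \<times> real) set)"
    unfolding halfspace_def by (intro closed_Collect_le continuous_intros)
  then show ?thesis by simp
qed

lemma test_function_Lp_fun: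
  assumes "test_function \<phi>" "0 < p"
  shows "Lp_fun lebesgue p \<phi>"
  using test_functionD[OF assms(1)] assms(2) closure_subset[of "{x. \<phi> x \<noteq> 0}"]
    smooth_continuous_on[OF test_functionD(1)[OF assms(1)]]
  by (intro continuous_compact_support_Lp_fun[where K = "closure {x. \<phi> x \<noteq> 0}"]) auto

lemma gradient_eq_0_outside:
  assumes "x \<notin> closure {x. \<phi> x \<noteq> 0}"
  shows "gradient \<phi> x = 0"
proof (rule gradient_eqI)
  show "(\<phi> has_derivative (\<lambda>_. 0)) (at x)"
    by (rule has_derivative_transform_within_open[of "\<lambda>_. 0" _ _ _ "- closure {x. \<phi> x \<noteq> 0}"])
      (use assms closure_subset[of "{x. \<phi> x \<noteq> 0}"] in auto)
qed simp

lemma test_function_gradient_Lp_fun: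
  assumes "test_function \<phi>" "0 < p"
  shows "Lp_fun lebesgue p (gradient \<phi>)"
  using test_functionD[OF assms(1)] assms(2) gradient_eq_0_outside
  by (intro continuous_compact_support_Lp_fun[where K = "closure {x. \<phi> x \<noteq> 0}"])
    (auto intro: smooth_continuous_on_gradient)

lemma test_function_trace_Lp_fun:
  assumes "test_function \<phi>" "0 < p"
  shows "Lp_fun lebesgue p (\<lambda>y. \<phi> (y, 0))"
proof (rule continuous_compact_support_Lp_fun[where K = "fst ` closure {x. \<phi> x \<noteq> 0}"])
  show "continuous_on UNIV (\<lambda>y. \<phi> (y, 0))"
    by (rule continuous_on_compose2[OF smooth_continuous_on[OF test_functionD(1)[OF assms(1)], of UNIV]])
      (auto intro!: continuous_intros)
  show "compact (fst ` closure {x. \<phi> x \<noteq> 0})"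
    by (intro compact_continuous_image test_functionD(2)[OF assms(1)] continuous_intros)
  show "\<phi> (y, 0) = 0" if "y \<notin> fst ` closure {x. \<phi> x \<noteq> 0}" for y
    using that closure_subset[of "{x. \<phi> x \<noteq> 0}"] by force
qed (fact assms(2))

lemma test_function_add:
  assumes "test_function f" "test_function g"
  shows "test_function (\<lambda>x. f x + g x)"
proof -
  have "closure {x. f x + g x \<noteq> 0} \<subseteq> closure {x. f x \<noteq> 0} \<union> closure {x. g x \<noteq> 0}"
    unfolding closure_Un[symmetric] by (rule closure_mono) auto
  then have "compact (closure {x. f x + g x \<noteq> 0})"
    using compact_Int_closed[OF compact_Un[OF test_functionD(2)[OF assms(1)] test_functionD(2)[OF assms(2)]]
        closed_closure[of "{x. f x + g x \<noteq> 0}"]]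
    by (simp add: inf.absorb2)
  then show ?thesis using test_functionD(1)[OF assms(1)] test_functionD(1)[OF assms(2)]
    by (auto simp: test_function_def intro!: times_cont_diff_add)
qed

lemma test_function_mult:
  assumes "smooth f" "test_function g"
  shows "test_function (\<lambda>x. f x * g x)"
proof -
  have "compact (closure {x. f x * g x \<noteq> 0})"
    by (rule compact_closure_subset[OF test_functionD(2)[OF assms(2)]]) auto
  then show ?thesis using assms(1) test_functionD(1)[OF assms(2)]
    by (auto simp only: test_function_def intro!: times_cont_diff_mult)
qed

lemma test_function_cmult: "test_function f \<Longrightarrow> test_function (\<lambda>x. c * f x)"
  by (rule test_function_mult) (auto intro: times_cont_diff_const)

section \<open>The space of limits of test functions\<close>

lemma ambient_dim_eq: "ambient_dim TYPE('m::finite) = CARD('m) + 1"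
  by (simp add: ambient_dim_def)

lemma one_less_sobolev_exponent:
  "2 \<le> CARD('m::finite) \<Longrightarrow> 1 < sobolev_exponent TYPE('m)"
  by (auto simp: sobolev_exponent_def ambient_dim_eq field_simps)

lemma two_less_trace_exponent:
  "2 \<le> CARD('m::finite) \<Longrightarrow> 2 < trace_exponent TYPE('m)"
  by (auto simp: trace_exponent_def ambient_dim_eq field_simps)

text \<open>Names the approximating sequence, so that constructions can act on each of its
  members.\<close>

definition D12_approx ::
  "(nat \<Rightarrow> (real^'m) \<times> real \<Rightarrow> real) \<Rightarrow> ((real^'m) \<times> real \<Rightarrow> real) \<Rightarrow>
   ((real^'m) \<times> real \<Rightarrow> (real^'m) \<times> real) \<Rightarrow> (real^'m \<Rightarrow> real) \<Rightarrow> bool" where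
  "D12_approx \<phi> u G \<tau> \<longleftrightarrow> (\<forall>k. test_function (\<phi> k)) \<and>
     Lp_tendsto (lebesgue_on halfspace) 2 (\<lambda>k. gradient (\<phi> k)) G \<and>
     Lp_tendsto (lebesgue_on halfspace) (sobolev_exponent TYPE('m)) \<phi> u \<and>
     Lp_tendsto lebesgue (trace_exponent TYPE('m)) (\<lambda>k y. \<phi> k (y, 0)) \<tau>"

lemma D12_limit_iff:
  "D12_limit u G \<tau> \<longleftrightarrow> u \<in> borel_measurable (lebesgue_on halfspace) \<and>
     G \<in> borel_measurable (lebesgue_on halfspace) \<and> \<tau> \<in> borel_measurable lebesgue \<and>
     (\<exists>\<phi>. D12_approx \<phi> u G \<tau>)"
  by (simp add: D12_limit_def D12_approx_def Lp_tendsto_def)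

lemma D12_limitI:
  "u \<in> borel_measurable (lebesgue_on halfspace) \<Longrightarrow> G \<in> borel_measurable (lebesgue_on halfspace) \<Longrightarrow>
   \<tau> \<in> borel_measurable lebesgue \<Longrightarrow> D12_approx \<phi> u G \<tau> \<Longrightarrow> D12_limit u G \<tau>"
  unfolding D12_limit_iff by blast

lemma D12_limit_measurable:
  assumes "D12_limit u G \<tau>"
  shows "u \<in> borel_measurable (lebesgue_on halfspace)"
    and "G \<in> borel_measurable (lebesgue_on halfspace)" and "\<tau> \<in> borel_measurable lebesgue"
  using assms by (auto simp: D12_limit_iff)

lemma test_function_Lp_fun_halfspace:
  assumes "test_function \<phi>" "0 < p"
  shows "Lp_fun (lebesgue_on halfspace) p \<phi>" "Lp_fun (lebesgue_on halfspace) p (gradient \<phi>)"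
  using test_function_Lp_fun[OF assms] test_function_gradient_Lp_fun[OF assms]
  by (auto intro: Lp_fun_lebesgue_on)

lemma test_function_measurable:
  assumes "test_function \<phi>"
  shows "\<phi> \<in> borel_measurable (lebesgue_on halfspace)"
    and "gradient \<phi> \<in> borel_measurable (lebesgue_on halfspace)"
    and "(\<lambda>y. \<phi> (y, 0)) \<in> borel_measurable lebesgue"
  using test_function_Lp_fun_halfspace[OF assms, of 2] test_function_trace_Lp_fun[OF assms, of 2]
  by (auto dest: Lp_fun_measurable)

lemma D12_limit_Lp_fun:
  fixes u :: "(real^'m) \<times> real \<Rightarrow> real"
  assumes "2 \<le> CARD('m)" "D12_limit u G \<tau>"
  shows "Lp_fun (lebesgue_on halfspace) 2 G"
    and "Lp_fun (lebesgue_on halfspace) (sobolev_exponent TYPE('m)) u"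
    and "Lp_fun lebesgue (trace_exponent TYPE('m)) \<tau>"
proof -
  obtain \<phi> where \<phi>: "D12_approx \<phi> u G \<tau>" using assms(2) by (auto simp: D12_limit_iff)
  note m = D12_limit_measurable[OF assms(2)]
  note e = one_less_sobolev_exponent[OF assms(1)] two_less_trace_exponent[OF assms(1)]
  show "Lp_fun (lebesgue_on halfspace) 2 G"
    "Lp_fun (lebesgue_on halfspace) (sobolev_exponent TYPE('m)) u"
    "Lp_fun lebesgue (trace_exponent TYPE('m)) \<tau>"
    using \<phi> m e unfolding D12_approx_def
    by (auto intro: Lp_tendsto_limit_Lp_fun[OF _ _ test_function_Lp_fun_halfspace(2)]
        Lp_tendsto_limit_Lp_fun[OF _ _ test_function_Lp_fun_halfspace(1)]
        Lp_tendsto_limit_Lp_fun[OF _ _ test_function_trace_Lp_fun])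
qed

lemma Lp_tendsto_const: "0 < p \<Longrightarrow> Lp_tendsto M p (\<lambda>k. f) f"
  by (simp add: Lp_tendsto_def)

lemma D12_limit_test_function:
  fixes \<phi> :: "(real^'m) \<times> real \<Rightarrow> real"
  assumes "2 \<le> CARD('m)" "test_function \<phi>"
  shows "D12_limit \<phi> (gradient \<phi>) (\<lambda>y. \<phi> (y, 0))"
  by (rule D12_limitI[where \<phi> = "\<lambda>k. \<phi>"])
    (use test_function_measurable[OF assms(2)] assms(2) one_less_sobolev_exponent[OF assms(1)]
      two_less_trace_exponent[OF assms(1)] in \<open>auto simp: D12_approx_def intro!: Lp_tendsto_const\<close>)

lemma D12_limit_add:
  fixes u v :: "(real^'m) \<times> real \<Rightarrow> real"
  assumes "2 \<le> CARD('m)" "D12_limit u G \<tau>" "D12_limit v H \<sigma>"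
  shows "D12_limit (\<lambda>x. u x + v x) (\<lambda>x. G x + H x) (\<lambda>y. \<tau> y + \<sigma> y)"
proof -
  obtain \<phi> \<psi> where \<phi>: "D12_approx \<phi> u G \<tau>" and \<psi>: "D12_approx \<psi> v H \<sigma>"
    using assms(2,3) by (auto simp: D12_limit_iff)
  note m [measurable] = D12_limit_measurable[OF assms(2)] D12_limit_measurable[OF assms(3)]
  have t: "test_function (\<phi> k)" "test_function (\<psi> k)" for k
    using \<phi> \<psi> by (auto simp: D12_approx_def)
  note e = one_less_sobolev_exponent[OF assms(1)] two_less_trace_exponent[OF assms(1)]
  have g: "gradient (\<lambda>x. \<phi> k x + \<psi> k x) = (\<lambda>x. gradient (\<phi> k) x + gradient (\<psi> k) x)" for k
    using gradient_add[OF test_functionD(1) test_functionD(1), OF t] by auto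
  have "D12_approx (\<lambda>k x. \<phi> k x + \<psi> k x) (\<lambda>x. u x + v x) (\<lambda>x. G x + H x) (\<lambda>y. \<tau> y + \<sigma> y)"
    unfolding D12_approx_def g
    using \<phi> \<psi> e unfolding D12_approx_def
    by (intro conjI allI Lp_tendsto_add m test_function_add t test_function_measurable[OF t(1)] test_function_measurable[OF t(2)]) auto
  then show ?thesis by (intro D12_limitI) auto
qed

lemma D12_limit_cmult:
  fixes u :: "(real^'m) \<times> real \<Rightarrow> real"
  assumes "2 \<le> CARD('m)" "D12_limit u G \<tau>"
  shows "D12_limit (\<lambda>x. c * u x) (\<lambda>x. c *\<^sub>R G x) (\<lambda>y. c * \<tau> y)"
proof -
  obtain \<phi> where \<phi>: "D12_approx \<phi> u G \<tau>" using assms(2) by (auto simp: D12_limit_iff)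
  note m [measurable] = D12_limit_measurable[OF assms(2)]
  have t: "test_function (\<phi> k)" for k
    using \<phi> by (auto simp: D12_approx_def)
  note e = one_less_sobolev_exponent[OF assms(1)] two_less_trace_exponent[OF assms(1)]
  have g: "gradient (\<lambda>x. c * \<phi> k x) = (\<lambda>x. c *\<^sub>R gradient (\<phi> k) x)" for k
    using gradient_mult[OF _ test_functionD(1), OF _ t, of "\<lambda>_. c"]
    by (auto simp: gradient_const times_cont_diff_const)
  have "D12_approx (\<lambda>k x. c * \<phi> k x) (\<lambda>x. c * u x) (\<lambda>x. c *\<^sub>R G x) (\<lambda>y. c * \<tau> y)"
    unfolding D12_approx_def g
    using \<phi> e unfolding D12_approx_def
    by (intro conjI allI Lp_tendsto_scaleR Lp_tendsto_scaleR[where 'b = real, unfolded real_scaleR_def]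
        m test_function_cmult t test_function_measurable[OF t]) auto
  then show ?thesis by (intro D12_limitI) auto
qed

lemma Lp_tendsto_diagonal:
  assumes "0 < p" "Lp_tendsto M p u v"
    and "\<And>j. (powr_norm_on M p (\<lambda>x. f j x - u j x)) < ennreal (1 / real (Suc j))"
    and [measurable]: "\<And>j. f j \<in> borel_measurable M" "\<And>j. u j \<in> borel_measurable M"
      "v \<in> borel_measurable M"
  shows "Lp_tendsto M p f v"
proof -
  have lim: "(\<lambda>j. ennreal (1 / real (Suc j))) \<longlonglongrightarrow> ennreal 0"
    using LIMSEQ_inverse_real_of_nat by (intro tendsto_ennrealI) (simp add: inverse_eq_divide)
  have "Lp_tendsto M p (\<lambda>j x. f j x - u j x) (\<lambda>_. 0)"
    unfolding Lp_tendsto_def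
    by (rule tendsto_sandwich[OF _ _ tendsto_const])
      (use lim assms(3) in \<open>auto intro!: always_eventually simp: less_imp_le\<close>)
  from Lp_tendsto_add[OF assms(1) this assms(2)] show ?thesis by simp
qed

text \<open>Diagonal choice: the j-th test function lies within 1/(j+1) of the j-th element in all
  three senses at once. Nonsmooth functions such as |u| become reachable through smooth
  compositions.\<close>

lemma D12_limit_closed:
  fixes u :: "(real^'m) \<times> real \<Rightarrow> real"
  assumes dim: "2 \<le> CARD('m)" and lim: "\<And>j. D12_limit (u' j) (G' j) (\<tau>' j)"
    and m: "u \<in> borel_measurable (lebesgue_on halfspace)"
      "G \<in> borel_measurable (lebesgue_on halfspace)" "\<tau> \<in> borel_measurable lebesgue"
    and conv: "Lp_tendsto (lebesgue_on halfspace) 2 G' G"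
      "Lp_tendsto (lebesgue_on halfspace) (sobolev_exponent TYPE('m)) u' u"
      "Lp_tendsto lebesgue (trace_exponent TYPE('m)) \<tau>' \<tau>"
  shows "D12_limit u G \<tau>"
proof -
  let ?p = "sobolev_exponent TYPE('m)" and ?q = "trace_exponent TYPE('m)"
  let ?H = "lebesgue_on halfspace :: ((real^'m) \<times> real) measure"
  note e = one_less_sobolev_exponent[OF dim] two_less_trace_exponent[OF dim]
  \<comment> \<open>One predicate for the three conditions, so that a single choice of test function
    meets all of them.\<close>
  define P where "P j \<psi> \<longleftrightarrow> test_function \<psi> \<and>
     powr_norm_on ?H 2 (\<lambda>x. gradient \<psi> x - G' j x) < ennreal (1 / real (Suc j)) \<and>
     powr_norm_on ?H ?p (\<lambda>x. \<psi> x - u' j x) < ennreal (1 / real (Suc j)) \<and>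
     powr_norm_on lebesgue ?q (\<lambda>y. \<psi> (y, 0) - \<tau>' j y) < ennreal (1 / real (Suc j))" for j \<psi>
  have "\<exists>\<psi>. P j \<psi>" for j
  proof -
    obtain \<phi> where \<phi>: "D12_approx \<phi> (u' j) (G' j) (\<tau>' j)" using lim[of j] by (auto simp: D12_limit_iff)
    have pos: "0 < ennreal (1 / real (Suc j))" by simp
    have "\<forall>\<^sub>F k in sequentially.
      (powr_norm_on ?H 2 (\<lambda>x. gradient (\<phi> k) x - G' j x)) < ennreal (1 / real (Suc j)) \<and>
     powr_norm_on ?H ?p (\<lambda>x. \<phi> k x - u' j x) < ennreal (1 / real (Suc j)) \<and>
     powr_norm_on lebesgue ?q (\<lambda>y. \<phi> k (y, 0) - \<tau>' j y) < ennreal (1 / real (Suc j))"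
      using \<phi> unfolding D12_approx_def Lp_tendsto_def
      by (intro eventually_conj order_tendstoD(2)[OF _ pos]) auto
    then obtain k where "powr_norm_on ?H 2 (\<lambda>x. gradient (\<phi> k) x - G' j x) < ennreal (1 / real (Suc j)) \<and>
     powr_norm_on ?H ?p (\<lambda>x. \<phi> k x - u' j x) < ennreal (1 / real (Suc j)) \<and>
     powr_norm_on lebesgue ?q (\<lambda>y. \<phi> k (y, 0) - \<tau>' j y) < ennreal (1 / real (Suc j))"
      unfolding eventually_sequentially by (meson le_refl)
    moreover have "test_function (\<phi> k)" using \<phi> by (simp add: D12_approx_def)
    ultimately show ?thesis unfolding P_def by (intro exI[of _ "\<phi> k"]) blast
  qed
  then obtain \<psi> where "\<And>j. P j (\<psi> j)" by metis
  then have t: "\<And>j. test_function (\<psi> j)"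
    and \<psi>: "\<And>j. (powr_norm_on ?H 2 (\<lambda>x. gradient (\<psi> j) x - G' j x)) < ennreal (1 / real (Suc j))"
     "\<And>j. (powr_norm_on ?H ?p (\<lambda>x. \<psi> j x - u' j x)) < ennreal (1 / real (Suc j))"
     "\<And>j. (powr_norm_on lebesgue ?q (\<lambda>y. \<psi> j (y, 0) - \<tau>' j y)) < ennreal (1 / real (Suc j))"
    unfolding P_def by blast+
  note m' = D12_limit_measurable[OF lim] test_function_measurable[OF t]
  have "D12_approx \<psi> u G \<tau>" unfolding D12_approx_def
  proof (intro conjI allI t)
    show "Lp_tendsto ?H 2 (\<lambda>k. gradient (\<psi> k)) G"
      by (rule Lp_tendsto_diagonal[OF _ conv(1) \<psi>(1)]) (auto intro!: m m')
    show "Lp_tendsto ?H ?p \<psi> u"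
      by (rule Lp_tendsto_diagonal[OF _ conv(2) \<psi>(2)]) (use e in \<open>auto intro!: m m'\<close>)
    show "Lp_tendsto lebesgue ?q (\<lambda>k y. \<psi> k (y, 0)) \<tau>"
      by (rule Lp_tendsto_diagonal[OF _ conv(3) \<psi>(3)]) (use e in \<open>auto intro!: m m'\<close>)
  qed
  then show ?thesis by (intro D12_limitI m)
qed

text \<open>Chain and product rule. The function and its trace are controlled by the Lipschitz bound
  \<open>B * L\<close>; the term with \<open>g'\<close> times \<open>G\<close> has no such control
  and goes through almost everywhere and dominated convergence. The function \<open>\<beta>\<close>
  dominates the term with the gradient of \<open>b\<close>: it may be 0 for constant
  \<open>b\<close>, which admits unbounded \<open>g\<close>, and the norm of that gradient if
  \<open>g\<close> is bounded by 1. The condition \<open>g 0 = 0\<close> preserves compact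
  supports.\<close>

lemma D12_limit_mult_compose:
  fixes u :: "(real^'m) \<times> real \<Rightarrow> real"
  assumes dim: "2 \<le> CARD('m)" and u: "D12_limit u G \<tau>"
    and b: "smooth b" "\<And>x. \<bar>b x\<bar> \<le> B"
    and g: "\<And>f :: (real^'m) \<times> real \<Rightarrow> real. smooth f \<Longrightarrow> smooth (\<lambda>x. g (f x))"
      "\<And>t. (g has_real_derivative g' t) (at t)" "continuous_on UNIV g'" "\<And>t. \<bar>g' t\<bar> \<le> L" "g 0 = 0"
    and \<beta>: "Lp_fun (lebesgue_on halfspace) 2 \<beta>" "\<And>t x. \<bar>g t\<bar> * norm (gradient b x) \<le> \<beta> x"
  shows "D12_limit (\<lambda>x. b x * g (u x)) (\<lambda>x. (b x * g' (u x)) *\<^sub>R G x + g (u x) *\<^sub>R gradient b x)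
     (\<lambda>y. b (y, 0) * g (\<tau> y))"
proof -
  let ?p = "sobolev_exponent TYPE('m)" and ?q = "trace_exponent TYPE('m)"
  let ?H = "lebesgue_on halfspace :: ((real^'m) \<times> real) measure"
  note e = one_less_sobolev_exponent[OF dim] two_less_trace_exponent[OF dim]
  obtain \<phi>0 where \<phi>0: "D12_approx \<phi>0 u G \<tau>" using u by (auto simp: D12_limit_iff)
  note Lp = D12_limit_Lp_fun[OF dim u]
  \<comment> \<open>Almost everywhere convergence is extracted in the half-space only; the boundary
    values are left to the Lipschitz bound.\<close>
  obtain r where r: "strict_mono r" "AE x in ?H. (\<lambda>k. \<phi>0 (r k) x) \<longlonglongrightarrow> u x"
    by (rule Lp_tendsto_AE_subseq[of ?H ?p \<phi>0 u])
      (use \<phi>0 e Lp in \<open>auto simp: D12_approx_def intro: test_function_Lp_fun_halfspace\<close>)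
  define \<phi> where "\<phi> k = \<phi>0 (r k)" for k
  have t: "test_function (\<phi> k)" for k using \<phi>0 by (auto simp: \<phi>_def D12_approx_def)
  have c1: "Lp_tendsto ?H 2 (\<lambda>k. gradient (\<phi> k)) G"
    using \<phi>0 r Lp_tendsto_subseq[of ?H 2 "\<lambda>k. gradient (\<phi>0 k)" G r]
    by (auto simp: D12_approx_def \<phi>_def)
  have c2: "Lp_tendsto ?H ?p \<phi> u"
    using \<phi>0 r Lp_tendsto_subseq[of ?H ?p \<phi>0 u r] by (auto simp: D12_approx_def \<phi>_def[abs_def])
  have c3: "Lp_tendsto lebesgue ?q (\<lambda>k y. \<phi> k (y, 0)) \<tau>"
    using \<phi>0 r Lp_tendsto_subseq[of lebesgue ?q "\<lambda>k y. \<phi>0 k (y, 0)" \<tau> r]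
    by (auto simp: D12_approx_def \<phi>_def)
  have ae: "AE x in ?H. (\<lambda>k. \<phi> k x) \<longlonglongrightarrow> u x" using r by (simp add: \<phi>_def)
  note [measurable] = D12_limit_measurable[OF u] test_function_measurable[OF t]
  have B: "0 \<le> B" using b(2)[of undefined] by linarith
  have L: "0 \<le> L" using g(4)[of 0] by linarith
  have lip: "\<bar>g s - g t\<bar> \<le> L * \<bar>s - t\<bar>" for s t
    using field_differentiable_bound[of UNIV g g' L s t] g(2,4) by (simp add: dist_norm)
  have gc: "continuous_on UNIV g"
    using g(2) by (meson DERIV_continuous_on has_field_derivative_at_within)
  note [measurable] = borel_measurable_continuous_onI[OF gc] borel_measurable_continuous_onI[OF g(3)]
  have bm [measurable]: "b \<in> borel_measurable ?H" "gradient b \<in> borel_measurable ?H"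
    using b(1) by (auto intro!: measurable_restrict_space1 measurable_completion
        borel_measurable_continuous_onI smooth_continuous_on smooth_continuous_on_gradient)
  have bm' [measurable]: "(\<lambda>y. b (y, 0)) \<in> borel_measurable lebesgue"
  proof -
    have "continuous_on UNIV (\<lambda>y. b (y, 0))"
      by (rule continuous_on_compose2[OF smooth_continuous_on[OF b(1), of UNIV]])
        (auto intro!: continuous_intros)
    then show ?thesis
      by (auto intro!: measurable_completion borel_measurable_continuous_onI)
  qed
  have tg: "test_function (\<lambda>x. g (\<phi> k x))" for k
  proof -
    have "compact (closure {x. g (\<phi> k x) \<noteq> 0})"
      using g(5) by (intro compact_closure_subset[OF test_functionD(2)[OF t[of k]]]) auto
    then show ?thesis using g(1)[OF test_functionD(1)[OF t]] by (simp add: test_function_def)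
  qed
  have tt: "test_function (\<lambda>x. b x * g (\<phi> k x))" for k
    by (rule test_function_mult[OF b(1) tg])
  \<comment> \<open>Adding and subtracting \<open>G\<close> separates the convergence of the
    gradients, where the coefficient is merely bounded, from the convergence of the coefficient,
    where \<open>G\<close> is fixed.\<close>
  have grad: "gradient (\<lambda>x. b x * g (\<phi> k x))
    = (\<lambda>x. ((b x * g' (\<phi> k x)) *\<^sub>R (gradient (\<phi> k) x - G x) + (b x * g' (\<phi> k x)) *\<^sub>R G x)
      + g (\<phi> k x) *\<^sub>R gradient b x)" for k
    using gradient_mult[OF b(1) test_functionD(1)[OF tg[of k]]]
      gradient_compose[OF test_functionD(1)[OF t[of k]] g(2)]
    by (auto simp: algebra_simps)
  have bg: "\<bar>b x * g' s\<bar> \<le> B * L" for x s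
    unfolding abs_mult by (intro mult_mono b g B) auto
  have 1: "Lp_tendsto ?H 2 (\<lambda>k x. (b x * g' (\<phi> k x)) *\<^sub>R (gradient (\<phi> k) x - G x)) (\<lambda>_. 0)"
    by (rule Lp_tendsto_le[OF c1, where c = "B * L"])
      (use bg in \<open>auto intro!: mult_right_mono\<close>)
  have 2: "Lp_tendsto ?H 2 (\<lambda>k x. (b x * g' (\<phi> k x)) *\<^sub>R G x) (\<lambda>x. (b x * g' (u x)) *\<^sub>R G x)"
  proof (rule Lp_tendsto_dominated[where F = "\<lambda>x. (2 * B * L) *\<^sub>R G x"])
    show "Lp_fun ?H 2 (\<lambda>x. (2 * B * L) *\<^sub>R G x)" by (intro Lp_fun_scaleR Lp) simp
    show "AE x in ?H. (\<lambda>k. (b x * g' (\<phi> k x)) *\<^sub>R G x) \<longlonglongrightarrow> (b x * g' (u x)) *\<^sub>R G x"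
      using ae
    proof eventually_elim
      case (elim x)
      have "isCont g' (u x)" using g(3) by (simp add: continuous_on_eq_continuous_at)
      then show ?case using elim by (intro tendsto_intros isCont_tendsto_compose[of _ g'])
    qed
    show "norm ((b x * g' (\<phi> k x)) *\<^sub>R G x - (b x * g' (u x)) *\<^sub>R G x) \<le> norm ((2 * B * L) *\<^sub>R G x)"
      for k x
    proof -
      have "\<bar>b x * g' (\<phi> k x) - b x * g' (u x)\<bar> \<le> \<bar>2 * B * L\<bar>"
        using bg[of x "\<phi> k x"] bg[of x "u x"] by linarith
      then show ?thesis by (auto simp flip: scaleR_diff_left intro!: mult_right_mono)
    qed
  qed auto
  have 3: "Lp_tendsto ?H 2 (\<lambda>k x. g (\<phi> k x) *\<^sub>R gradient b x) (\<lambda>x. g (u x) *\<^sub>R gradient b x)"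
  proof (rule Lp_tendsto_dominated[where F = "\<lambda>x. 2 *\<^sub>R \<beta> x"])
    show "Lp_fun ?H 2 (\<lambda>x. 2 *\<^sub>R \<beta> x)" by (intro Lp_fun_scaleR \<beta>) simp
    show "AE x in ?H. (\<lambda>k. g (\<phi> k x) *\<^sub>R gradient b x) \<longlonglongrightarrow> g (u x) *\<^sub>R gradient b x"
      using ae
    proof eventually_elim
      case (elim x)
      have "isCont g (u x)" using gc by (simp add: continuous_on_eq_continuous_at)
      then show ?case using elim by (intro tendsto_intros isCont_tendsto_compose[of _ g])
    qed
    show "norm (g (\<phi> k x) *\<^sub>R gradient b x - g (u x) *\<^sub>R gradient b x) \<le> norm (2 *\<^sub>R \<beta> x)" for k x
      using norm_triangle_ineq4[of "g (\<phi> k x) *\<^sub>R gradient b x" "g (u x) *\<^sub>R gradient b x"]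
        \<beta>(2)[of "\<phi> k x" x] \<beta>(2)[of "u x" x] by simp
  qed auto
  have "Lp_tendsto ?H 2 (\<lambda>k. gradient (\<lambda>x. b x * g (\<phi> k x)))
      (\<lambda>x. (0 + (b x * g' (u x)) *\<^sub>R G x) + g (u x) *\<^sub>R gradient b x)"
    unfolding grad by (intro Lp_tendsto_add 1 2 3) auto
  moreover have lipb: "norm (b x * g s - b x * g t) \<le> B * L * norm (s - t)" for x s t
  proof -
    have "norm (b x * g s - b x * g t) = \<bar>b x\<bar> * \<bar>g s - g t\<bar>"
      by (simp flip: right_diff_distrib abs_mult)
    also have "\<dots> \<le> B * (L * \<bar>s - t\<bar>)" by (intro mult_mono b lip B) auto
    finally show ?thesis by simp
  qed
  have "Lp_tendsto ?H ?p (\<lambda>k x. b x * g (\<phi> k x)) (\<lambda>x. b x * g (u x))"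
    by (rule Lp_tendsto_le[OF c2, where c = "B * L"]) (use lipb e in auto)
  moreover have "Lp_tendsto lebesgue ?q (\<lambda>k y. b (y, 0) * g (\<phi> k (y, 0))) (\<lambda>y. b (y, 0) * g (\<tau> y))"
    by (rule Lp_tendsto_le[OF c3, where c = "B * L"]) (use lipb e in auto)
  ultimately have "D12_approx (\<lambda>k x. b x * g (\<phi> k x)) (\<lambda>x. b x * g (u x))
     (\<lambda>x. (b x * g' (u x)) *\<^sub>R G x + g (u x) *\<^sub>R gradient b x) (\<lambda>y. b (y, 0) * g (\<tau> y))"
    using tt by (simp add: D12_approx_def)
  then show ?thesis by (rule D12_limitI[rotated -1]) auto
qed

section \<open>Absolute value and positive part\<close>

text \<open>cosh s lies between exp |s| / 2 and exp |s|. The defect ln 2 disappears after scaling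
  the argument by k and dividing by k.\<close>

lemma ln_cosh_bounds:
  fixes s :: real
  shows "\<bar>s\<bar> - ln 2 \<le> ln (cosh s)" "ln (cosh s) \<le> \<bar>s\<bar>" "0 \<le> ln (cosh s)"
proof -
  have c: "cosh s = (exp \<bar>s\<bar> + exp (- \<bar>s\<bar>)) / 2"
    by (cases "0 \<le> s") (auto simp: cosh_def)
  have "exp (- \<bar>s\<bar>) \<le> exp \<bar>s\<bar>" by simp
  then have b: "exp \<bar>s\<bar> / 2 \<le> cosh s" "cosh s \<le> exp \<bar>s\<bar>" unfolding c by auto
  have "ln (exp \<bar>s\<bar> / 2) \<le> ln (cosh s)" using b by (intro ln_mono) auto
  then show "\<bar>s\<bar> - ln 2 \<le> ln (cosh s)" by (simp add: ln_div)
  have "ln (cosh s) \<le> ln (exp \<bar>s\<bar>)" using b by (intro ln_mono) auto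
  then show "ln (cosh s) \<le> \<bar>s\<bar>" by simp
  show "0 \<le> ln (cosh s)" by (intro ln_ge_zero cosh_real_ge_1)
qed

lemma tanh_mult_tendsto_sgn:
  fixes t :: real
  shows "(\<lambda>j. tanh (real (Suc j) * t)) \<longlonglongrightarrow> sgn t"
proof -
  have pos: "(\<lambda>j. tanh (real (Suc j) * t)) \<longlonglongrightarrow> 1" if "0 < t" for t :: real
  proof (rule filterlim_compose[OF tanh_real_at_top])
    show "filterlim (\<lambda>j. real (Suc j) * t) at_top sequentially"
      using that by real_asymp
  qed
  consider "t = 0" | "0 < t" | "t < 0" by linarith
  then show ?thesis
  proof cases
    case 3
    then have "(\<lambda>j. - tanh (real (Suc j) * - t)) \<longlonglongrightarrow> - 1"
      by (intro tendsto_minus pos) simp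
    then show ?thesis using 3 by simp
  qed (use pos in auto)
qed

lemma ln_cosh_mult_tendsto_abs:
  fixes t :: real
  shows "(\<lambda>j. ln (cosh (real (Suc j) * t)) / real (Suc j)) \<longlonglongrightarrow> \<bar>t\<bar>"
proof (rule tendsto_sandwich)
  have b: "\<bar>t\<bar> - ln 2 / real (Suc j) \<le> ln (cosh (real (Suc j) * t)) / real (Suc j)"
    "ln (cosh (real (Suc j) * t)) / real (Suc j) \<le> \<bar>t\<bar>" for j
  proof -
    have "(real (Suc j) * \<bar>t\<bar> - ln 2) / real (Suc j) \<le> ln (cosh (real (Suc j) * t)) / real (Suc j)"
      "ln (cosh (real (Suc j) * t)) / real (Suc j) \<le> real (Suc j) * \<bar>t\<bar> / real (Suc j)"
      using ln_cosh_bounds[of "real (Suc j) * t"]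
      by (intro divide_right_mono; simp only: abs_mult abs_of_nat of_nat_0_le_iff)+
    then show "\<bar>t\<bar> - ln 2 / real (Suc j) \<le> ln (cosh (real (Suc j) * t)) / real (Suc j)"
      "ln (cosh (real (Suc j) * t)) / real (Suc j) \<le> \<bar>t\<bar>"
      by (simp_all only: diff_divide_distrib nonzero_mult_div_cancel_left of_nat_eq_0_iff nat.distinct not_False_eq_True)
  qed
  show "\<forall>\<^sub>F j in sequentially. \<bar>t\<bar> - ln 2 / real (Suc j) \<le> ln (cosh (real (Suc j) * t)) / real (Suc j)"
    "\<forall>\<^sub>F j in sequentially. ln (cosh (real (Suc j) * t)) / real (Suc j) \<le> \<bar>t\<bar>"
    using b by (auto intro: always_eventually)
  show "(\<lambda>j. \<bar>t\<bar> - ln 2 / real (Suc j)) \<longlonglongrightarrow> \<bar>t\<bar>" by real_asymp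
qed simp

text \<open>ln(cosh(k t)) / k is smooth, lies between 0 and |t| and tends to |t|, while its
  derivative tanh(k t) tends to sgn t. Dominated convergence and closedness give the gradient sgn(u)
  \<open>G\<close>. Its value on the zero set is 0 because sgn 0 = 0, with no claim about
  \<open>G\<close> there.\<close>

lemma D12_limit_abs:
  fixes u :: "(real^'m) \<times> real \<Rightarrow> real"
  assumes dim: "2 \<le> CARD('m)" and u: "D12_limit u G \<tau>"
  shows "D12_limit (\<lambda>x. \<bar>u x\<bar>) (\<lambda>x. sgn (u x) *\<^sub>R G x) (\<lambda>y. \<bar>\<tau> y\<bar>)"
proof -
  let ?p = "sobolev_exponent TYPE('m)" and ?q = "trace_exponent TYPE('m)"
  let ?H = "lebesgue_on halfspace :: ((real^'m) \<times> real) measure"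
  note e = one_less_sobolev_exponent[OF dim] two_less_trace_exponent[OF dim]
  note Lp = D12_limit_Lp_fun[OF dim u]
  note [measurable] = D12_limit_measurable[OF u]
  \<comment> \<open>\<open>Suc j\<close> instead of \<open>j\<close> keeps the scale positive, so
    that there is no division by zero.\<close>
  define g where "g j t = ln (cosh (real (Suc j) * t)) / real (Suc j)" for j t
  have gD: "(g j has_real_derivative tanh (real (Suc j) * t)) (at t)" for j t
    unfolding g_def by (auto intro!: derivative_eq_intros simp: tanh_def)
  have g: "D12_limit (\<lambda>x. 1 * g j (u x))
     (\<lambda>x. (1 * tanh (real (Suc j) * u x)) *\<^sub>R G x + g j (u x) *\<^sub>R gradient (\<lambda>_. 1) x)
     (\<lambda>y. 1 * g j (\<tau> y))" for j
  proof (rule D12_limit_mult_compose[OF dim u, where B = 1 and L = 1 and \<beta> = "\<lambda>_. 0"])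
    show "smooth (\<lambda>x. g j (f x))" if "smooth f" for f :: "(real^'m) \<times> real \<Rightarrow> real"
      using that unfolding g_def divide_inverse
      by (auto intro!: times_cont_diff_mult times_cont_diff_const times_cont_diff_ln_cosh)
    show "(g j has_real_derivative tanh (real (Suc j) * t)) (at t)" for t by (rule gD)
    show "continuous_on UNIV (\<lambda>t. tanh (real (Suc j) * t))" by (auto intro!: continuous_intros)
    show "\<bar>tanh (real (Suc j) * t)\<bar> \<le> 1" for t
      using tanh_real_bounds[of "real (Suc j) * t"] by auto
    show "g j 0 = 0" by (simp add: g_def)
    show "Lp_fun ?H 2 (\<lambda>_. 0 :: real)" by (simp add: Lp_fun_def)
  qed (auto simp: gradient_const intro: times_cont_diff_const)
  then have g: "D12_limit (\<lambda>x. g j (u x)) (\<lambda>x. tanh (real (Suc j) * u x) *\<^sub>R G x) (\<lambda>y. g j (\<tau> y))" for j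
    by (simp add: gradient_const)
  have gb: "\<bar>g j t - \<bar>t\<bar>\<bar> \<le> \<bar>t\<bar>" for j t
  proof -
    have "ln (cosh (real (Suc j) * t)) / real (Suc j) \<le> real (Suc j) * \<bar>t\<bar> / real (Suc j)"
      using ln_cosh_bounds(2)[of "real (Suc j) * t"]
      by (intro divide_right_mono; simp only: abs_mult abs_of_nat of_nat_0_le_iff)
    then have "g j t \<le> \<bar>t\<bar>"
      unfolding g_def
      by (simp only: nonzero_mult_div_cancel_left of_nat_eq_0_iff nat.distinct not_False_eq_True)
    moreover have "0 \<le> g j t" unfolding g_def by (intro divide_nonneg_nonneg ln_cosh_bounds) simp
    ultimately show ?thesis by linarith
  qed
  have tb: "\<bar>tanh s - sgn t\<bar> \<le> 2" for s t :: real
    using tanh_real_bounds[of s] by (auto simp: sgn_if)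
  note gm = D12_limit_measurable[OF g]
  show ?thesis
  proof (rule D12_limit_closed[OF dim g])
    show "Lp_tendsto ?H 2 (\<lambda>j x. tanh (real (Suc j) * u x) *\<^sub>R G x) (\<lambda>x. sgn (u x) *\<^sub>R G x)"
    proof (rule Lp_tendsto_dominated[where F = "\<lambda>x. 2 *\<^sub>R G x"])
      show "Lp_fun ?H 2 (\<lambda>x. 2 *\<^sub>R G x)" by (intro Lp_fun_scaleR Lp) simp
      show "AE x in ?H. (\<lambda>k. tanh (real (Suc k) * u x) *\<^sub>R G x) \<longlonglongrightarrow> sgn (u x) *\<^sub>R G x"
        by (intro AE_I2 tendsto_intros tanh_mult_tendsto_sgn)
      show "norm (tanh (real (Suc k) * u x) *\<^sub>R G x - sgn (u x) *\<^sub>R G x) \<le> norm (2 *\<^sub>R G x)" for k x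
        using tb by (auto simp flip: scaleR_diff_left intro!: mult_right_mono)
      show "(\<lambda>x. tanh (real (Suc k) * u x) *\<^sub>R G x) \<in> borel_measurable ?H" for k
        by (rule gm(2))
    qed auto
    show "Lp_tendsto ?H ?p (\<lambda>j x. g j (u x)) (\<lambda>x. \<bar>u x\<bar>)"
    proof (rule Lp_tendsto_dominated[OF _ Lp(2)])
      show "(\<lambda>x. g k (u x)) \<in> borel_measurable ?H" for k by (rule gm(1))
    qed (use e gb ln_cosh_mult_tendsto_abs in \<open>auto simp: g_def\<close>)
    show "Lp_tendsto lebesgue ?q (\<lambda>j x. g j (\<tau> x)) (\<lambda>x. \<bar>\<tau> x\<bar>)"
    proof (rule Lp_tendsto_dominated[OF _ Lp(3)])
      show "(\<lambda>x. g k (\<tau> x)) \<in> borel_measurable lebesgue" for k by (rule gm(3))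
    qed (use e gb ln_cosh_mult_tendsto_abs in \<open>auto simp: g_def\<close>)
  qed auto
qed

lemma D12_limit_pos_part:
  fixes u :: "(real^'m) \<times> real \<Rightarrow> real"
  assumes dim: "2 \<le> CARD('m)" and u: "D12_limit u G \<tau>"
  shows "D12_limit (\<lambda>x. max (u x) 0) (\<lambda>x. ((1 + sgn (u x)) / 2) *\<^sub>R G x) (\<lambda>y. max (\<tau> y) 0)"
proof -
  have m: "max t 0 = 1 / 2 * (t + \<bar>t\<bar>)" for t :: real by auto
  have s: "((1 + sgn t) / 2) *\<^sub>R v = (1 / 2) *\<^sub>R (v + sgn t *\<^sub>R v)" for t :: real and v :: "(real^'m) \<times> real"
    by (simp add: algebra_simps add_divide_distrib)
  show ?thesis unfolding m s
    by (intro D12_limit_cmult D12_limit_add D12_limit_abs dim u)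
qed

section \<open>Uniqueness of gradient and trace\<close>

lemma set_nn_integral_lebesgue_on:
  assumes "S \<in> sets lebesgue" "Q \<subseteq> S"
  shows "(\<integral>\<^sup>+x\<in>Q. h x \<partial>lebesgue_on S) = (\<integral>\<^sup>+x\<in>Q. h x \<partial>lebesgue)"
  using assms by (subst nn_integral_restrict_space)
    (auto intro!: nn_integral_cong simp: indicator_def)

text \<open>On a set of finite measure the splitting t <= 1 + t^p makes a p-integrable function
  integrable, as the integrals over boxes require.\<close>

lemma Lp_fun_absolutely_integrable_on:
  assumes "Lp_fun (lebesgue_on S) p f" "1 \<le> p" "S \<in> sets lebesgue" "Q \<in> lmeasurable" "Q \<subseteq> S"
  shows "f absolutely_integrable_on Q"
proof -
  have f: "f \<in> borel_measurable (lebesgue_on S)" using Lp_fun_measurable[OF assms(1)] .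
  have Q: "Q \<in> sets (lebesgue_on S)" "emeasure (lebesgue_on S) Q = emeasure lebesgue Q"
    using assms(3-5) by (auto simp: sets_restrict_space_iff emeasure_restrict_space fmeasurableD)
  have "f \<in> borel_measurable (lebesgue_on Q)"
    using f assms(5) by (rule measurable_restrict_mono)
  then have m: "(\<lambda>x. indicator Q x *\<^sub>R f x) \<in> borel_measurable lebesgue"
    using assms(4) by (subst (asm) borel_measurable_restrict_space_iff) (auto simp: fmeasurableD)
  have "(\<integral>\<^sup>+x. ennreal (norm (indicator Q x *\<^sub>R f x)) \<partial>lebesgue) = L1_on lebesgue Q f"
    by (intro nn_integral_cong) (auto simp: indicator_def)
  also have "\<dots> = L1_on (lebesgue_on S) Q f"
    using set_nn_integral_lebesgue_on[OF assms(3,5)] by metis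
  also have "\<dots> \<le> ennreal 1 * emeasure (lebesgue_on S) Q
      + ennreal (1 powr (1 - p)) * (\<integral>\<^sup>+x\<in>Q. ennreal (norm (f x) powr p) \<partial>lebesgue_on S)"
    by (rule nn_integral_norm_le_powr) (use assms f Q in auto)
  also have "(\<integral>\<^sup>+x\<in>Q. ennreal (norm (f x) powr p) \<partial>lebesgue_on S)
      \<le> powr_norm_on (lebesgue_on S) p f"
    by (intro nn_integral_mono) (auto simp: indicator_def)
  also have "ennreal 1 * emeasure (lebesgue_on S) Q
      + ennreal (1 powr (1 - p)) * powr_norm_on (lebesgue_on S) p f < \<infinity>"
    using assms(1,4) Q(2) by (auto simp: Lp_fun_def fmeasurable_def)
  finally show ?thesis
    using m by (auto simp: set_integrable_def integrable_iff_bounded add_left_mono)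
qed

text \<open>The threshold for k depends on the measure bound \<open>V\<close> and not on the set
  \<open>A\<close>. This uniformity is what later allows the set to move.\<close>

lemma Lp_tendsto_imp_L1_uniform:
  fixes f :: "nat \<Rightarrow> 'a \<Rightarrow> 'b::euclidean_space"
  assumes "Lp_tendsto M p f g" "1 \<le> p" "0 < e" "0 \<le> V"
    and [measurable]: "\<And>k. f k \<in> borel_measurable M" "g \<in> borel_measurable M"
  shows "\<forall>\<^sub>F k in sequentially. \<forall>A\<in>sets M. emeasure M A \<le> ennreal V \<longrightarrow>
    L1_on M A (\<lambda>x. f k x - g x) \<le> ennreal e"
proof -
  \<comment> \<open>With this choice the measure term is at most e/2 on every admissible set; the 1
    added to \<open>V\<close> covers the case V = 0.\<close>
  define \<eta> where "\<eta> = e / (2 * (V + 1))"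
  have \<eta>: "0 < \<eta>" "\<eta> * V \<le> e / 2" using assms by (auto simp: \<eta>_def field_simps)
  let ?I = "\<lambda>k. \<integral>\<^sup>+x. ennreal (norm (f k x - g x) powr p) \<partial>M"
  have "(\<lambda>k. ennreal (\<eta> powr (1 - p)) * ?I k) \<longlonglongrightarrow> ennreal (\<eta> powr (1 - p)) * 0"
    using assms(1) unfolding Lp_tendsto_def by (intro ennreal_tendsto_cmult) auto
  then have "\<forall>\<^sub>F k in sequentially. ennreal (\<eta> powr (1 - p)) * ?I k < ennreal (e / 2)"
    using assms(3) by (intro order_tendstoD(2)) auto
  then show ?thesis
  proof (eventually_elim, intro ballI impI)
    fix k A assume k: "ennreal (\<eta> powr (1 - p)) * ?I k < ennreal (e / 2)"
      and A: "A \<in> sets M" "emeasure M A \<le> ennreal V"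
    have "L1_on M A (\<lambda>x. f k x - g x) \<le> ennreal \<eta> * emeasure M A
      + ennreal (\<eta> powr (1 - p)) * (\<integral>\<^sup>+x\<in>A. ennreal (norm (f k x - g x) powr p) \<partial>M)"
      by (rule nn_integral_norm_le_powr) (use \<eta> assms(2) A in auto)
    also have "\<dots> \<le> ennreal \<eta> * ennreal V + ennreal (\<eta> powr (1 - p)) * ?I k"
      using A by (intro add_mono mult_left_mono nn_integral_mono) (auto simp: indicator_def)
    also have "\<dots> \<le> ennreal (e / 2) + ennreal (e / 2)"
      using \<eta> k assms(4) by (intro add_mono) (auto simp flip: ennreal_mult intro: ennreal_leI)
    also have "\<dots> = ennreal e" using assms(3) by (simp flip: ennreal_plus)
    finally show "L1_on M A (\<lambda>x. f k x - g x) \<le> ennreal e" .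
  qed
qed

section \<open>Integrals over translated boxes\<close>

lemma norm_integral_diff_le:
  fixes f g :: "'a::euclidean_space \<Rightarrow> 'b::euclidean_space"
  assumes "f absolutely_integrable_on Q" "g absolutely_integrable_on Q"
    and "L1_on lebesgue Q (\<lambda>x. f x - g x) \<le> ennreal e" "0 \<le> e"
  shows "norm (integral Q f - integral Q g) \<le> e"
proof -
  have d: "set_integrable lebesgue Q (\<lambda>x. f x - g x)"
    using assms(1,2) by (rule set_integral_diff)
  have "integral Q f - integral Q g = (LINT x:Q|lebesgue. f x - g x)"
    using set_lebesgue_integral_eq_integral[OF assms(1)] set_lebesgue_integral_eq_integral[OF assms(2)]
      set_integral_diff(2)[OF assms(1,2)] by simp
  also have "ennreal (norm \<dots>) \<le> (\<integral>\<^sup>+x. ennreal (norm (indicator Q x *\<^sub>R (f x - g x))) \<partial>lebesgue)"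
    unfolding set_lebesgue_integral_def
    by (rule integral_norm_bound_ennreal) (use d in \<open>simp add: set_integrable_def\<close>)
  also have "\<dots> = L1_on lebesgue Q (\<lambda>x. f x - g x)"
    by (intro nn_integral_cong) (auto simp: indicator_def)
  also have "\<dots> \<le> ennreal e" by fact
  finally show ?thesis using assms(4) by (simp add: ennreal_le_iff)
qed

text \<open>Differentiating in the translation replaces integration by parts: no faces of the box
  appear, and both sides are integrals over boxes, which survive the passage to an L^p limit. The
  half-line \<open>{0..}\<close> is the range of shifts available inside the half-space.\<close>

lemma smooth_integral_shift_derivative:
  fixes \<phi> :: "'a::euclidean_space \<Rightarrow> real"
  assumes "smooth \<phi>"
  shows "((\<lambda>s. integral (cbox (a + s *\<^sub>R b) (c + s *\<^sub>R b)) \<phi>) has_real_derivative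
    integral (cbox (a + s *\<^sub>R b) (c + s *\<^sub>R b)) (\<lambda>x. gradient \<phi> x \<bullet> b)) (at s within {0..})"
proof -
  have sh: "integral (cbox (a + s *\<^sub>R b) (c + s *\<^sub>R b)) f = integral (cbox a c) (\<lambda>x. f (x + s *\<^sub>R b))"
    for s and f :: "'a \<Rightarrow> real"
    using integral_shift_cbox_plus[of a c f "s *\<^sub>R b"] by (simp add: o_def add.commute)
  have D: "((\<lambda>s. \<phi> (x + s *\<^sub>R b)) has_field_derivative gradient \<phi> (x + s *\<^sub>R b) \<bullet> b) (at s)" for x s
  proof -
    have "((\<lambda>s. x + s *\<^sub>R b) has_derivative (\<lambda>h. h *\<^sub>R b)) (at s)"
      by (auto intro!: derivative_eq_intros)
    from has_derivative_compose[OF this smooth_has_derivative[OF assms]]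
    show ?thesis by (simp add: has_field_derivative_def mult_commute_abs)
  qed
  have cont: "continuous_on UNIV (\<lambda>(s, x). gradient \<phi> (x + s *\<^sub>R b) \<bullet> b)"
    unfolding case_prod_unfold
    by (intro continuous_intros continuous_on_compose2[OF smooth_continuous_on_gradient[OF assms, of UNIV]]) auto
  have "((\<lambda>s. integral (cbox a c) (\<lambda>x. \<phi> (x + s *\<^sub>R b))) has_field_derivative
     integral (cbox a c) (\<lambda>x. gradient \<phi> (x + s *\<^sub>R b) \<bullet> b)) (at s within UNIV)"
  proof (rule leibniz_rule_field_derivative)
    show "(\<lambda>x. \<phi> (x + s *\<^sub>R b)) integrable_on cbox a c" for s
      by (intro integrable_continuous continuous_on_compose2[OF smooth_continuous_on[OF assms, of UNIV]]
          continuous_intros) auto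
    show "continuous_on (UNIV \<times> cbox a c) (\<lambda>(s, x). gradient \<phi> (x + s *\<^sub>R b) \<bullet> b)"
      using cont by (rule continuous_on_subset) simp
  qed (use D in auto)
  then show ?thesis unfolding sh by (rule has_field_derivative_at_within)
qed

text \<open>Derivatives that converge uniformly in s, together with convergence of the functions at
  one point, pass to the limit.\<close>

lemma integral_shift_limit_derivative:
  fixes \<phi> :: "nat \<Rightarrow> 'a::euclidean_space \<Rightarrow> real"
  assumes "\<And>k. smooth (\<phi> k)"
    and J: "\<And>e. 0 < e \<Longrightarrow> \<forall>\<^sub>F k in sequentially. \<forall>s\<ge>0. \<bar>integral (cbox (a + s *\<^sub>R b) (c + s *\<^sub>R b)) (\<phi> k) - J s\<bar> \<le> e"
    and I: "\<And>e. 0 < e \<Longrightarrow> \<forall>\<^sub>F k in sequentially. \<forall>s\<ge>0.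
       \<bar>integral (cbox (a + s *\<^sub>R b) (c + s *\<^sub>R b)) (\<lambda>x. gradient (\<phi> k) x \<bullet> b) - I s\<bar> \<le> e"
    and "0 \<le> s"
  shows "(J has_real_derivative I s) (at s within {0..})"
proof -
  let ?J = "\<lambda>k s. integral (cbox (a + s *\<^sub>R b) (c + s *\<^sub>R b)) (\<phi> k)"
  let ?I = "\<lambda>k s. integral (cbox (a + s *\<^sub>R b) (c + s *\<^sub>R b)) (\<lambda>x. gradient (\<phi> k) x \<bullet> b)"
  have lim: "(\<lambda>k. ?J k s) \<longlonglongrightarrow> J s" if "0 \<le> s" for s
  proof (rule tendstoI)
    fix e :: real assume "0 < e"
    then have "0 < e / 2" by simp
    from J[OF this] show "\<forall>\<^sub>F k in sequentially. dist (?J k s) (J s) < e"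
      by eventually_elim (use that \<open>0 < e\<close> in \<open>force simp: dist_real_def\<close>)
  qed
  have "\<exists>g. \<forall>s\<in>{0..}. (\<lambda>k. ?J k s) \<longlonglongrightarrow> g s \<and> (g has_derivative (\<lambda>h. I s * h)) (at s within {0..})"
  proof (rule has_derivative_sequence[where f = ?J and f' = "\<lambda>k s h. ?I k s * h"
        and g' = "\<lambda>s h. I s * h" and ?x0.0 = 0 and l = "J 0"])
    show "(?J k has_derivative (*) (?I k s)) (at s within {0..})" for k s
      using smooth_integral_shift_derivative[OF assms(1)] by (simp add: has_field_derivative_def)
    show "(\<lambda>k. ?J k 0) \<longlonglongrightarrow> J 0" by (rule lim) simp
    fix e :: real assume "0 < e"
    from I[OF this] show "\<forall>\<^sub>F k in sequentially. \<forall>s\<in>{0..}. \<forall>h. norm (?I k s * h - I s * h) \<le> e * norm h"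
      by eventually_elim (auto simp: abs_mult simp flip: left_diff_distrib intro!: mult_right_mono)
  qed auto
  then obtain g where g: "\<And>s. 0 \<le> s \<Longrightarrow> (\<lambda>k. ?J k s) \<longlonglongrightarrow> g s"
    "\<And>s. 0 \<le> s \<Longrightarrow> (g has_derivative (\<lambda>h. I s * h)) (at s within {0..})" by auto
  have "g s = J s" if "0 \<le> s" for s
    using LIMSEQ_unique[OF g(1) lim, OF that that] .
  then have "(J has_derivative (\<lambda>h. I s * h)) (at s within {0..})"
    by (intro has_derivative_transform[OF _ _ g(2)[OF \<open>0 \<le> s\<close>]]) (use \<open>0 \<le> s\<close> in auto)
  then show ?thesis by (simp add: has_field_derivative_def)
qed

text \<open>Ties \<open>G\<close> to \<open>u\<close> through integrals alone, which is how
  \<open>G\<close> is seen to be determined by \<open>u\<close>. Directions with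
  \<open>0 \<le> snd b\<close> keep the shifted boxes inside the half-space, hence the one-sided
  derivative.\<close>

lemma D12_box_integral_derivative:
  fixes u :: "(real^'m) \<times> real \<Rightarrow> real" and a b c :: "(real^'m) \<times> real"
  assumes dim: "2 \<le> CARD('m)" and u: "D12_limit u G \<tau>"
    and b: "norm b \<le> 1" "0 \<le> snd b" and ac: "cbox a c \<subseteq> halfspace" and "0 \<le> s"
  shows "((\<lambda>s. integral (cbox (a + s *\<^sub>R b) (c + s *\<^sub>R b)) u) has_real_derivative
    integral (cbox (a + s *\<^sub>R b) (c + s *\<^sub>R b)) (\<lambda>x. G x \<bullet> b)) (at s within {0..})"
proof -
  let ?p = "sobolev_exponent TYPE('m)"
  let ?H = "lebesgue_on halfspace :: ((real^'m) \<times> real) measure"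
  note pe = one_less_sobolev_exponent[OF dim]
  obtain \<phi> where \<phi>: "D12_approx \<phi> u G \<tau>" using u by (auto simp: D12_limit_iff)
  have t: "test_function (\<phi> k)" for k using \<phi> by (simp add: D12_approx_def)
  note Lp = D12_limit_Lp_fun[OF dim u]
  define Q where "Q s = cbox (a + s *\<^sub>R b) (c + s *\<^sub>R b)" for s
  have Q_eq: "Q s = (\<lambda>x. s *\<^sub>R b + x) ` cbox a c" for s
    using cbox_translation[of "s *\<^sub>R b" a c] by (simp add: Q_def add.commute)
  have sub: "Q s \<subseteq> halfspace" if "0 \<le> s" for s
  proof -
    have "0 \<le> snd x" if "x \<in> cbox a c" for x using ac that by (auto simp: halfspace_def)
    then show ?thesis using b(2) that by (auto simp: Q_eq halfspace_def)
  qed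
  have lm: "Q s \<in> lmeasurable" for s by (simp add: Q_def lmeasurable_cbox)
  define V where "V = measure lebesgue (cbox a c)"
  have V: "emeasure ?H (Q s) = ennreal V" "Q s \<in> sets ?H" if "0 \<le> s" for s
  proof -
    have "emeasure ?H (Q s) = emeasure lebesgue (Q s)"
      using sub[OF that] by (intro emeasure_restrict_space) auto
    also have "\<dots> = emeasure lebesgue (cbox a c)"
      using lm[of s] lmeasurable_cbox[of a c] measure_translation[of "s *\<^sub>R b" "cbox a c"]
      unfolding Q_eq by (simp add: emeasure_eq_measure2)
    finally show "emeasure ?H (Q s) = ennreal V"
      by (simp add: V_def emeasure_eq_measure2)
    show "Q s \<in> sets ?H" using sub[OF that] lm[of s]
      by (auto simp: sets_restrict_space_iff fmeasurableD)
  qed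
  have "V \<ge> 0" by (simp add: V_def)
  have ai: "f absolutely_integrable_on Q s" if "Lp_fun ?H p f" "1 \<le> p" "0 \<le> s"
    for f :: "_ \<Rightarrow> 'x::euclidean_space" and p s
    by (rule Lp_fun_absolutely_integrable_on[OF that(1,2) halfspace_measurable lm sub[OF that(3)]])
  \<comment> \<open>All shifted boxes have the same volume \<open>V\<close>, so one threshold for k
    serves every s.\<close>
  have conv: "\<forall>\<^sub>F k in sequentially. \<forall>s\<ge>0. norm (integral (Q s) (f k) - integral (Q s) g) \<le> e"
    if f: "Lp_tendsto ?H p f g" "1 \<le> p" "\<And>k. Lp_fun ?H p (f k)" and g: "Lp_fun ?H p g" and e: "0 < e"
    for f :: "nat \<Rightarrow> _ \<Rightarrow> 'x::euclidean_space" and g p e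
  proof -
    have "\<forall>\<^sub>F k in sequentially. \<forall>A\<in>sets ?H. emeasure ?H A \<le> ennreal V \<longrightarrow>
       L1_on ?H A (\<lambda>x. f k x - g x) \<le> ennreal e"
      by (rule Lp_tendsto_imp_L1_uniform[OF f(1,2) e \<open>V \<ge> 0\<close> Lp_fun_measurable[OF f(3)] Lp_fun_measurable[OF g]])
    then show ?thesis
    proof (eventually_elim, intro allI impI)
      fix k s assume k: "\<forall>A\<in>sets ?H. emeasure ?H A \<le> ennreal V \<longrightarrow>
       L1_on ?H A (\<lambda>x. f k x - g x) \<le> ennreal e" and s: "(0::real) \<le> s"
      show "norm (integral (Q s) (f k) - integral (Q s) g) \<le> e"
      proof (rule norm_integral_diff_le[OF ai[OF f(3,2) s] ai[OF g f(2) s]])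
        show "L1_on lebesgue (Q s) (\<lambda>x. f k x - g x) \<le> ennreal e"
          using k V[OF s] by (subst set_nn_integral_lebesgue_on[OF halfspace_measurable sub[OF s], symmetric]) simp
      qed (use e in simp)
    qed
  qed
  have 1: "\<forall>\<^sub>F k in sequentially. \<forall>s\<ge>0. \<bar>integral (Q s) (\<phi> k) - integral (Q s) u\<bar> \<le> e" if "0 < e" for e
    using conv[of ?p \<phi> u e] \<phi> pe that test_function_Lp_fun_halfspace(1)[OF t, of ?p] Lp(2)
    by (simp add: D12_approx_def)
  have 2: "\<forall>\<^sub>F k in sequentially. \<forall>s\<ge>0.
    \<bar>integral (Q s) (\<lambda>x. gradient (\<phi> k) x \<bullet> b) - integral (Q s) (\<lambda>x. G x \<bullet> b)\<bar> \<le> e" if "0 < e" for e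
  proof -
    have tL: "Lp_fun ?H 2 (gradient (\<phi> k))" for k
      by (rule test_function_Lp_fun_halfspace(2)[OF t]) simp
    have "\<forall>\<^sub>F k in sequentially. \<forall>s\<ge>0. norm (integral (Q s) (gradient (\<phi> k)) - integral (Q s) G) \<le> e"
      by (rule conv[of 2 "\<lambda>k. gradient (\<phi> k)" G e]) (use \<phi> that tL Lp(1) in \<open>auto simp: D12_approx_def\<close>)
    then show ?thesis
    proof (eventually_elim, intro allI impI)
      fix k s assume "\<forall>s\<ge>0. norm (integral (Q s) (gradient (\<phi> k)) - integral (Q s) G) \<le> e"
        and s: "(0::real) \<le> s"
      then have "norm (integral (Q s) (gradient (\<phi> k)) - integral (Q s) G) * norm b \<le> e"
        using b(1) mult_left_le by (meson norm_ge_zero order_trans)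
      then have "\<bar>(integral (Q s) (gradient (\<phi> k)) - integral (Q s) G) \<bullet> b\<bar> \<le> e"
        by (rule order_trans[OF Cauchy_Schwarz_ineq2])
      moreover have "integral (Q s) (\<lambda>x. f x \<bullet> b) = integral (Q s) f \<bullet> b" if "Lp_fun ?H 2 f" for f
        using integral_linear[OF set_lebesgue_integral_eq_integral(1)[OF ai[OF that _ s]] bounded_linear_inner_left[of b]]
        by (simp add: o_def)
      ultimately show "\<bar>integral (Q s) (\<lambda>x. gradient (\<phi> k) x \<bullet> b) - integral (Q s) (\<lambda>x. G x \<bullet> b)\<bar> \<le> e"
        using tL Lp(1) by (simp add: inner_diff_left)
    qed
  qed
  show ?thesis
    by (rule integral_shift_limit_derivative[OF test_functionD(1)[OF t] 1[unfolded Q_def] 2[unfolded Q_def] \<open>0 \<le> s\<close>])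
qed

lemma cbox_One_subset_halfspace:
  fixes x :: "(real^'m) \<times> real"
  assumes "x \<in> halfspace"
  shows "cbox x (x + h *\<^sub>R One) \<subseteq> halfspace"
proof
  fix y assume "y \<in> cbox x (x + h *\<^sub>R One)"
  moreover have "(0, 1) \<in> (Basis :: ((real^'m) \<times> real) set)" by (simp add: Basis_prod_def)
  ultimately have "x \<bullet> (0, 1) \<le> y \<bullet> (0, 1)" unfolding mem_box by blast
  then have "snd x \<le> snd y" by (simp add: inner_prod_def)
  then show "y \<in> halfspace" using assms by (simp add: halfspace_def)
qed

text \<open>Lebesgue differentiation on cubes whose lowest corner is x: they stay in the half-space
  for every x in it, boundary points included.\<close>

lemma AE_halfspace_eq_0:
  fixes f :: "(real^'m) \<times> real \<Rightarrow> 'b::euclidean_space"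
  assumes f: "Lp_fun (lebesgue_on halfspace) p f" "1 \<le> p"
    and int: "\<And>x h. x \<in> halfspace \<Longrightarrow> 0 < h \<Longrightarrow> integral (cbox x (x + h *\<^sub>R One)) f = 0"
  shows "AE x in lebesgue_on halfspace. f x = 0"
proof -
  \<comment> \<open>The differentiation theorem concerns functions on the whole space, hence the
    extension by zero.\<close>
  define F where "F x = (if x \<in> halfspace then f x else 0)" for x
  have F: "F integrable_on cbox a c" for a c
  proof -
    have lm: "halfspace \<inter> cbox a c \<in> lmeasurable"
      using fmeasurable_Int_fmeasurable[OF lmeasurable_cbox halfspace_measurable]
      by (simp add: Int_commute)
    have "f absolutely_integrable_on (halfspace \<inter> cbox a c)"
      by (rule Lp_fun_absolutely_integrable_on[OF f halfspace_measurable lm]) simp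
    then show ?thesis unfolding F_def[abs_def] integrable_restrict_Int
      by (rule set_lebesgue_integral_eq_integral)
  qed
  obtain N where N: "negligible N"
    "\<And>x e. x \<notin> N \<Longrightarrow> 0 < e \<Longrightarrow> \<exists>d>0. \<forall>h. 0 < h \<and> h < d \<longrightarrow>
       norm (integral (cbox x (x + h *\<^sub>R One)) F /\<^sub>R h ^ DIM((real^'m) \<times> real) - F x) < e"
    by (rule integrable_ccontinuous_explicit[of F, OF F]) (rule that)
  have "f x = 0" if x: "x \<notin> N" "x \<in> halfspace" for x
  proof (rule ccontr)
    assume "f x \<noteq> 0"
    then have "0 < norm (f x)" by simp
    from N(2)[OF x(1) this] obtain d where d: "d > 0" "\<And>h. 0 < h \<and> h < d \<Longrightarrow>
       norm (integral (cbox x (x + h *\<^sub>R One)) F /\<^sub>R h ^ DIM((real^'m) \<times> real) - F x) < norm (f x)"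
      by blast
    have "integral (cbox x (x + (d / 2) *\<^sub>R One)) F = integral (cbox x (x + (d / 2) *\<^sub>R One)) f"
      using cbox_One_subset_halfspace[OF x(2)] by (intro integral_cong) (auto simp: F_def)
    also have "\<dots> = 0" using d(1) x by (intro int) auto
    finally show False using d(2)[of "d / 2"] d(1) x(2) by (simp add: F_def)
  qed
  moreover have "AE x in lebesgue. x \<notin> N"
    using N(1) by (intro AE_not_in) (simp add: negligible_iff_null_sets)
  ultimately have "AE x in lebesgue. x \<in> halfspace \<longrightarrow> f x = 0"
    by (auto elim: eventually_mono)
  then show ?thesis by (subst AE_restrict_space_iff) auto
qed

lemma deriv_atLeast_0_unique:
  assumes "(f has_real_derivative c) (at 0 within {0..})" "(f has_real_derivative d) (at 0 within {0..})"
  shows "c = d"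
proof -
  have "at (0 :: real) within {0..} \<noteq> bot"
    by (simp add: at_within_Ici_at_right trivial_limit_at_right_real)
  from vector_derivative_unique_within[OF this] show ?thesis
    using assms unfolding has_real_derivative_iff_has_vector_derivative by blast
qed

text \<open>Box integrals of the function 0 do not change under translation, so the integral of
  \<open>G\<close> over a box has vanishing component along every basis vector. All of these are
  admissible directions, their last coordinate being 0 or 1.\<close>

lemma D12_limit_zero_gradient:
  fixes G :: "(real^'m) \<times> real \<Rightarrow> (real^'m) \<times> real"
  assumes dim: "2 \<le> CARD('m)" and u: "D12_limit (\<lambda>_. 0) G \<tau>"
  shows "AE x in lebesgue_on halfspace. G x = 0"
proof (rule AE_halfspace_eq_0)
  show G: "Lp_fun (lebesgue_on halfspace) 2 G" by (rule D12_limit_Lp_fun[OF dim u])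
  fix x :: "(real^'m) \<times> real" and h :: real assume x: "x \<in> halfspace" "0 < h"
  let ?Q = "cbox x (x + h *\<^sub>R One)"
  note sub = cbox_One_subset_halfspace[OF x(1), of h]
  have "G absolutely_integrable_on ?Q"
    by (rule Lp_fun_absolutely_integrable_on[OF G _ halfspace_measurable lmeasurable_cbox sub]) simp
  then have iG: "G integrable_on ?Q" by (rule set_lebesgue_integral_eq_integral)
  have ib: "integral ?Q G \<bullet> b = 0" if b: "b \<in> Basis" for b
  proof -
    have "snd b \<ge> 0" using b by (auto simp: Basis_prod_def)
    then have "((\<lambda>s. integral (cbox (x + s *\<^sub>R b) (x + h *\<^sub>R One + s *\<^sub>R b)) (\<lambda>_. 0)) has_real_derivative
      integral (cbox (x + 0 *\<^sub>R b) (x + h *\<^sub>R One + 0 *\<^sub>R b)) (\<lambda>x. G x \<bullet> b)) (at 0 within {0..})"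
      using b by (intro D12_box_integral_derivative[OF dim u _ _ sub]) auto
    moreover have "((\<lambda>s. integral (cbox (x + s *\<^sub>R b) (x + h *\<^sub>R One + s *\<^sub>R b)) (\<lambda>_. 0 :: real)) has_real_derivative 0)
       (at 0 within {0..})" by simp
    ultimately have "integral (cbox (x + 0 *\<^sub>R b) (x + h *\<^sub>R One + 0 *\<^sub>R b)) (\<lambda>x. G x \<bullet> b) = 0"
      by (rule deriv_atLeast_0_unique)
    then have "integral ?Q (\<lambda>x. G x \<bullet> b) = 0" by simp
    then show ?thesis
      using integral_linear[OF iG bounded_linear_inner_left[of b]] by (simp add: o_def)
  qed
  show "integral ?Q G = 0"
    by (rule euclidean_eqI) (simp only: ib inner_zero_left)
qed simp

text \<open>With vanishing gradient the integral over a box is unchanged when the box is pushed away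
  from the boundary, and along this motion it must become small because \<open>u\<close> is
  p-integrable. This is how nonzero constants are excluded.\<close>

lemma D12_limit_eq_0:
  fixes u :: "(real^'m) \<times> real \<Rightarrow> real"
  assumes dim: "2 \<le> CARD('m)" and u: "D12_limit u G \<tau>"
    and G: "AE x in lebesgue_on halfspace. G x = 0"
  shows "AE x in lebesgue_on halfspace. u x = 0"
proof (rule AE_halfspace_eq_0)
  let ?p = "sobolev_exponent TYPE('m)"
  let ?H = "lebesgue_on halfspace :: ((real^'m) \<times> real) measure"
  note pe = one_less_sobolev_exponent[OF dim]
  show Lpu: "Lp_fun ?H ?p u" by (rule D12_limit_Lp_fun[OF dim u])
  show "1 \<le> ?p" using pe by simp
  note [measurable] = D12_limit_measurable(1)[OF u]
  fix x :: "(real^'m) \<times> real" and h :: real assume x: "x \<in> halfspace" "0 < h"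
  note sub = cbox_One_subset_halfspace[OF x(1), of h]
  define b :: "(real^'m) \<times> real" where "b = (0, 1)"
  define Q where "Q s = cbox (x + s *\<^sub>R b) (x + h *\<^sub>R One + s *\<^sub>R b)" for s
  have Q_eq: "Q s = (\<lambda>y. s *\<^sub>R b + y) ` cbox x (x + h *\<^sub>R One)" for s
    using cbox_translation[of "s *\<^sub>R b" x "x + h *\<^sub>R One"] by (simp add: Q_def add.commute)
  have snd_Q: "s \<le> snd y" if "y \<in> Q s" for y s
  proof -
    obtain z where "z \<in> cbox x (x + h *\<^sub>R One)" "y = s *\<^sub>R b + z" using \<open>y \<in> Q s\<close> by (auto simp: Q_eq)
    then show ?thesis using sub by (auto simp: halfspace_def b_def)
  qed
  have subQ: "Q s \<subseteq> halfspace" if "0 \<le> s" for s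
    using snd_Q that by (fastforce simp: halfspace_def)
  have lm: "Q s \<in> lmeasurable" for s by (simp add: Q_def lmeasurable_cbox)
  define J where "J s = integral (Q s) u" for s
  have "(J has_real_derivative 0) (at s within {0..})" if "s \<in> {0..}" for s
  proof -
    have "AE x in lebesgue. x \<in> halfspace \<longrightarrow> G x = 0"
      using G by (subst (asm) AE_restrict_space_iff) auto
    then obtain N where N: "{x \<in> space lebesgue. \<not> (x \<in> halfspace \<longrightarrow> G x = 0)} \<subseteq> N"
      "emeasure lebesgue N = 0" "N \<in> sets lebesgue" by (rule AE_E)
    then have "negligible N" by (simp add: negligible_iff_null_sets null_setsI)
    then have "integral (Q s) (\<lambda>x. G x \<bullet> b) = integral (Q s) (\<lambda>x. 0)"
    proof (rule integral_spike)
      fix y assume "y \<in> Q s - N"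
      then have "G y = 0" using subQ[of s] that N(1) by auto
      then show "0 = G y \<bullet> b" by simp
    qed
    then show ?thesis
      using D12_box_integral_derivative[OF dim u _ _ sub, of b s] that
      by (simp add: J_def[abs_def] Q_def b_def)
  qed
  then obtain C where C: "\<And>s. 0 \<le> s \<Longrightarrow> J s = C"
    using has_field_derivative_zero_constant[of "{0..}" J] by auto
  \<comment> \<open>The part of \<open>u\<close> above height k tends to 0 in L^p by domination and
    coincides with \<open>u\<close> on the box shifted upwards by k.\<close>
  define f where "f k y = (if real k \<le> snd y then u y else 0)" for k y
  have fm [measurable]: "f k \<in> borel_measurable ?H" for k
  proof -
    have [measurable]: "snd \<in> borel_measurable ?H"
      by (intro measurable_restrict_space1 measurable_completion)
        (auto intro!: borel_measurable_continuous_onI continuous_intros)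
    show ?thesis unfolding f_def[abs_def] by measurable
  qed
  have "Lp_tendsto ?H ?p f (\<lambda>_. 0)"
  proof (rule Lp_tendsto_dominated[OF _ Lpu])
    show "AE y in ?H. (\<lambda>k. f k y) \<longlonglongrightarrow> 0"
    proof (rule AE_I2)
      fix y
      have "\<forall>\<^sub>F k in sequentially. f k y = 0"
        using eventually_gt_at_top[of "nat \<lceil>snd y\<rceil>"]
      proof eventually_elim
        case (elim k)
        then have "snd y < real k" by linarith
        then show ?case by (simp add: f_def)
      qed
      then show "(\<lambda>k. f k y) \<longlonglongrightarrow> 0" by (rule tendsto_eventually)
    qed
    show "f k \<in> borel_measurable ?H" for k by (rule fm)
  qed (use pe in \<open>auto simp: f_def\<close>)
  note unif = Lp_tendsto_imp_L1_uniform[OF this]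
  define V where "V = measure lebesgue (cbox x (x + h *\<^sub>R One))"
  have "\<bar>C\<bar> \<le> e" if "0 < e" for e
  proof -
    have ev: "\<forall>\<^sub>F k in sequentially. \<forall>A\<in>sets ?H. emeasure ?H A \<le> ennreal V \<longrightarrow>
       L1_on ?H A (\<lambda>y. f k y - 0) \<le> ennreal e"
      by (rule unif) (use pe that in \<open>auto simp: V_def intro: fm\<close>)
    from eventually_happens'[OF sequentially_bot ev]
    obtain k where k: "\<forall>A\<in>sets ?H. emeasure ?H A \<le> ennreal V \<longrightarrow>
       L1_on ?H A (\<lambda>y. f k y - 0) \<le> ennreal e" ..
    have s: "Q (real k) \<subseteq> halfspace" by (rule subQ) simp
    have "emeasure ?H (Q (real k)) = emeasure lebesgue (Q (real k))"
      using s by (intro emeasure_restrict_space) auto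
    also have "\<dots> = ennreal V"
      using lm[of "real k"] lmeasurable_cbox[of x "x + h *\<^sub>R One"]
        measure_translation[of "real k *\<^sub>R b" "cbox x (x + h *\<^sub>R One)"]
      unfolding Q_eq by (simp add: emeasure_eq_measure2 V_def)
    finally have "L1_on ?H (Q (real k)) (\<lambda>y. f k y - 0) \<le> ennreal e"
      using k s lm[of "real k"] by (auto simp: sets_restrict_space_iff fmeasurableD)
    then have "L1_on lebesgue (Q (real k)) (\<lambda>y. f k y - 0) \<le> ennreal e"
      using set_nn_integral_lebesgue_on[OF halfspace_measurable s] by metis
    also have "L1_on lebesgue (Q (real k)) (\<lambda>y. f k y - 0)
      = L1_on lebesgue (Q (real k)) (\<lambda>y. u y - 0)"
      using snd_Q[of _ "real k"] by (intro nn_integral_cong) (auto simp: f_def indicator_def)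
    finally have "norm (integral (Q (real k)) u - integral (Q (real k)) (\<lambda>_. 0)) \<le> e"
      using pe that
      by (intro norm_integral_diff_le Lp_fun_absolutely_integrable_on[OF Lpu _ halfspace_measurable lm s]) auto
    then show ?thesis using C[of "real k"] by (simp add: J_def)
  qed
  then have "C = 0" using field_le_epsilon[of "\<bar>C\<bar>" 0] by simp
  then show "integral (cbox x (x + h *\<^sub>R One)) u = 0" using C[of 0] by (simp add: J_def Q_def)
qed

section \<open>Boundary values controlled by a boundary layer\<close>

lemma has_integral_abs_le_nn_integral:
  fixes h k :: "real \<Rightarrow> real"
  assumes h: "(h has_integral I) {0..1}" and k: "continuous_on UNIV k"
    and le: "\<And>s. s \<in> {0..1} \<Longrightarrow> \<bar>h s\<bar> \<le> k s"
  shows "ennreal \<bar>I\<bar> \<le> (\<integral>\<^sup>+s\<in>{0..1}. ennreal (k s) \<partial>lborel)"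
proof -
  have i: "k integrable_on {0..1}"
    by (intro integrable_continuous_real continuous_on_subset[OF k]) simp
  have k0: "0 \<le> k s" if "s \<in> {0..1}" for s using le[OF that] by linarith
  have "norm (integral {0..1} h) \<le> integral {0..1} k"
    using h i le by (intro integral_norm_bound_integral) auto
  then have "ennreal \<bar>I\<bar> \<le> ennreal (integral {0..1} k)"
    using h by (intro ennreal_leI) (simp add: integral_unique)
  also have "\<dots> = (\<integral>\<^sup>+s. ennreal (indicator {0..1} s * k s) \<partial>lborel)"
    by (rule nn_integral_has_integral_lebesgue[symmetric]) (use i k0 in \<open>auto simp: has_integral_iff\<close>)
  also have "\<dots> = (\<integral>\<^sup>+s\<in>{0..1}. ennreal (k s) \<partial>lborel)"
    by (intro nn_integral_cong) (auto simp: indicator_def)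
  finally show ?thesis .
qed

lemma smooth_boundary_value_le:
  fixes \<phi> :: "'a::euclidean_space \<times> real \<Rightarrow> real"
  assumes "smooth \<phi>"
  shows "ennreal \<bar>\<phi> (y, 0)\<bar>
    \<le> (\<integral>\<^sup>+s\<in>{0..1}. ennreal (\<bar>\<phi> (y, s)\<bar> + norm (gradient \<phi> (y, s))) \<partial>lborel)"
proof -
  let ?k = "\<lambda>s. \<bar>\<phi> (y, s)\<bar> + norm (gradient \<phi> (y, s))"
  let ?h = "\<lambda>s. \<phi> (y, s) - (1 - s) * (gradient \<phi> (y, s) \<bullet> (0, 1))"
  have D: "((\<lambda>s. \<phi> (y, s)) has_real_derivative gradient \<phi> (y, s) \<bullet> (0, 1)) (at s)" for s
  proof -
    have "((\<lambda>s. (y, s)) has_derivative (\<lambda>h. h *\<^sub>R (0, 1))) (at s)"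
      by (auto intro!: derivative_eq_intros)
    from has_derivative_compose[OF this smooth_has_derivative[OF assms]]
    show ?thesis by (simp add: has_field_derivative_def inner_prod_def)
  qed
  \<comment> \<open>The weight 1 - s vanishes at s = 1, so the fundamental theorem leaves only the
    value at the boundary, expressed by \<open>\<phi>\<close> and its normal derivative on the
    segment.\<close>
  have "((\<lambda>s. - ((1 - s) * \<phi> (y, s))) has_vector_derivative ?h s) (at s within {0..1})" for s
    unfolding has_real_derivative_iff_has_vector_derivative[symmetric]
    by (rule has_field_derivative_at_within) (auto intro!: derivative_eq_intros D)
  then have "(?h has_integral (- ((1 - 1) * \<phi> (y, 1)) - - ((1 - 0) * \<phi> (y, 0)))) {0..1}"
    by (intro fundamental_theorem_of_calculus) auto
  then have h: "(?h has_integral \<phi> (y, 0)) {0..1}" by simp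
  have c: "continuous_on UNIV ?k"
    by (intro continuous_intros continuous_on_compose2[OF smooth_continuous_on[OF assms, of UNIV]]
        continuous_on_compose2[OF smooth_continuous_on_gradient[OF assms, of UNIV]]) auto
  have "\<bar>?h s\<bar> \<le> ?k s" if "s \<in> {0..1}" for s
  proof -
    have "\<bar>gradient \<phi> (y, s) \<bullet> (0, 1)\<bar> \<le> norm (gradient \<phi> (y, s)) * norm (0 :: 'a, 1 :: real)"
      by (rule Cauchy_Schwarz_ineq2)
    then have "\<bar>1 - s\<bar> * \<bar>gradient \<phi> (y, s) \<bullet> (0, 1)\<bar> \<le> 1 * norm (gradient \<phi> (y, s))"
      using that by (intro mult_mono) auto
    then show ?thesis
      using abs_triangle_ineq4[of "\<phi> (y, s)" "(1 - s) * (gradient \<phi> (y, s) \<bullet> (0, 1))"]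
      by (simp add: abs_mult)
  qed
  with h c show ?thesis by (rule has_integral_abs_le_nn_integral)
qed

text \<open>The estimate on a single normal segment, integrated over its foot point. This local L^1
  bound is all that the uniqueness of the trace asks for.\<close>

lemma smooth_boundary_L1_le:
  fixes \<phi> :: "'a::euclidean_space \<times> real \<Rightarrow> real"
  assumes "smooth \<phi>"
  shows "(\<integral>\<^sup>+y\<in>cbox a c. ennreal \<bar>\<phi> (y, 0)\<bar> \<partial>lebesgue)
    \<le> L1_on lebesgue (cbox (a, 0) (c, 1)) \<phi>
      + L1_on lebesgue (cbox (a, 0) (c, 1)) (\<lambda>x. gradient \<phi> x)"
proof -
  have [measurable]: "\<phi> \<in> borel_measurable borel" "gradient \<phi> \<in> borel_measurable borel"
    using assms by (auto intro!: borel_measurable_continuous_onI smooth_continuous_on smooth_continuous_on_gradient)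
  let ?k = "\<lambda>x. ennreal (\<bar>\<phi> x\<bar> + norm (gradient \<phi> x))"
  have m [measurable]: "(\<lambda>x. ?k x * indicator (cbox (a, 0) (c, 1)) x) \<in> borel_measurable (lborel \<Otimes>\<^sub>M lborel)"
    unfolding lborel_prod by measurable
  have "(\<integral>\<^sup>+y\<in>cbox a c. ennreal \<bar>\<phi> (y, 0)\<bar> \<partial>lebesgue) = (\<integral>\<^sup>+y\<in>cbox a c. ennreal \<bar>\<phi> (y, 0)\<bar> \<partial>lborel)"
    by (rule nn_integral_completion)
  also have "\<dots> \<le> (\<integral>\<^sup>+y. \<integral>\<^sup>+s. ?k (y, s) * indicator (cbox (a, 0) (c, 1)) (y, s) \<partial>lborel \<partial>lborel)"
  proof (rule nn_integral_mono)
    fix y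
    show "ennreal \<bar>\<phi> (y, 0)\<bar> * indicator (cbox a c) y
      \<le> (\<integral>\<^sup>+s. ?k (y, s) * indicator (cbox (a, 0) (c, 1)) (y, s) \<partial>lborel)"
    proof (cases "y \<in> cbox a c")
      case True
      then have "(\<integral>\<^sup>+s. ?k (y, s) * indicator (cbox (a, 0) (c, 1)) (y, s) \<partial>lborel)
        = (\<integral>\<^sup>+s\<in>{0..1}. ?k (y, s) \<partial>lborel)"
        by (intro nn_integral_cong) (auto simp: indicator_def cbox_Pair_eq)
      then show ?thesis using smooth_boundary_value_le[OF assms, of y] True by simp
    qed simp
  qed
  also have "\<dots> = (\<integral>\<^sup>+x. ?k x * indicator (cbox (a, 0) (c, 1)) x \<partial>(lborel \<Otimes>\<^sub>M lborel))"
    using lborel.nn_integral_fst[OF m] by simp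
  also have "\<dots> = (\<integral>\<^sup>+x. ?k x * indicator (cbox (a, 0) (c, 1)) x \<partial>lborel)"
    by (simp only: lborel_prod)
  also have "\<dots> = (\<integral>\<^sup>+x. ennreal (norm (\<phi> x)) * indicator (cbox (a, 0) (c, 1)) x
      + ennreal (norm (gradient \<phi> x)) * indicator (cbox (a, 0) (c, 1)) x \<partial>lborel)"
    by (intro nn_integral_cong) (auto simp: indicator_def)
  also have "\<dots> = L1_on lborel (cbox (a, 0) (c, 1)) \<phi>
      + L1_on lborel (cbox (a, 0) (c, 1)) (\<lambda>x. gradient \<phi> x)"
    by (intro nn_integral_add) auto
  finally show ?thesis by (simp only: nn_integral_completion)
qed

text \<open>The three convergences have different exponents; on sets of finite measure all errors
  become L^1 errors, and one test function serves them all.\<close>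

lemma D12_limit_L1_approx:
  fixes u :: "(real^'m) \<times> real \<Rightarrow> real"
  assumes dim: "2 \<le> CARD('m)" and u: "D12_limit u G \<tau>"
    and S: "S \<in> lmeasurable" "S \<subseteq> halfspace" and P: "P \<in> lmeasurable" and e: "0 < e"
  obtains \<phi> where "test_function \<phi>"
    "L1_on lebesgue S (\<lambda>x. gradient \<phi> x - G x) \<le> ennreal e"
    "L1_on lebesgue S (\<lambda>x. \<phi> x - u x) \<le> ennreal e"
    "L1_on lebesgue P (\<lambda>y. \<phi> (y, 0) - \<tau> y) \<le> ennreal e"
proof -
  let ?p = "sobolev_exponent TYPE('m)" and ?q = "trace_exponent TYPE('m)"
  let ?H = "lebesgue_on halfspace :: ((real^'m) \<times> real) measure"
  note pq = one_less_sobolev_exponent[OF dim] two_less_trace_exponent[OF dim]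
  obtain \<phi> where \<phi>: "D12_approx \<phi> u G \<tau>" using u by (auto simp: D12_limit_iff)
  have t: "test_function (\<phi> k)" for k using \<phi> by (simp add: D12_approx_def)
  note m = D12_limit_measurable[OF u] test_function_measurable[OF t]
  have conv: "Lp_tendsto ?H 2 (\<lambda>k. gradient (\<phi> k)) G" "Lp_tendsto ?H ?p \<phi> u"
    "Lp_tendsto lebesgue ?q (\<lambda>k y. \<phi> k (y, 0)) \<tau>"
    using \<phi> by (auto simp: D12_approx_def)
  define V where "V = max (measure lebesgue S) (measure lebesgue P)"
  have "emeasure ?H S = emeasure lebesgue S"
    using S by (intro emeasure_restrict_space) auto
  then have VS: "S \<in> sets ?H" "emeasure ?H S \<le> ennreal V"
    using S by (auto simp: sets_restrict_space_iff fmeasurableD emeasure_eq_measure2 V_def intro!: ennreal_leI)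
  have VP: "P \<in> sets lebesgue" "emeasure lebesgue P \<le> ennreal V"
    using P by (auto simp: fmeasurableD emeasure_eq_measure2 V_def intro!: ennreal_leI)
  have V: "0 \<le> V" by (simp add: V_def le_max_iff_disj)
  have "\<forall>\<^sub>F k in sequentially.
     (L1_on ?H S (\<lambda>x. gradient (\<phi> k) x - G x)) \<le> ennreal e \<and>
     L1_on ?H S (\<lambda>x. \<phi> k x - u x) \<le> ennreal e \<and>
     L1_on lebesgue P (\<lambda>y. \<phi> k (y, 0) - \<tau> y) \<le> ennreal e"
  proof (intro eventually_conj)
    have "\<forall>\<^sub>F k in sequentially. \<forall>A\<in>sets ?H. emeasure ?H A \<le> ennreal V \<longrightarrow>
        L1_on ?H A (\<lambda>x. gradient (\<phi> k) x - G x) \<le> ennreal e"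
      by (rule Lp_tendsto_imp_L1_uniform[OF conv(1) _ e V m(5) m(2)]) auto
    then show "\<forall>\<^sub>F k in sequentially. (L1_on ?H S (\<lambda>x. gradient (\<phi> k) x - G x)) \<le> ennreal e"
      by (rule eventually_mono) (use VS in blast)
    have "\<forall>\<^sub>F k in sequentially. \<forall>A\<in>sets ?H. emeasure ?H A \<le> ennreal V \<longrightarrow>
        L1_on ?H A (\<lambda>x. \<phi> k x - u x) \<le> ennreal e"
      by (rule Lp_tendsto_imp_L1_uniform[OF conv(2) _ e V m(4) m(1)]) (use pq in auto)
    then show "\<forall>\<^sub>F k in sequentially. (L1_on ?H S (\<lambda>x. \<phi> k x - u x)) \<le> ennreal e"
      by (rule eventually_mono) (use VS in blast)
    have "\<forall>\<^sub>F k in sequentially. \<forall>A\<in>sets lebesgue. emeasure lebesgue A \<le> ennreal V \<longrightarrow>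
        L1_on lebesgue A (\<lambda>y. \<phi> k (y, 0) - \<tau> y) \<le> ennreal e"
      by (rule Lp_tendsto_imp_L1_uniform[OF conv(3) _ e V m(6) m(3)]) (use pq in auto)
    then show "\<forall>\<^sub>F k in sequentially. (L1_on lebesgue P (\<lambda>y. \<phi> k (y, 0) - \<tau> y)) \<le> ennreal e"
      by (rule eventually_mono) (use VP in blast)
  qed
  from eventually_happens'[OF sequentially_bot this] obtain k where
    "L1_on ?H S (\<lambda>x. gradient (\<phi> k) x - G x) \<le> ennreal e"
    "L1_on ?H S (\<lambda>x. \<phi> k x - u x) \<le> ennreal e"
    "L1_on lebesgue P (\<lambda>y. \<phi> k (y, 0) - \<tau> y) \<le> ennreal e"
    by (elim exE conjE) (rule that)
  then show ?thesis
    by (intro that[OF t]) (simp_all only: set_nn_integral_lebesgue_on[OF halfspace_measurable S(2)])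
qed

text \<open>In L^1 the boundary values of a test function are bounded by the function and its
  gradient in a layer of height 1. Both are small here, since the limit is 0 and its gradient has
  already been shown to vanish.\<close>

lemma D12_limit_zero_trace:
  fixes \<tau> :: "real^'m \<Rightarrow> real"
  assumes dim: "2 \<le> CARD('m)" and u: "D12_limit (\<lambda>_. 0) G \<tau>"
  shows "AE y in lebesgue. \<tau> y = 0"
proof -
  note [measurable] = D12_limit_measurable(3)[OF u]
  have "AE x in lebesgue. x \<in> halfspace \<longrightarrow> G x = 0"
    using D12_limit_zero_gradient[OF dim u] by (subst (asm) AE_restrict_space_iff) auto
  note G0 = this
  \<comment> \<open>Finite measure is needed for the L^1 errors; countably many cubes exhaust the
    boundary.\<close>
  have "AE y in lebesgue. y \<in> cbox (- real n *\<^sub>R One) (real n *\<^sub>R One) \<longrightarrow> \<tau> y = 0" for n :: nat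
  proof -
    define P :: "(real^'m) set" where "P = cbox (- real n *\<^sub>R One) (real n *\<^sub>R One)"
    define S :: "((real^'m) \<times> real) set" where "S = cbox (- real n *\<^sub>R One, 0) (real n *\<^sub>R One, 1)"
    have S: "S \<subseteq> halfspace" by (auto simp: S_def cbox_Pair_eq halfspace_def)
    have lm: "S \<in> lmeasurable" "P \<in> lmeasurable" by (auto simp: S_def P_def lmeasurable_cbox)
    have le: "(\<integral>\<^sup>+y\<in>P. ennreal \<bar>\<tau> y\<bar> \<partial>lebesgue) \<le> 0 + ennreal e" if "0 < e" for e
    proof -
      have e3: "0 < e / 3" using that by simp
      obtain \<phi> where t: "test_function \<phi>" and
        k: "L1_on lebesgue S (\<lambda>x. gradient \<phi> x - G x) \<le> ennreal (e / 3)"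
          "L1_on lebesgue S (\<lambda>x. \<phi> x - 0) \<le> ennreal (e / 3)"
          "L1_on lebesgue P (\<lambda>y. \<phi> (y, 0) - \<tau> y) \<le> ennreal (e / 3)"
        by (rule D12_limit_L1_approx[OF dim u lm(1) S lm(2) e3])
      note [measurable] = test_function_measurable(3)[OF t]
      have "(\<integral>\<^sup>+y\<in>P. ennreal \<bar>\<tau> y\<bar> \<partial>lebesgue)
        \<le> (\<integral>\<^sup>+y. ennreal \<bar>\<phi> (y, 0)\<bar> * indicator P y + ennreal (norm (\<phi> (y, 0) - \<tau> y)) * indicator P y \<partial>lebesgue)"
        by (intro nn_integral_mono) (auto simp: indicator_def simp flip: ennreal_plus intro!: ennreal_leI)
      also have "\<dots> = (\<integral>\<^sup>+y\<in>P. ennreal \<bar>\<phi> (y, 0)\<bar> \<partial>lebesgue)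
          + L1_on lebesgue P (\<lambda>y. \<phi> (y, 0) - \<tau> y)"
        using lm(2) by (intro nn_integral_add) (auto simp: fmeasurableD)
      also have "(\<integral>\<^sup>+y\<in>P. ennreal \<bar>\<phi> (y, 0)\<bar> \<partial>lebesgue) \<le>
        L1_on lebesgue S \<phi> + L1_on lebesgue S (\<lambda>x. gradient \<phi> x)"
        unfolding P_def S_def by (rule smooth_boundary_L1_le[OF test_functionD(1)[OF t]])
      also have "L1_on lebesgue S \<phi> \<le> ennreal (e / 3)"
        using k(2) by simp
      \<comment> \<open>\<open>G\<close> vanishes almost everywhere, so the gradient is its own
        approximation error.\<close>
      also have "L1_on lebesgue S (\<lambda>x. gradient \<phi> x)
          = L1_on lebesgue S (\<lambda>x. gradient \<phi> x - G x)"
        by (rule nn_integral_cong_AE, rule eventually_mono[OF G0])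
          (use S in \<open>auto simp: indicator_def\<close>)
      also note k(1)
      also note k(3)
      also have "ennreal (e / 3) + ennreal (e / 3) + ennreal (e / 3) = ennreal e"
        using that by (simp flip: ennreal_plus)
      finally show ?thesis by (simp add: add_mono)
    qed
    have "(\<integral>\<^sup>+y\<in>P. ennreal \<bar>\<tau> y\<bar> \<partial>lebesgue) \<le> 0"
      by (rule ennreal_le_epsilon) (use le in auto)
    then have "(\<integral>\<^sup>+y\<in>P. ennreal \<bar>\<tau> y\<bar> \<partial>lebesgue) = 0" by simp
    then have "AE y in lebesgue. ennreal \<bar>\<tau> y\<bar> * indicator P y = 0"
      using lm(2) by (subst (asm) nn_integral_0_iff_AE) (auto simp: fmeasurableD)
    then show ?thesis
      unfolding P_def[symmetric] by (rule eventually_mono) (auto simp: indicator_def split: if_splits)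
  qed
  then have "AE y in lebesgue. \<forall>n. y \<in> cbox (- real n *\<^sub>R One) (real n *\<^sub>R One) \<longrightarrow> \<tau> y = 0"
    unfolding AE_all_countable ..
  then show ?thesis
  proof (rule eventually_mono)
    fix y :: "real^'m"
    assume *: "\<forall>n. y \<in> cbox (- real n *\<^sub>R One) (real n *\<^sub>R One) \<longrightarrow> \<tau> y = 0"
    obtain n :: nat where "norm y \<le> real n" using real_arch_simple by blast
    then have "\<bar>y \<bullet> b\<bar> \<le> real n" if "b \<in> Basis" for b
      using Basis_le_norm[OF that, of y] by linarith
    then have "y \<in> cbox (- real n *\<^sub>R One) (real n *\<^sub>R One)"
      by (simp add: mem_box abs_le_iff minus_le_iff)
    then show "\<tau> y = 0" using * by blast
  qed
qed

text \<open>\<open>weak_gradient\<close> and \<open>boundary_trace\<close> are chosen separately,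
  possibly with different partners, so each must be unique on its own. Subtracting the two
  representations leaves one of the function 0.\<close>

lemma D12_limit_unique:
  fixes u :: "(real^'m) \<times> real \<Rightarrow> real"
  assumes dim: "2 \<le> CARD('m)" and "D12_limit u G \<tau>" "D12_limit u G' \<tau>'"
  shows "AE x in lebesgue_on halfspace. G x = G' x" "AE y in lebesgue. \<tau> y = \<tau>' y"
proof -
  have "D12_limit (\<lambda>x. u x + (- 1) * u x) (\<lambda>x. G x + (- 1) *\<^sub>R G' x) (\<lambda>y. \<tau> y + (- 1) * \<tau>' y)"
    by (intro D12_limit_add D12_limit_cmult assms)
  then have d: "D12_limit (\<lambda>_. 0) (\<lambda>x. G x - G' x) (\<lambda>y. \<tau> y - \<tau>' y)" by simp
  show "AE x in lebesgue_on halfspace. G x = G' x" "AE y in lebesgue. \<tau> y = \<tau>' y"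
    using D12_limit_zero_gradient[OF dim d] D12_limit_zero_trace[OF dim d] by simp_all
qed

section \<open>The integrals computed from any gradient and trace\<close>

lemma D12_limit_D12: "D12_limit u G \<tau> \<Longrightarrow> u \<in> D12"
  by (auto simp: D12_def)

lemma dirichlet_integral_eq:
  fixes u :: "(real^'m) \<times> real \<Rightarrow> real"
  assumes dim: "2 \<le> CARD('m)" and u: "D12_limit u G \<tau>"
  shows "dirichlet_integral u = (\<integral>x. (norm (G x))\<^sup>2 \<partial>lebesgue_on halfspace)"
proof -
  have "\<exists>\<tau>. D12_limit u (weak_gradient u) \<tau>"
    unfolding weak_gradient_def by (rule someI[of "\<lambda>G. \<exists>\<tau>. D12_limit u G \<tau>"]) (use u in blast)
  then obtain \<tau>' where w: "D12_limit u (weak_gradient u) \<tau>'" ..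
  note [measurable] = D12_limit_measurable(2)[OF w] D12_limit_measurable(2)[OF u]
  show ?thesis unfolding dirichlet_integral_def
    by (rule integral_cong_AE) (use D12_limit_unique(1)[OF dim w u] in auto)
qed

lemma trace_integral_eq:
  fixes u :: "(real^'m) \<times> real \<Rightarrow> real"
  assumes dim: "2 \<le> CARD('m)" and u: "D12_limit u G \<tau>"
  shows "trace_integral u = (\<integral>y. \<bar>\<tau> y\<bar> powr trace_exponent TYPE('m) \<partial>lebesgue)"
proof -
  have "\<exists>G. D12_limit u G (boundary_trace u)"
    unfolding boundary_trace_def by (rule someI[of "\<lambda>\<tau>. \<exists>G. D12_limit u G \<tau>"]) (use u in blast)
  then obtain G' where w: "D12_limit u G' (boundary_trace u)" ..
  note [measurable] = D12_limit_measurable(3)[OF w] D12_limit_measurable(3)[OF u]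
  show ?thesis unfolding trace_integral_def
    by (rule integral_cong_AE) (use D12_limit_unique(2)[OF dim w u] in auto)
qed

section \<open>A Poincare inequality\<close>

lemma smooth_diff_le_segment:
  fixes \<phi> :: "'a::euclidean_space \<Rightarrow> real"
  assumes "smooth \<phi>"
  shows "ennreal \<bar>\<phi> x - \<phi> y\<bar>
    \<le> ennreal (norm (x - y)) * L1_on lborel ({0..1}) (\<lambda>t. gradient \<phi> (y + t *\<^sub>R (x - y)))"
proof -
  let ?h = "\<lambda>t. gradient \<phi> (y + t *\<^sub>R (x - y)) \<bullet> (x - y)"
  let ?k = "\<lambda>t. norm (x - y) * norm (gradient \<phi> (y + t *\<^sub>R (x - y)))"
  have D: "((\<lambda>t. \<phi> (y + t *\<^sub>R (x - y))) has_real_derivative ?h t) (at t)" for t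
  proof -
    have "((\<lambda>t. y + t *\<^sub>R (x - y)) has_derivative (\<lambda>h. h *\<^sub>R (x - y))) (at t)"
      by (auto intro!: derivative_eq_intros)
    from has_derivative_compose[OF this smooth_has_derivative[OF assms]]
    show ?thesis by (simp add: has_field_derivative_def mult_commute_abs)
  qed
  have "((\<lambda>t. \<phi> (y + t *\<^sub>R (x - y))) has_vector_derivative ?h t) (at t within {0..1})" for t
    unfolding has_real_derivative_iff_has_vector_derivative[symmetric]
    by (rule has_field_derivative_at_within) (rule D)
  then have "(?h has_integral (\<phi> (y + 1 *\<^sub>R (x - y)) - \<phi> (y + 0 *\<^sub>R (x - y)))) {0..1}"
    by (intro fundamental_theorem_of_calculus) auto
  then have h: "(?h has_integral (\<phi> x - \<phi> y)) {0..1}" by simp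
  have cg: "continuous_on UNIV (\<lambda>t. norm (gradient \<phi> (y + t *\<^sub>R (x - y))))"
    by (intro continuous_intros continuous_on_compose2[OF smooth_continuous_on_gradient[OF assms, of UNIV]]) auto
  then have ck: "continuous_on UNIV ?k" by (rule continuous_on_mult_left)
  have "\<bar>?h t\<bar> \<le> ?k t" for t
    using Cauchy_Schwarz_ineq2[of "gradient \<phi> (y + t *\<^sub>R (x - y))" "x - y"] by (simp add: mult.commute)
  then have "ennreal \<bar>\<phi> x - \<phi> y\<bar> \<le> (\<integral>\<^sup>+t\<in>{0..1}. ennreal (?k t) \<partial>lborel)"
    by (rule has_integral_abs_le_nn_integral[OF h ck])
  also have "\<dots> = (\<integral>\<^sup>+t. ennreal (norm (x - y)) * (ennreal (norm (gradient \<phi> (y + t *\<^sub>R (x - y)))) * indicator {0..1} t) \<partial>lborel)"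
    by (intro nn_integral_cong) (auto simp: indicator_def ennreal_mult)
  also have "\<dots> = ennreal (norm (x - y)) * L1_on lborel ({0..1}) (\<lambda>t. gradient \<phi> (y + t *\<^sub>R (x - y)))"
  proof (rule nn_integral_cmult)
    have [measurable]: "(\<lambda>t. norm (gradient \<phi> (y + t *\<^sub>R (x - y)))) \<in> borel_measurable lborel"
      using borel_measurable_continuous_onI[OF cg] by simp
    show "(\<lambda>t. ennreal (norm (gradient \<phi> (y + t *\<^sub>R (x - y)))) * indicator {0..1} t) \<in> borel_measurable lborel"
      by measurable
  qed
  finally show ?thesis .
qed

text \<open>The map contracts the convex set \<open>Q\<close> towards its point y and hence stays in
  \<open>Q\<close>. Its Jacobian t^DIM is at least 2^(-DIM), which gives the constant.\<close>

lemma nn_integral_contraction_le: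
  fixes f :: "'a::euclidean_space \<Rightarrow> ennreal"
  assumes [measurable]: "f \<in> borel_measurable borel" and "Q \<in> sets borel" "convex Q" "y \<in> Q" "1 / 2 \<le> t" "t \<le> 1"
  shows "(\<integral>\<^sup>+x\<in>Q. f (y + t *\<^sub>R (x - y)) \<partial>lborel) \<le> 2 ^ DIM('a) * (\<integral>\<^sup>+x\<in>Q. f x \<partial>lborel)"
proof -
  note [measurable] = assms(2)
  have t: "t \<noteq> 0" using assms by auto
  define g where "g x = f x * indicator Q x" for x
  have [measurable]: "g \<in> borel_measurable borel" unfolding g_def by measurable
  let ?T = "\<lambda>x. (y - t *\<^sub>R y) + t *\<^sub>R x"
  have T: "y + t *\<^sub>R (x - y) = ?T x" for x by (simp add: algebra_simps)
  have inQ: "?T x \<in> Q" if "x \<in> Q" for x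
  proof -
    have "(1 - t) *\<^sub>R y + t *\<^sub>R x \<in> Q" using assms that by (intro convexD) auto
    then show ?thesis by (simp add: algebra_simps)
  qed
  have "ennreal (\<bar>t\<bar> ^ DIM('a)) * (\<integral>\<^sup>+x. g (?T x) \<partial>lborel) = (\<integral>\<^sup>+x. g x \<partial>lborel)"
  proof -
    have "(\<integral>\<^sup>+x. g x \<partial>lborel) = (\<integral>\<^sup>+x. g x \<partial>density (distr lborel borel ?T) (\<lambda>_. \<bar>t\<bar> ^ DIM('a)))"
      by (subst lborel_affine[OF t, of "y - t *\<^sub>R y"]) simp
    also have "\<dots> = (\<integral>\<^sup>+x. ennreal (\<bar>t\<bar> ^ DIM('a)) * g x \<partial>distr lborel borel ?T)"
      by (subst nn_integral_density) auto
    also have "\<dots> = (\<integral>\<^sup>+x. ennreal (\<bar>t\<bar> ^ DIM('a)) * g (?T x) \<partial>lborel)"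
      by (subst nn_integral_distr) auto
    also have "\<dots> = ennreal (\<bar>t\<bar> ^ DIM('a)) * (\<integral>\<^sup>+x. g (?T x) \<partial>lborel)"
      by (rule nn_integral_cmult) measurable
    finally show ?thesis ..
  qed
  note eq = this
  have one: "1 \<le> 2 ^ DIM('a) * ennreal (\<bar>t\<bar> ^ DIM('a))"
  proof -
    have "1 \<le> (2 * t) ^ DIM('a)" using assms by (intro one_le_power) auto
    then have "ennreal 1 \<le> ennreal (2 ^ DIM('a) * \<bar>t\<bar> ^ DIM('a))"
      using assms by (intro ennreal_leI) (simp add: power_mult_distrib)
    then show ?thesis by (simp add: ennreal_mult ennreal_power[symmetric])
  qed
  have "(\<integral>\<^sup>+x\<in>Q. f (y + t *\<^sub>R (x - y)) \<partial>lborel) \<le> 1 * (\<integral>\<^sup>+x. g (?T x) \<partial>lborel)"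
    unfolding T g_def using inQ by (auto intro!: nn_integral_mono simp: indicator_def)
  also have "\<dots> \<le> 2 ^ DIM('a) * ennreal (\<bar>t\<bar> ^ DIM('a)) * (\<integral>\<^sup>+x. g (?T x) \<partial>lborel)"
    by (intro mult_right_mono one) simp
  also have "\<dots> = 2 ^ DIM('a) * (\<integral>\<^sup>+x\<in>Q. f x \<partial>lborel)"
    using eq by (simp add: g_def mult.assoc)
  finally show ?thesis .
qed

text \<open>The segment joining the two points is cut at its midpoint: on the half near \<open>x\<close> the
  substitution is made in \<open>x\<close>, on the other half in \<open>y\<close>, so that its Jacobian stays bounded.\<close>

lemma smooth_poincare_L1:
  fixes \<phi> :: "'a::euclidean_space \<Rightarrow> real"
  assumes "smooth \<phi>"
  shows "(\<integral>\<^sup>+x\<in>cbox a c. (\<integral>\<^sup>+y\<in>cbox a c. ennreal \<bar>\<phi> x - \<phi> y\<bar> \<partial>lborel) \<partial>lborel)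
    \<le> ennreal (norm (c - a)) * 2 ^ DIM('a) * emeasure lborel (cbox a c)
      * L1_on lborel (cbox a c) (\<lambda>x. gradient \<phi> x)"
proof -
  define Q where "Q = cbox a c"
  define f where "f x = ennreal (norm (gradient \<phi> x))" for x
  have [measurable]: "Q \<in> sets borel" and cQ: "convex Q" by (auto simp: Q_def convex_box)
  have [measurable]: "\<phi> \<in> borel_measurable borel" "gradient \<phi> \<in> borel_measurable borel"
    using assms by (auto intro!: borel_measurable_continuous_onI smooth_continuous_on smooth_continuous_on_gradient)
  have [measurable]: "f \<in> borel_measurable borel" unfolding f_def by measurable
  let ?I = "\<integral>\<^sup>+x\<in>Q. f x \<partial>lborel"
  let ?J = "\<lambda>t x. \<integral>\<^sup>+y\<in>Q. f (y + t *\<^sub>R (x - y)) \<partial>lborel"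
  let ?K = "\<lambda>x y. \<integral>\<^sup>+t\<in>{0..1}. f (y + t *\<^sub>R (x - y)) \<partial>lborel"
  have bound: "(\<integral>\<^sup>+x\<in>Q. ?J t x \<partial>lborel)
     \<le> 2 ^ DIM('a) * emeasure lborel Q * ?I" if t: "0 \<le> t" "t \<le> 1" for t
  proof -
    have const: "(\<integral>\<^sup>+x\<in>Q. 2 ^ DIM('a) * ?I \<partial>lborel)
      = 2 ^ DIM('a) * emeasure lborel Q * ?I"
      by (subst nn_integral_cmult_indicator) (auto simp: mult_ac)
    show ?thesis
    proof (cases "1 / 2 \<le> t")
      case True
      have m: "(\<lambda>(x, y). f (y + t *\<^sub>R (x - y)) * indicator Q y * indicator Q x)
          \<in> borel_measurable (lborel \<Otimes>\<^sub>M lborel)"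
        by measurable
      have "(\<integral>\<^sup>+x\<in>Q. ?J t x \<partial>lborel)
        = (\<integral>\<^sup>+x. (\<integral>\<^sup>+y. f (y + t *\<^sub>R (x - y)) * indicator Q y * indicator Q x \<partial>lborel) \<partial>lborel)"
        by (intro nn_integral_cong nn_integral_multc[symmetric]) measurable
      also have "\<dots> = (\<integral>\<^sup>+y. (\<integral>\<^sup>+x. f (y + t *\<^sub>R (x - y)) * indicator Q y * indicator Q x \<partial>lborel) \<partial>lborel)"
        by (rule lborel_pair.Fubini'[OF m, symmetric])
      also have "\<dots> \<le> (\<integral>\<^sup>+y\<in>Q. 2 ^ DIM('a) * ?I \<partial>lborel)"
      proof (rule nn_integral_mono)
        fix y
        show "(\<integral>\<^sup>+x. f (y + t *\<^sub>R (x - y)) * indicator Q y * indicator Q x \<partial>lborel)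
          \<le> 2 ^ DIM('a) * ?I * indicator Q y"
          using nn_integral_contraction_le[of f Q y t] cQ True t by (cases "y \<in> Q") auto
      qed
      finally show ?thesis unfolding const .
    next
      case False
      have "(\<integral>\<^sup>+x\<in>Q. ?J t x \<partial>lborel)
         \<le> (\<integral>\<^sup>+x\<in>Q. 2 ^ DIM('a) * ?I \<partial>lborel)"
      proof (intro nn_integral_mono)
        fix x
        have "y + t *\<^sub>R (x - y) = x + (1 - t) *\<^sub>R (y - x)" for y :: 'a by (simp add: algebra_simps)
        then show "?J t x * indicator Q x
          \<le> 2 ^ DIM('a) * ?I * indicator Q x"
          using nn_integral_contraction_le[of f Q x "1 - t"] cQ False t by (cases "x \<in> Q") auto
      qed
      then show ?thesis unfolding const .
    qed
  qed
  let ?N = "ennreal (norm (c - a))"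
  have diam: "norm (x - y) \<le> norm (c - a)" if "x \<in> Q" "y \<in> Q" for x y
    using that by (auto simp: Q_def mem_box inner_diff_left intro!: norm_le_componentwise abs_leI; fastforce)
  have "(\<integral>\<^sup>+x\<in>Q. (\<integral>\<^sup>+y\<in>Q. ennreal \<bar>\<phi> x - \<phi> y\<bar> \<partial>lborel) \<partial>lborel)
    \<le> (\<integral>\<^sup>+x\<in>Q. (\<integral>\<^sup>+y\<in>Q. ?N * ?K x y \<partial>lborel) \<partial>lborel)"
  proof (intro nn_integral_mono)
    fix x
    show "(\<integral>\<^sup>+y\<in>Q. ennreal \<bar>\<phi> x - \<phi> y\<bar> \<partial>lborel) * indicator Q x \<le>
      (\<integral>\<^sup>+y\<in>Q. ?N * ?K x y \<partial>lborel) * indicator Q x"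
    proof (cases "x \<in> Q")
      case True
      have "(\<integral>\<^sup>+y\<in>Q. ennreal \<bar>\<phi> x - \<phi> y\<bar> \<partial>lborel)
        \<le> (\<integral>\<^sup>+y\<in>Q. ?N * ?K x y \<partial>lborel)"
      proof (intro nn_integral_mono)
        fix y
        have "ennreal \<bar>\<phi> x - \<phi> y\<bar> \<le> ?N * ?K x y" if "y \<in> Q"
          using smooth_diff_le_segment[OF assms, of x y] diam[OF True that] unfolding f_def
          by (auto elim!: order_trans intro!: mult_right_mono ennreal_leI)
        then show "ennreal \<bar>\<phi> x - \<phi> y\<bar> * indicator Q y
          \<le> ?N * ?K x y * indicator Q y"
          by (auto simp: indicator_def)
      qed
      then show ?thesis using True by simp
    qed simp
  qed
  also have "\<dots> = ?N * (\<integral>\<^sup>+x\<in>Q. (\<integral>\<^sup>+y\<in>Q. ?K x y \<partial>lborel) \<partial>lborel)"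
    by (simp add: mult.assoc nn_integral_cmult)
  \<comment> \<open>Tonelli makes the segment parameter the outermost variable, so that each fixed t
    is covered by \<open>bound\<close>.\<close>
  also have "(\<integral>\<^sup>+x\<in>Q. (\<integral>\<^sup>+y\<in>Q. ?K x y \<partial>lborel) \<partial>lborel)
    = (\<integral>\<^sup>+t\<in>{0..1 :: real}. (\<integral>\<^sup>+x\<in>Q. ?J t x \<partial>lborel) \<partial>lborel)"
  proof -
    let ?F = "\<lambda>x y t. f (y + t *\<^sub>R (x - y)) * indicator Q y * indicator Q x * indicator {0..1 :: real} t"
    have "(\<integral>\<^sup>+x\<in>Q. (\<integral>\<^sup>+y\<in>Q. ?K x y \<partial>lborel) \<partial>lborel)
      = (\<integral>\<^sup>+x. (\<integral>\<^sup>+y. (\<integral>\<^sup>+t. ?F x y t \<partial>lborel) \<partial>lborel) \<partial>lborel)"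
    proof (intro nn_integral_cong)
      fix x
      have "(\<integral>\<^sup>+t. ?F x y t \<partial>lborel)
        = ?K x y * indicator Q y * indicator Q x" for y
        unfolding mult.assoc by (subst nn_integral_multc[symmetric]) (auto simp: mult_ac)
      then have "(\<integral>\<^sup>+y. (\<integral>\<^sup>+t. ?F x y t \<partial>lborel) \<partial>lborel)
        = (\<integral>\<^sup>+y. ?K x y * indicator Q y * indicator Q x \<partial>lborel)"
        by simp
      also have "\<dots> = (\<integral>\<^sup>+y\<in>Q. ?K x y \<partial>lborel) * indicator Q x"
        by (rule nn_integral_multc) measurable
      finally show "(\<integral>\<^sup>+y\<in>Q. ?K x y \<partial>lborel) * indicator Q x
        = (\<integral>\<^sup>+y. (\<integral>\<^sup>+t. ?F x y t \<partial>lborel) \<partial>lborel)" by simp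
    qed
    also have "\<dots> = (\<integral>\<^sup>+x. (\<integral>\<^sup>+t. (\<integral>\<^sup>+y. ?F x y t \<partial>lborel) \<partial>lborel) \<partial>lborel)"
      by (intro nn_integral_cong lborel_pair.Fubini'[symmetric]) measurable
    also have "\<dots> = (\<integral>\<^sup>+t. (\<integral>\<^sup>+x. (\<integral>\<^sup>+y. ?F x y t \<partial>lborel) \<partial>lborel) \<partial>lborel)"
      by (intro lborel_pair.Fubini'[symmetric]) measurable
    also have "\<dots> = (\<integral>\<^sup>+t\<in>{0..1 :: real}. (\<integral>\<^sup>+x\<in>Q. ?J t x \<partial>lborel) \<partial>lborel)"
      by (simp add: nn_integral_multc)
    finally show ?thesis .
  qed
  also have "\<dots> \<le> (\<integral>\<^sup>+t\<in>{0..1 :: real}. 2 ^ DIM('a) * emeasure lborel Q * ?I \<partial>lborel)"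
    using bound by (intro nn_integral_mono) (auto simp: indicator_def)
  also have "\<dots> = 2 ^ DIM('a) * emeasure lborel Q * ?I"
    by (subst nn_integral_cmult_indicator) auto
  finally show ?thesis
    unfolding Q_def f_def by (simp add: mult.assoc mult_left_mono)
qed

section \<open>The energy and the trace quotient\<close>

lemma D12_obtain:
  assumes "u \<in> D12"
  obtains G \<tau> where "D12_limit u G \<tau>"
  using assms by (auto simp: D12_def)

lemma dirichlet_integral_nonneg: "0 \<le> dirichlet_integral u"
  by (simp add: dirichlet_integral_def)

lemma trace_integral_nonneg: "0 \<le> trace_integral u"
  by (simp add: trace_integral_def)

text \<open>The supremum of an unbounded set of reals carries no information; a single w with
  positive trace integral bounds the set by its own quotient. The set contains 0, and its inequality
  passes to the supremum after division by the trace term.\<close>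

lemma trace_constant_bounds:
  fixes w :: "(real^'m) \<times> real \<Rightarrow> real"
  assumes w: "w \<in> D12" "0 < trace_integral w"
  shows "0 \<le> trace_constant TYPE('m)"
    and "\<And>v :: (real^'m) \<times> real \<Rightarrow> real. v \<in> D12 \<Longrightarrow>
      trace_constant TYPE('m) * trace_integral v powr (2 / trace_exponent TYPE('m)) \<le> dirichlet_integral v"
proof -
  let ?q = "2 / trace_exponent TYPE('m)"
  let ?X = "{S. \<forall>u\<in>(D12 :: ((real^'m) \<times> real \<Rightarrow> real) set).
       dirichlet_integral u \<ge> S * trace_integral u powr ?q}"
  have bound: "S \<le> dirichlet_integral v / trace_integral v powr ?q"
    if "S \<in> ?X" "v \<in> D12" "0 < trace_integral v" for S and v :: "(real^'m) \<times> real \<Rightarrow> real"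
    using that by (auto simp: pos_le_divide_eq)
  have bdd: "bdd_above ?X"
    by (rule bdd_aboveI) (rule bound[OF _ w])
  have zero: "0 \<in> ?X" by (simp add: dirichlet_integral_nonneg)
  show "0 \<le> trace_constant TYPE('m)"
    unfolding trace_constant_def by (rule cSup_upper[OF zero bdd])
  fix v :: "(real^'m) \<times> real \<Rightarrow> real"
  assume v: "v \<in> D12"
  show "trace_constant TYPE('m) * trace_integral v powr ?q \<le> dirichlet_integral v"
  proof (cases "trace_integral v = 0")
    case True
    then show ?thesis by (simp add: dirichlet_integral_nonneg)
  next
    case False
    then have pos: "0 < trace_integral v" using trace_integral_nonneg[of v] by linarith
    have "trace_constant TYPE('m) \<le> dirichlet_integral v / trace_integral v powr ?q"
      unfolding trace_constant_def using zero by (intro cSup_least bound v pos) blast+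
    then show ?thesis using pos by (simp add: pos_le_divide_eq)
  qed
qed

lemma D12_add_cmult:
  fixes u v :: "(real^'m) \<times> real \<Rightarrow> real"
  assumes "2 \<le> CARD('m)" "D12_limit u G \<tau>" "D12_limit v H \<sigma>"
  shows "D12_limit (\<lambda>x. u x + t * v x) (\<lambda>x. G x + t *\<^sub>R H x) (\<lambda>y. \<tau> y + t * \<sigma> y)"
  by (intro D12_limit_add D12_limit_cmult assms)

lemma dirichlet_integral_add_cmult:
  fixes u v :: "(real^'m) \<times> real \<Rightarrow> real"
  assumes dim: "2 \<le> CARD('m)" and u: "D12_limit u G \<tau>" and v: "D12_limit v H \<sigma>"
  shows "dirichlet_integral (\<lambda>x. u x + t * v x) = dirichlet_integral u
    + 2 * t * (\<integral>x. G x \<bullet> H x \<partial>lebesgue_on halfspace) + t\<^sup>2 * dirichlet_integral v"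
proof -
  let ?H = "lebesgue_on halfspace :: ((real^'m) \<times> real) measure"
  note L = D12_limit_Lp_fun(1)[OF dim u] D12_limit_Lp_fun(1)[OF dim v]
  note i = Lp_fun_2_integrable[OF L(1)] Lp_fun_2_integrable[OF L(2)] Lp_fun_2_integrable_inner[OF L]
  have "(norm (G x + t *\<^sub>R H x))\<^sup>2 = (norm (G x))\<^sup>2 + 2 * t * (G x \<bullet> H x) + t\<^sup>2 * (norm (H x))\<^sup>2" for x
    unfolding power2_norm_eq_inner
    by (simp add: inner_add_left inner_add_right inner_commute algebra_simps power2_eq_square)
  then show ?thesis
    using i by (simp add: dirichlet_integral_eq[OF dim D12_add_cmult[OF dim u v]]
        dirichlet_integral_eq[OF dim u] dirichlet_integral_eq[OF dim v])
qed

section \<open>Testing the equation with the positive part\<close>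

lemma energy_uminus:
  fixes u :: "(real^'m) \<times> real \<Rightarrow> real"
  assumes dim: "2 \<le> CARD('m)" and "u \<in> D12"
  shows "energy (\<lambda>x. - u x) = energy u"
proof -
  obtain G \<tau> where u: "D12_limit u G \<tau>" using assms(2) by (rule D12_obtain)
  have m: "D12_limit (\<lambda>x. - u x) (\<lambda>x. - G x) (\<lambda>y. - \<tau> y)"
    using D12_limit_cmult[OF dim u, of "- 1"] by simp
  show ?thesis
    by (simp add: energy_def dirichlet_integral_eq[OF dim u] dirichlet_integral_eq[OF dim m]
        trace_integral_eq[OF dim u] trace_integral_eq[OF dim m])
qed

text \<open>Allows u^- to be treated as the positive part of the solution -u, so that only positive
  parts have to be studied.\<close>

lemma weak_solution_uminus:
  fixes u :: "(real^'m) \<times> real \<Rightarrow> real"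
  assumes dim: "2 \<le> CARD('m)" and u: "weak_solution u"
  shows "weak_solution (\<lambda>x. - u x)"
proof -
  obtain G \<tau> where G: "D12_limit u G \<tau>" using u D12_obtain unfolding weak_solution_def by blast
  have "((\<lambda>t. energy (\<lambda>x. - u x + t * v x)) has_real_derivative 0) (at 0)" if v: "v \<in> D12" for v
  proof -
    obtain H \<sigma> where H: "D12_limit v H \<sigma>" using v by (rule D12_obtain)
    have mv: "D12_limit (\<lambda>x. - v x) (\<lambda>x. - H x) (\<lambda>y. - \<sigma> y)"
      using D12_limit_cmult[OF dim H, of "- 1"] by simp
    have "energy (\<lambda>x. - u x + t * v x) = energy (\<lambda>x. u x + t * - v x)" for t
      using energy_uminus[OF dim D12_limit_D12[OF D12_add_cmult[OF dim G mv, of t]]] by simp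
    moreover have "((\<lambda>t. energy (\<lambda>x. u x + t * - v x)) has_real_derivative 0) (at 0)"
      by (rule bspec[OF conjunct2[OF u[unfolded weak_solution_def]] D12_limit_D12[OF mv]])
    ultimately show ?thesis by (simp only:)
  qed
  moreover have "(\<lambda>x. - u x) \<in> D12"
    using D12_limit_D12[OF D12_limit_cmult[OF dim G, of "- 1"]] by simp
  ultimately show ?thesis by (simp add: weak_solution_def)
qed

text \<open>For t > -1 the factor 1 + t is positive, so a + t a^+ has the positive part (1 + t) a^+
  and the negative part of a, and the two do not overlap.\<close>

lemma abs_add_pos_part_powr:
  fixes a t p :: real
  assumes "- 1 < t" "0 < p"
  shows "\<bar>a + t * max a 0\<bar> powr p = (1 + t) powr p * max a 0 powr p + max (- a) 0 powr p"
proof (cases "0 \<le> a")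
  case True
  moreover have "0 \<le> (1 + t) * a" using True assms by (intro mult_nonneg_nonneg) auto
  ultimately have "\<bar>a + t * max a 0\<bar> = (1 + t) * a" by (simp add: algebra_simps)
  then show ?thesis using True assms by (simp add: powr_mult)
qed (use assms in auto)

text \<open>Testing the equation with \<open>u\<^sup>+\<close> needs no differentiation under the integral sign, since
  the trace term of \<open>u + t u\<^sup>+\<close> is an explicit function of \<open>t\<close>. The weight \<open>(1 + sgn u) / 2\<close> takes the
  value \<open>1 / 2\<close> on the zero set of \<open>u\<close>, where the gradient is not yet known to vanish.\<close>

lemma weak_solution_test_pos_part:
  fixes u :: "(real^'m) \<times> real \<Rightarrow> real"
  assumes dim: "2 \<le> CARD('m)" and sol: "weak_solution u" and u: "D12_limit u G \<tau>"
  shows "(\<integral>x. (1 + sgn (u x)) / 2 * (norm (G x))\<^sup>2 \<partial>lebesgue_on halfspace)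
     = trace_integral (\<lambda>x. max (u x) 0)"
    and "trace_integral u = trace_integral (\<lambda>x. max (u x) 0) + trace_integral (\<lambda>x. max (- u x) 0)"
proof -
  let ?p = "trace_exponent TYPE('m)"
  let ?H = "lebesgue_on halfspace :: ((real^'m) \<times> real) measure"
  note p = two_less_trace_exponent[OF dim]
  define v where "v x = max (u x) 0" for x
  define \<sigma> where "\<sigma> y = max (\<tau> y) 0" for y
  define H where "H x = ((1 + sgn (u x)) / 2) *\<^sub>R G x" for x
  have v: "D12_limit v H \<sigma>"
    using D12_limit_pos_part[OF dim u] by (simp add: v_def[abs_def] H_def[abs_def] \<sigma>_def[abs_def])
  have mu: "D12_limit (\<lambda>x. - u x) (\<lambda>x. - G x) (\<lambda>y. - \<tau> y)"
    using D12_limit_cmult[OF dim u, of "- 1"] by simp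
  note mv = D12_limit_pos_part[OF dim mu]
  define A where "A = trace_integral v"
  define B where "B = trace_integral (\<lambda>x. max (- u x) 0)"
  have A: "A = (\<integral>y. max (\<tau> y) 0 powr ?p \<partial>lebesgue)" and iA: "integrable lebesgue (\<lambda>y. max (\<tau> y) 0 powr ?p)"
    using trace_integral_eq[OF dim v] Lp_fun_integrable[OF D12_limit_Lp_fun(3)[OF dim v]]
    by (simp_all add: A_def \<sigma>_def)
  have B: "B = (\<integral>y. max (- \<tau> y) 0 powr ?p \<partial>lebesgue)" and iB: "integrable lebesgue (\<lambda>y. max (- \<tau> y) 0 powr ?p)"
    using trace_integral_eq[OF dim mv] Lp_fun_integrable[OF D12_limit_Lp_fun(3)[OF dim mv]]
    by (simp_all add: B_def)
  have T: "trace_integral (\<lambda>x. u x + t * v x) = (1 + t) powr ?p * A + B" if "- 1 < t" for t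
    using trace_integral_eq[OF dim D12_add_cmult[OF dim u v, of t]] that p iA iB
    by (simp add: \<sigma>_def abs_add_pos_part_powr A B)
  show "trace_integral u = trace_integral (\<lambda>x. max (u x) 0) + trace_integral (\<lambda>x. max (- u x) 0)"
    using T[of 0] by (simp add: A_def B_def v_def[abs_def])
  define I where "I = (\<integral>x. G x \<bullet> H x \<partial>?H)"
  define E where "E t = 1 / 2 * (dirichlet_integral u + 2 * t * I + t\<^sup>2 * dirichlet_integral v)
      - 1 / ?p * ((1 + t) powr ?p * A + B)" for t
  have d0: "((\<lambda>t. energy (\<lambda>x. u x + t * v x)) has_real_derivative 0) (at 0)"
    using sol D12_limit_D12[OF v] by (simp add: weak_solution_def)
  have E: "energy (\<lambda>x. u x + t * v x) = E t" if "- 1 < t" for t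
    using that by (simp add: energy_def E_def T dirichlet_integral_add_cmult[OF dim u v] I_def)
  \<comment> \<open>The energy is known to agree with the explicit formula for t > -1 only, hence a
    neighbourhood of radius 1.\<close>
  have "(E has_real_derivative 0) (at 0)"
    by (rule has_field_derivative_transform_within[OF d0, of 1])
      (use E in \<open>auto simp: dist_real_def\<close>)
  moreover have "(E has_real_derivative I - A) (at 0)"
    unfolding E_def using p by (auto intro!: derivative_eq_intros)
  ultimately have "0 = I - A" by (rule DERIV_unique)
  then have "I = A" by simp
  then show "(\<integral>x. (1 + sgn (u x)) / 2 * (norm (G x))\<^sup>2 \<partial>?H) = trace_integral (\<lambda>x. max (u x) 0)"
    by (simp add: I_def A_def H_def v_def[abs_def] power2_norm_eq_inner)
qed

lemma dirichlet_integral_pos_part: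
  fixes u :: "(real^'m) \<times> real \<Rightarrow> real"
  assumes dim: "2 \<le> CARD('m)" and u: "D12_limit u G \<tau>"
  shows "dirichlet_integral (\<lambda>x. max (u x) 0)
    = (\<integral>x. ((1 + sgn (u x)) / 2)\<^sup>2 * (norm (G x))\<^sup>2 \<partial>lebesgue_on halfspace)"
  using dirichlet_integral_eq[OF dim D12_limit_pos_part[OF dim u]]
  by (simp add: power_mult_distrib power_divide)

lemma integrable_weight_gradient:
  fixes u :: "(real^'m) \<times> real \<Rightarrow> real"
  assumes dim: "2 \<le> CARD('m)" and u: "D12_limit u G \<tau>" and "w \<in> borel_measurable (lebesgue_on halfspace)"
    and "\<And>x. \<bar>w x\<bar> \<le> c"
  shows "integrable (lebesgue_on halfspace) (\<lambda>x. w x * (norm (G x))\<^sup>2)"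
proof (rule Bochner_Integration.integrable_bound)
  note [measurable] = D12_limit_measurable[OF u] assms(3)
  show "integrable (lebesgue_on halfspace) (\<lambda>x. c * (norm (G x))\<^sup>2)"
    by (intro integrable_mult_right Lp_fun_2_integrable D12_limit_Lp_fun[OF dim u])
  show "(\<lambda>x. w x * (norm (G x))\<^sup>2) \<in> borel_measurable (lebesgue_on halfspace)" by measurable
  show "AE x in lebesgue_on halfspace. norm (w x * (norm (G x))\<^sup>2) \<le> norm (c * (norm (G x))\<^sup>2)"
  proof (rule AE_I2)
    fix x
    have "\<bar>w x\<bar> \<le> \<bar>c\<bar>" using assms(4)[of x] by linarith
    then show "norm (w x * (norm (G x))\<^sup>2) \<le> norm (c * (norm (G x))\<^sup>2)"
      by (auto simp: abs_mult intro!: mult_right_mono)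
  qed
qed

text \<open>The weight w = (1 + sgn u) / 2 takes the values 0, 1/2 and 1, so w^2 <= w; the equation
  yields the integral with w, the Dirichlet integral the one with w^2. If the trace integral were 0,
  the gradient w \<open>G\<close> of u^+ would vanish, and an element of \<open>D12\<close> with
  vanishing gradient is 0.\<close>

lemma weak_solution_pos_part_bounds:
  fixes u :: "(real^'m) \<times> real \<Rightarrow> real"
  assumes dim: "2 \<le> CARD('m)" and sol: "weak_solution u"
    and pos: "\<not> (AE x in lebesgue_on halfspace. max (u x) 0 = 0)"
  shows "dirichlet_integral (\<lambda>x. max (u x) 0) \<le> trace_integral (\<lambda>x. max (u x) 0)"
    and "0 < trace_integral (\<lambda>x. max (u x) 0)"
proof -
  let ?H = "lebesgue_on halfspace :: ((real^'m) \<times> real) measure"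
  obtain G \<tau> where u: "D12_limit u G \<tau>" using sol D12_obtain unfolding weak_solution_def by blast
  note [measurable] = D12_limit_measurable[OF u]
  let ?w = "\<lambda>x. (1 + sgn (u x)) / 2"
  have w: "0 \<le> ?w x" "?w x \<le> 1" "\<bar>?w x\<bar> \<le> 1" "\<bar>(?w x)\<^sup>2\<bar> \<le> 1" "(?w x)\<^sup>2 \<le> ?w x" for x
    by (auto simp: sgn_if power2_eq_square)
  have i1: "integrable ?H (\<lambda>x. ?w x * (norm (G x))\<^sup>2)"
    by (rule integrable_weight_gradient[OF dim u, where c = 1]) (use w(3) in auto)
  have i2: "integrable ?H (\<lambda>x. (?w x)\<^sup>2 * (norm (G x))\<^sup>2)"
    by (rule integrable_weight_gradient[OF dim u, where c = 1]) (use w(4) in auto)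
  show "dirichlet_integral (\<lambda>x. max (u x) 0) \<le> trace_integral (\<lambda>x. max (u x) 0)"
    unfolding dirichlet_integral_pos_part[OF dim u] weak_solution_test_pos_part(1)[OF dim sol u, symmetric]
  proof (rule integral_mono[OF i2 i1])
    fix x
    show "(?w x)\<^sup>2 * (norm (G x))\<^sup>2 \<le> ?w x * (norm (G x))\<^sup>2" by (rule mult_right_mono[OF w(5)]) simp
  qed
  show "0 < trace_integral (\<lambda>x. max (u x) 0)"
  proof (rule ccontr)
    assume "\<not> 0 < trace_integral (\<lambda>x. max (u x) 0)"
    then have "(\<integral>x. ?w x * (norm (G x))\<^sup>2 \<partial>?H) = 0"
      using trace_integral_nonneg[of "\<lambda>x. max (u x) 0"] weak_solution_test_pos_part(1)[OF dim sol u] by simp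
    then have "AE x in ?H. ?w x * (norm (G x))\<^sup>2 = 0"
      using w by (subst (asm) integral_nonneg_eq_0_iff_AE[OF i1]) auto
    then have "AE x in ?H. ?w x *\<^sub>R G x = 0" by (rule eventually_mono) auto
    from D12_limit_eq_0[OF dim D12_limit_pos_part[OF dim u] this] pos show False by simp
  qed
qed

section \<open>The equality case\<close>

text \<open>The difference w - w^2 of the two weights is 1/4 where u = 0 and 0 elsewhere.
  Extremality makes its integral against |\<open>G\<close>|^2 nonpositive, so \<open>G\<close>
  vanishes on the zero set. From here on the weight may be replaced by the indicator of {u >
  0}.\<close>

lemma extremal_pos_part_gradient_eq_0:
  fixes u :: "(real^'m) \<times> real \<Rightarrow> real"
  assumes dim: "2 \<le> CARD('m)" and sol: "weak_solution u" and u: "D12_limit u G \<tau>"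
    and ext: "trace_integral (\<lambda>x. max (u x) 0) \<le> dirichlet_integral (\<lambda>x. max (u x) 0)"
  shows "AE x in lebesgue_on halfspace. u x = 0 \<longrightarrow> G x = 0"
proof -
  let ?H = "lebesgue_on halfspace :: ((real^'m) \<times> real) measure"
  note [measurable] = D12_limit_measurable[OF u]
  let ?w = "\<lambda>x. (1 + sgn (u x)) / 2"
  have w: "\<bar>?w x\<bar> \<le> 1" "\<bar>(?w x)\<^sup>2\<bar> \<le> 1" "(?w x)\<^sup>2 \<le> ?w x" for x
    by (auto simp: sgn_if power2_eq_square)
  have i1: "integrable ?H (\<lambda>x. ?w x * (norm (G x))\<^sup>2)"
    by (rule integrable_weight_gradient[OF dim u, where c = 1]) (use w(1) in auto)
  have i2: "integrable ?H (\<lambda>x. (?w x)\<^sup>2 * (norm (G x))\<^sup>2)"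
    by (rule integrable_weight_gradient[OF dim u, where c = 1]) (use w(2) in auto)
  have i: "integrable ?H (\<lambda>x. ?w x * (norm (G x))\<^sup>2 - (?w x)\<^sup>2 * (norm (G x))\<^sup>2)"
    using i1 i2 by (rule Bochner_Integration.integrable_diff)
  have nn: "0 \<le> ?w x * (norm (G x))\<^sup>2 - (?w x)\<^sup>2 * (norm (G x))\<^sup>2" for x
    using mult_right_mono[OF w(3)[of x], of "(norm (G x))\<^sup>2"] by simp
  have "(\<integral>x. ?w x * (norm (G x))\<^sup>2 - (?w x)\<^sup>2 * (norm (G x))\<^sup>2 \<partial>?H)
    = trace_integral (\<lambda>x. max (u x) 0) - dirichlet_integral (\<lambda>x. max (u x) 0)"
    unfolding dirichlet_integral_pos_part[OF dim u] weak_solution_test_pos_part(1)[OF dim sol u, symmetric]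
    by (rule Bochner_Integration.integral_diff[OF i1 i2])
  then have "(\<integral>x. ?w x * (norm (G x))\<^sup>2 - (?w x)\<^sup>2 * (norm (G x))\<^sup>2 \<partial>?H) \<le> 0"
    using ext by simp
  moreover have "0 \<le> (\<integral>x. ?w x * (norm (G x))\<^sup>2 - (?w x)\<^sup>2 * (norm (G x))\<^sup>2 \<partial>?H)"
    by (rule Bochner_Integration.integral_nonneg) (rule nn)
  ultimately have "(\<integral>x. ?w x * (norm (G x))\<^sup>2 - (?w x)\<^sup>2 * (norm (G x))\<^sup>2 \<partial>?H) = 0" by simp
  then have "AE x in ?H. ?w x * (norm (G x))\<^sup>2 - (?w x)\<^sup>2 * (norm (G x))\<^sup>2 = 0"
    using nn by (subst (asm) integral_nonneg_eq_0_iff_AE[OF i]) auto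
  then show ?thesis by (rule eventually_mono) (auto simp: power2_eq_square)
qed

text \<open>A minimiser of the trace quotient that is nonnegative on the boundary is a supersolution:
  adding a nonnegative direction can only increase the trace term.\<close>

lemma extremal_pos_part_supersolution:
  fixes u v :: "(real^'m) \<times> real \<Rightarrow> real"
  assumes dim: "2 \<le> CARD('m)" and sol: "weak_solution u" and u: "D12_limit u G \<tau>"
    and K: "0 \<le> K" "\<And>v :: (real^'m) \<times> real \<Rightarrow> real. v \<in> D12 \<Longrightarrow>
       K * trace_integral v powr (2 / trace_exponent TYPE('m)) \<le> dirichlet_integral v"
    and ext: "dirichlet_integral (\<lambda>x. max (u x) 0)
       \<le> K * trace_integral (\<lambda>x. max (u x) 0) powr (2 / trace_exponent TYPE('m))"
    and grad: "AE x in lebesgue_on halfspace. u x = 0 \<longrightarrow> G x = 0"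
    and v: "D12_limit v V \<sigma>" "\<And>y. 0 \<le> \<sigma> y"
  shows "0 \<le> (\<integral>x. (if 0 < u x then G x \<bullet> V x else 0) \<partial>lebesgue_on halfspace)"
proof -
  let ?H = "lebesgue_on halfspace :: ((real^'m) \<times> real) measure"
  let ?p = "trace_exponent TYPE('m)"
  note p = two_less_trace_exponent[OF dim]
  note [measurable] = D12_limit_measurable[OF u] D12_limit_measurable[OF v(1)]
  note u' = D12_limit_pos_part[OF dim u]
  define I where "I = (\<integral>x. ((1 + sgn (u x)) / 2) *\<^sub>R G x \<bullet> V x \<partial>?H)"
  have le: "0 \<le> 2 * I + t * dirichlet_integral v" if t: "0 < t" for t
  proof -
    note s = D12_add_cmult[OF dim u' v(1), of t]
    have "trace_integral (\<lambda>x. max (u x) 0) \<le> trace_integral (\<lambda>x. max (u x) 0 + t * v x)"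
      unfolding trace_integral_eq[OF dim u'] trace_integral_eq[OF dim s]
    proof (rule integral_mono)
      show "integrable lebesgue (\<lambda>y. \<bar>max (\<tau> y) 0\<bar> powr ?p)"
        "integrable lebesgue (\<lambda>y. \<bar>max (\<tau> y) 0 + t * \<sigma> y\<bar> powr ?p)"
        using Lp_fun_integrable[OF D12_limit_Lp_fun(3)[OF dim u']]
          Lp_fun_integrable[OF D12_limit_Lp_fun(3)[OF dim s]] by simp_all
      fix y
      have "0 \<le> t * \<sigma> y" using t v(2)[of y] by simp
      then show "\<bar>max (\<tau> y) 0\<bar> powr ?p \<le> \<bar>max (\<tau> y) 0 + t * \<sigma> y\<bar> powr ?p"
        using p by (intro powr_mono2) auto
    qed
    then have "K * trace_integral (\<lambda>x. max (u x) 0) powr (2 / ?p)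
      \<le> K * trace_integral (\<lambda>x. max (u x) 0 + t * v x) powr (2 / ?p)"
      using p K(1) trace_integral_nonneg by (intro mult_left_mono powr_mono2) auto
    also have "\<dots> \<le> dirichlet_integral (\<lambda>x. max (u x) 0 + t * v x)"
      by (rule K(2)[OF D12_limit_D12[OF s]])
    also have "\<dots> = dirichlet_integral (\<lambda>x. max (u x) 0) + 2 * t * I + t\<^sup>2 * dirichlet_integral v"
      unfolding I_def by (rule dirichlet_integral_add_cmult[OF dim u' v(1)])
    finally have "0 \<le> t * (2 * I + t * dirichlet_integral v)"
      using ext by (simp add: algebra_simps power2_eq_square)
    then show ?thesis using t by (simp add: zero_le_mult_iff)
  qed
  have "0 \<le> I"
  proof (rule ccontr)
    assume I: "\<not> 0 \<le> I"
    let ?D = "dirichlet_integral v"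
    have D: "0 \<le> ?D" by (rule dirichlet_integral_nonneg)
    \<comment> \<open>For I < 0 the step t = -I / (D + 1) is positive and t D <= -I, so 2 I + t D <=
      I < 0. The 1 in the denominator covers D = 0.\<close>
    have "- I / (?D + 1) * ?D \<le> - I" using I D by (simp add: field_simps)
    moreover have "0 \<le> 2 * I + - I / (?D + 1) * ?D"
      using I D by (intro le divide_pos_pos) auto
    ultimately show False using I by linarith
  qed
  \<comment> \<open>The two weights differ only where u = 0, and there \<open>G\<close>
    vanishes.\<close>
  also have "I = (\<integral>x. (if 0 < u x then G x \<bullet> V x else 0) \<partial>?H)"
    unfolding I_def
  proof (rule integral_cong_AE)
    show "AE x in ?H. ((1 + sgn (u x)) / 2) *\<^sub>R G x \<bullet> V x = (if 0 < u x then G x \<bullet> V x else 0)"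
      using grad by (rule eventually_mono) (auto simp: sgn_if)
  qed measurable
  finally show ?thesis .
qed

section \<open>The logarithmic estimate\<close>

lemma D12_limit_tanh:
  fixes u :: "(real^'m) \<times> real \<Rightarrow> real"
  assumes dim: "2 \<le> CARD('m)" and u: "D12_limit u G \<tau>" and b: "smooth b" "\<And>x. \<bar>b x\<bar> \<le> B"
    and Lb: "Lp_fun (lebesgue_on halfspace) 2 (gradient b)" and l: "0 < l"
  shows "D12_limit (\<lambda>x. b x * tanh (l * u x))
    (\<lambda>x. (b x * (l * (1 - (tanh (l * u x))\<^sup>2))) *\<^sub>R G x + tanh (l * u x) *\<^sub>R gradient b x)
    (\<lambda>y. b (y, 0) * tanh (l * \<tau> y))"
proof (rule D12_limit_mult_compose[OF dim u b, where \<beta> = "\<lambda>x. norm (gradient b x)" and L = l])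
  show "smooth (\<lambda>x. tanh (l * f x))" if "smooth f" for f :: "(real^'m) \<times> real \<Rightarrow> real"
    using that by (auto intro!: times_cont_diff_tanh times_cont_diff_mult times_cont_diff_const)
  show "((\<lambda>t. tanh (l * t)) has_real_derivative l * (1 - (tanh (l * t))\<^sup>2)) (at t)" for t
    by (auto intro!: derivative_eq_intros)
  show "continuous_on UNIV (\<lambda>t. l * (1 - (tanh (l * t))\<^sup>2))" by (intro continuous_intros) auto
  have tb: "\<bar>tanh s\<bar> \<le> 1" for s :: real using tanh_real_bounds[of s] by auto
  show "\<bar>l * (1 - (tanh (l * t))\<^sup>2)\<bar> \<le> l" for t
    using tb[of "l * t"] l by (simp add: abs_mult abs_square_le_1 mult_left_le abs_le_iff)
  show "Lp_fun (lebesgue_on halfspace) 2 (\<lambda>x. norm (gradient b x))"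
    by (rule Lp_fun_mono[OF Lb, where c = 1]) (use Lp_fun_measurable[OF Lb] in auto)
  show "\<bar>tanh (l * t)\<bar> * norm (gradient b x) \<le> norm (gradient b x)" for t x
    using tb[of "l * t"] by (simp add: mult_right_le_one_le mult.commute)
qed simp

lemma borel_measurable_tanh [measurable]: "(tanh :: real \<Rightarrow> real) \<in> borel_measurable borel"
  by (intro borel_measurable_continuous_onI continuous_intros) auto

text \<open>The extremal inequality is tested with \<open>\<psi>\<^sup>2 (1 - tanh (l u))\<close>, a smooth substitute for the
  function \<open>\<psi>\<^sup>2 / (u\<^sup>+ + 1 / l)\<close> of Moser's logarithmic estimate.\<close>

lemma extremal_caccioppoli:
  fixes u :: "(real^'m) \<times> real \<Rightarrow> real"
  assumes dim: "2 \<le> CARD('m)" and u: "D12_limit u G \<tau>" and \<psi>: "test_function \<psi>" and l: "0 < l"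
    and super: "\<And>v V \<sigma>. D12_limit v V \<sigma> \<Longrightarrow> (\<And>y. 0 \<le> \<sigma> y) \<Longrightarrow>
      0 \<le> (\<integral>x. (if 0 < u x then G x \<bullet> V x else 0) \<partial>lebesgue_on halfspace)"
  shows "integrable (lebesgue_on halfspace)
      (\<lambda>x. if 0 < u x then (\<psi> x)\<^sup>2 * l\<^sup>2 * (1 - (tanh (l * u x))\<^sup>2) * (norm (G x))\<^sup>2 else 0)"
    and "(\<integral>x. (if 0 < u x then (\<psi> x)\<^sup>2 * l\<^sup>2 * (1 - (tanh (l * u x))\<^sup>2) * (norm (G x))\<^sup>2 else 0) \<partial>lebesgue_on halfspace)
    \<le> 4 * (\<integral>x. (if 0 < u x then (1 - tanh (l * u x)) * (norm (gradient \<psi> x))\<^sup>2 else 0) \<partial>lebesgue_on halfspace)"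
proof -
  let ?H = "lebesgue_on halfspace :: ((real^'m) \<times> real) measure"
  let ?b = "\<lambda>x. \<psi> x * \<psi> x" and ?T = "\<lambda>x. tanh (l * u x)"
  note [measurable] = D12_limit_measurable[OF u] test_function_measurable[OF \<psi>]
  have tb: "- 1 < tanh s" "tanh s < 1" for s :: real using tanh_real_bounds[of s] by auto
  have \<psi>2: "test_function ?b" by (rule test_function_mult[OF test_functionD(1)[OF \<psi>] \<psi>])
  obtain B where B: "\<And>x. \<bar>\<psi> x\<bar> \<le> B"
  proof -
    have "compact (\<psi> ` closure {x. \<psi> x \<noteq> 0})"
      by (intro compact_continuous_image smooth_continuous_on test_functionD[OF \<psi>])
    then obtain B where B: "\<And>x. x \<in> closure {x. \<psi> x \<noteq> 0} \<Longrightarrow> \<bar>\<psi> x\<bar> \<le> B"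
      using compact_imp_bounded[THEN bounded_iff[THEN iffD1]] by (metis image_eqI real_norm_def)
    have "\<bar>\<psi> x\<bar> \<le> max B 0" for x
      using B[of x] closure_subset[of "{x. \<psi> x \<noteq> 0}"] by (cases "\<psi> x = 0") (auto simp: le_max_iff_disj)
    then show ?thesis by (rule that)
  qed
  have Bb: "\<bar>?b x\<bar> \<le> B * B" for x
    unfolding abs_mult using B[of x] by (intro mult_mono) (auto intro: order_trans[OF abs_ge_zero])
  have gb: "gradient ?b = (\<lambda>x. (2 * \<psi> x) *\<^sub>R gradient \<psi> x)"
    using gradient_mult[OF test_functionD(1)[OF \<psi>] test_functionD(1)[OF \<psi>]]
    by (auto simp: scaleR_2 simp flip: scaleR_add_left)
  let ?V = "\<lambda>x. gradient ?b x + (- 1) *\<^sub>R ((?b x * (l * (1 - (?T x)\<^sup>2))) *\<^sub>R G x + ?T x *\<^sub>R gradient ?b x)"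
  \<comment> \<open>A cross term and a negative quadratic term, half of which will absorb the
    quadratic part of the bound on the cross term.\<close>
  let ?Z = "\<lambda>x. if 0 < u x then 2 * (\<psi> x * (1 - ?T x)) * (G x \<bullet> gradient \<psi> x)
        - (\<psi> x)\<^sup>2 * l * (1 - (?T x)\<^sup>2) * (norm (G x))\<^sup>2 else 0"
  have Z: "(\<lambda>x. if 0 < u x then G x \<bullet> ?V x else 0) = ?Z"
    unfolding gb power2_norm_eq_inner
    by (auto simp: fun_eq_iff inner_add_right algebra_simps power2_eq_square)
  have V: "D12_limit (\<lambda>x. ?b x + (- 1) * (?b x * ?T x)) ?V
    (\<lambda>y. \<psi> (y, 0) * \<psi> (y, 0) + (- 1) * (\<psi> (y, 0) * \<psi> (y, 0) * tanh (l * \<tau> y)))"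
    using test_functionD(1)[OF \<psi>2] test_function_Lp_fun_halfspace(2)[OF \<psi>2, of 2] l
    by (intro D12_limit_add D12_limit_cmult D12_limit_test_function D12_limit_tanh[where B = "B * B"] dim u \<psi>2 Bb) auto
  have main: "0 \<le> (\<integral>x. ?Z x \<partial>?H)" unfolding Z[symmetric]
  proof (rule super[OF V])
    fix y
    have "\<psi> (y, 0) * \<psi> (y, 0) + (- 1) * (\<psi> (y, 0) * \<psi> (y, 0) * tanh (l * \<tau> y))
      = (\<psi> (y, 0) * \<psi> (y, 0)) * (1 - tanh (l * \<tau> y))" by (simp add: algebra_simps)
    also have "0 \<le> \<dots>" using tb[of "l * \<tau> y"] by simp
    finally show "0 \<le> \<psi> (y, 0) * \<psi> (y, 0) + (- 1) * (\<psi> (y, 0) * \<psi> (y, 0) * tanh (l * \<tau> y))" .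
  qed
  have iZ: "integrable ?H ?Z" unfolding Z[symmetric]
  proof (rule Bochner_Integration.integrable_bound)
    note [measurable] = D12_limit_measurable(2)[OF V]
    show "integrable ?H (\<lambda>x. G x \<bullet> ?V x)"
      by (rule Lp_fun_2_integrable_inner[OF D12_limit_Lp_fun(1)[OF dim u] D12_limit_Lp_fun(1)[OF dim V]])
    show "(\<lambda>x. if 0 < u x then G x \<bullet> ?V x else 0) \<in> borel_measurable ?H" by measurable
  qed (auto intro!: AE_I2)
  let ?X = "\<lambda>x. if 0 < u x then (\<psi> x)\<^sup>2 * l\<^sup>2 * (1 - (?T x)\<^sup>2) * (norm (G x))\<^sup>2 else 0"
  let ?Y = "\<lambda>x. if 0 < u x then (1 - ?T x) * (norm (gradient \<psi> x))\<^sup>2 else 0"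
  have iX: "integrable ?H ?X"
  proof -
    let ?w = "\<lambda>x. if 0 < u x then (\<psi> x)\<^sup>2 * l\<^sup>2 * (1 - (?T x)\<^sup>2) else 0"
    have "integrable ?H (\<lambda>x. ?w x * (norm (G x))\<^sup>2)"
    proof (rule integrable_weight_gradient[OF dim u, where c = "B * B * l\<^sup>2"])
      fix x
      have "(?T x)\<^sup>2 \<le> 1" using tb[of "l * u x"] by (simp add: abs_square_le_1 abs_le_iff)
      then have "\<bar>(\<psi> x)\<^sup>2 * l\<^sup>2 * (1 - (?T x)\<^sup>2)\<bar> \<le> B * B * l\<^sup>2 * 1"
        using Bb[of x] unfolding abs_mult
        by (intro mult_mono) (auto simp: power2_eq_square abs_mult intro: order_trans[OF abs_ge_zero])
      moreover have "0 \<le> B * B * l\<^sup>2" by simp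
      ultimately show "\<bar>?w x\<bar> \<le> B * B * l\<^sup>2" by auto
    qed measurable
    then show ?thesis by (rule Bochner_Integration.integrable_cong[THEN iffD1, rotated -1]) auto
  qed
  then show "integrable ?H ?X" .
  have iY: "integrable ?H ?Y"
  proof (rule Bochner_Integration.integrable_bound)
    show "integrable ?H (\<lambda>x. 2 * (norm (gradient \<psi> x))\<^sup>2)"
      by (intro integrable_mult_right Lp_fun_2_integrable test_function_Lp_fun_halfspace \<psi>) simp
    show "?Y \<in> borel_measurable ?H" by measurable
    show "AE x in ?H. norm (?Y x) \<le> norm (2 * (norm (gradient \<psi> x))\<^sup>2)"
    proof (rule AE_I2)
      fix x
      have "\<bar>1 - ?T x\<bar> \<le> 2" using tb[of "l * u x"] by linarith
      then show "norm (?Y x) \<le> norm (2 * (norm (gradient \<psi> x))\<^sup>2)"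
        by (auto simp: abs_mult intro!: mult_right_mono)
    qed
  qed
  \<comment> \<open>Young's inequality in the form h (l/2) (a g - (2/l) d)^2 >= 0 with h = 1 -
    tanh(l u). Its quadratic part fits into half of the negative term because 0 <= tanh < 1 on {u >
    0} gives h <= 1 - tanh^2. Multiplying by 2 l at the end produces the constant 4, independent of
    l.\<close>
  have pt: "?Z x \<le> (2 / l) * ?Y x - (1 / (2 * l)) * ?X x" for x
  proof (cases "0 < u x")
    case True
    let ?h = "1 - ?T x" and ?g = "norm (G x)" and ?d = "norm (gradient \<psi> x)" and ?a = "\<bar>\<psi> x\<bar>"
    have T: "0 \<le> ?T x" "?T x < 1" using True l tb by auto
    have "2 * (\<psi> x * ?h) * (G x \<bullet> gradient \<psi> x) \<le> 2 * (?a * ?h) * (?g * ?d)"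
    proof -
      have "2 * (\<psi> x * ?h) * (G x \<bullet> gradient \<psi> x) \<le> \<bar>2 * (\<psi> x * ?h)\<bar> * \<bar>G x \<bullet> gradient \<psi> x\<bar>"
        by (metis abs_ge_self abs_mult)
      also have "\<dots> \<le> (2 * (?a * ?h)) * (?g * ?d)"
        using T Cauchy_Schwarz_ineq2[of "G x" "gradient \<psi> x"] by (intro mult_mono) (auto simp: abs_mult)
      finally show ?thesis .
    qed
    moreover have "2 * (?a * ?h) * (?g * ?d)
       \<le> (1 / 2) * (?a\<^sup>2 * l * (1 - (?T x)\<^sup>2) * ?g\<^sup>2) + (2 / l) * (?h * ?d\<^sup>2)"
    proof -
      have "0 \<le> ?h * (l / 2 * (?a * ?g - 2 / l * ?d)\<^sup>2)"
        using T l by (intro mult_nonneg_nonneg) auto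
      also have "\<dots> = (1 / 2) * (?a\<^sup>2 * l * ?h * ?g\<^sup>2) + (2 / l) * (?h * ?d\<^sup>2) - 2 * (?a * ?h) * (?g * ?d)"
        using l by (simp add: power2_diff field_simps power2_eq_square)
      finally have "2 * (?a * ?h) * (?g * ?d) \<le> (1 / 2) * (?a\<^sup>2 * l * ?h * ?g\<^sup>2) + (2 / l) * (?h * ?d\<^sup>2)" by simp
      moreover have "?a\<^sup>2 * l * ?h * ?g\<^sup>2 \<le> ?a\<^sup>2 * l * (1 - (?T x)\<^sup>2) * ?g\<^sup>2"
      proof (intro mult_right_mono mult_left_mono)
        have "(?T x)\<^sup>2 \<le> ?T x" using T by (simp add: power2_eq_square mult_left_le)
        then show "?h \<le> 1 - (?T x)\<^sup>2" by simp
      qed (use l in auto)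
      ultimately show ?thesis by simp
    qed
    ultimately have "2 * (\<psi> x * ?h) * (G x \<bullet> gradient \<psi> x)
       \<le> (1 / 2) * ((\<psi> x)\<^sup>2 * l * (1 - (?T x)\<^sup>2) * ?g\<^sup>2) + (2 / l) * (?h * ?d\<^sup>2)"
      by simp
    moreover have "(1 / (2 * l)) * ((\<psi> x)\<^sup>2 * l\<^sup>2 * (1 - (?T x)\<^sup>2) * ?g\<^sup>2)
       = (1 / 2) * ((\<psi> x)\<^sup>2 * l * (1 - (?T x)\<^sup>2) * ?g\<^sup>2)"
      using l by (simp add: power2_eq_square)
    ultimately show ?thesis using True by simp
  qed simp
  have "0 \<le> (\<integral>x. (2 / l) * ?Y x - (1 / (2 * l)) * ?X x \<partial>?H)"
    by (rule order_trans[OF main]) (use iX iY iZ in \<open>intro integral_mono pt; auto\<close>)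
  also have "\<dots> = (2 / l) * (\<integral>x. ?Y x \<partial>?H) - (1 / (2 * l)) * (\<integral>x. ?X x \<partial>?H)"
    using iX iY by simp
  finally show "(\<integral>x. ?X x \<partial>?H) \<le> 4 * (\<integral>x. ?Y x \<partial>?H)" using l by (simp add: field_simps)
qed

text \<open>The product of the two measures is the measure of the set of pairs (x, y) in the box
  with x in \<open>E\<close> and y outside. On it 1 <= |phi x - 1| + |phi x - phi y| + |phi y|: the
  outer terms are approximation errors, and the Poincare inequality controls the middle one. All
  three can be made small, so one factor is 0.\<close>

lemma poincare_dichotomy:
  fixes E :: "'a::euclidean_space set"
  assumes E [measurable]: "E \<in> sets lebesgue"
    and approx: "\<And>e. 0 < e \<Longrightarrow> \<exists>\<phi>. smooth \<phi> \<and>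
      L1_on lebesgue (cbox a c) (\<lambda>x. \<phi> x - indicator E x) \<le> ennreal e \<and>
      L1_on lebesgue (cbox a c) (\<lambda>x. gradient \<phi> x) \<le> ennreal e"
  shows "emeasure lebesgue (cbox a c \<inter> E) = 0 \<or> emeasure lebesgue (cbox a c - E) = 0"
proof -
  define Q where "Q = cbox a c"
  have Q [measurable]: "Q \<in> sets lebesgue" "Q \<in> sets borel" by (auto simp: Q_def)
  define V where "V = measure lborel Q"
  have V: "emeasure lborel Q = ennreal V" "emeasure lebesgue Q = ennreal V" "0 \<le> V"
  proof -
    have "emeasure lborel Q \<noteq> \<infinity>" using emeasure_lborel_cbox_finite[of a c] by (simp add: Q_def)
    then show "emeasure lborel Q = ennreal V" unfolding V_def by (intro emeasure_eq_ennreal_measure) simp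
    then show "emeasure lebesgue Q = ennreal V" using Q(2) by simp
    show "0 \<le> V" by (simp add: V_def)
  qed
  define C where "C = norm (c - a) * 2 ^ DIM('a) * V"
  have C: "0 \<le> C" "ennreal (norm (c - a)) * 2 ^ DIM('a) * emeasure lborel Q = ennreal C"
    using V by (auto simp: C_def ennreal_mult ennreal_power[symmetric])
  have le: "emeasure lebesgue (Q \<inter> E) * emeasure lebesgue (Q - E) \<le> 0 + ennreal e" if e: "0 < e" for e
  proof -
    \<comment> \<open>The two approximation errors contribute V d each and the Poincare term C d;
      the 1 keeps the denominator positive.\<close>
    define d where "d = e / (2 * V + C + 1)"
    have d: "0 < d" "(2 * V + C) * d \<le> e" using e V C by (auto simp: d_def field_simps)
    obtain \<phi> where \<phi>: "smooth \<phi>" and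
      a1: "L1_on lebesgue Q (\<lambda>x. \<phi> x - indicator E x) \<le> ennreal d" and
      a2: "L1_on lebesgue Q (\<lambda>x. gradient \<phi> x) \<le> ennreal d"
      using approx[OF d(1)] unfolding Q_def by blast
    have [measurable]: "\<phi> \<in> borel_measurable borel"
      using \<phi> by (auto intro!: borel_measurable_continuous_onI smooth_continuous_on)
    then have [measurable]: "\<phi> \<in> borel_measurable lebesgue" by (intro measurable_completion) simp
    define r where "r x = ennreal (norm (\<phi> x - indicator E x)) * indicator Q x" for x
    have [measurable]: "r \<in> borel_measurable lebesgue" unfolding r_def by measurable
    define P where "P x = (\<integral>\<^sup>+y\<in>Q. ennreal \<bar>\<phi> x - \<phi> y\<bar> \<partial>lborel) * indicator Q x" for x
    have "P \<in> borel_measurable borel" unfolding P_def by measurable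
    then have [measurable]: "P \<in> borel_measurable lebesgue" by (intro measurable_completion) simp
    have P: "(\<integral>\<^sup>+y. ennreal \<bar>\<phi> x - \<phi> y\<bar> * indicator Q y * indicator Q x \<partial>lebesgue) = P x" for x
      unfolding P_def nn_integral_completion by (rule nn_integral_multc) measurable
    have "emeasure lebesgue (Q \<inter> E) * emeasure lebesgue (Q - E)
      = (\<integral>\<^sup>+x. (\<integral>\<^sup>+y. indicator (Q \<inter> E) x * indicator (Q - E) y \<partial>lebesgue) \<partial>lebesgue)"
      by (simp add: nn_integral_cmult nn_integral_multc)
    also have "\<dots> \<le> (\<integral>\<^sup>+x. (\<integral>\<^sup>+y. r x * indicator Q y
        + (ennreal \<bar>\<phi> x - \<phi> y\<bar> * indicator Q y * indicator Q x + r y * indicator Q x) \<partial>lebesgue) \<partial>lebesgue)"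
    proof (intro nn_integral_mono)
      fix x y
      show "indicator (Q \<inter> E) x * indicator (Q - E) y \<le> r x * indicator Q y
        + (ennreal \<bar>\<phi> x - \<phi> y\<bar> * indicator Q y * indicator Q x + r y * indicator Q x)"
      proof (cases "x \<in> Q \<inter> E \<and> y \<in> Q - E")
        case True
        have "1 \<le> \<bar>\<phi> x - 1\<bar> + (\<bar>\<phi> x - \<phi> y\<bar> + \<bar>\<phi> y\<bar>)" by linarith
        then have "ennreal 1 \<le> ennreal (\<bar>\<phi> x - 1\<bar> + (\<bar>\<phi> x - \<phi> y\<bar> + \<bar>\<phi> y\<bar>))" by (rule ennreal_leI)
        then show ?thesis using True by (simp add: r_def)
      qed (auto simp: indicator_def)
    qed
    also have "\<dots> = (\<integral>\<^sup>+x. r x * ennreal V + (P x + (\<integral>\<^sup>+y. r y \<partial>lebesgue) * indicator Q x) \<partial>lebesgue)"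
      using V by (simp add: nn_integral_add nn_integral_cmult nn_integral_multc P)
    also have "\<dots> = (\<integral>\<^sup>+y. r y \<partial>lebesgue) * ennreal V
        + ((\<integral>\<^sup>+x. P x \<partial>lebesgue) + (\<integral>\<^sup>+y. r y \<partial>lebesgue) * ennreal V)"
      using V by (simp add: nn_integral_add nn_integral_cmult nn_integral_multc)
    also have "(\<integral>\<^sup>+y. r y \<partial>lebesgue) \<le> ennreal d" using a1 by (simp add: r_def)
    also have "(\<integral>\<^sup>+x. P x \<partial>lebesgue) \<le> ennreal C * ennreal d"
    proof -
      have "(\<integral>\<^sup>+x. P x \<partial>lebesgue) = (\<integral>\<^sup>+x\<in>Q. (\<integral>\<^sup>+y\<in>Q. ennreal \<bar>\<phi> x - \<phi> y\<bar> \<partial>lborel) \<partial>lborel)"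
        by (simp add: P_def nn_integral_completion)
      also have "\<dots> \<le> ennreal C * L1_on lborel Q (\<lambda>x. gradient \<phi> x)"
        using smooth_poincare_L1[OF \<phi>, of a c] C(2) by (simp add: Q_def)
      also have "\<dots> \<le> ennreal C * ennreal d"
        using a2 by (intro mult_left_mono) (simp_all add: nn_integral_completion)
      finally show ?thesis .
    qed
    also have "ennreal d * ennreal V + (ennreal C * ennreal d + ennreal d * ennreal V)
        = ennreal ((2 * V + C) * d)"
      using V C d by (simp add: algebra_simps flip: ennreal_mult ennreal_plus)
    also have "\<dots> \<le> ennreal e" using d by (intro ennreal_leI)
    finally show ?thesis by (simp add: add_mono mult_right_mono)
  qed
  have "emeasure lebesgue (Q \<inter> E) * emeasure lebesgue (Q - E) \<le> 0"
    by (rule ennreal_le_epsilon) (use le in auto)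
  then show ?thesis by (simp add: Q_def)
qed

text \<open>Yields a nonzero test function without an explicit bump function: if all of them
  vanished, so would every limit.\<close>

lemma D12_limit_nonzero_test_function:
  fixes u :: "(real^'m) \<times> real \<Rightarrow> real"
  assumes dim: "2 \<le> CARD('m)" and u: "D12_limit u G \<tau>" and nz: "\<not> (AE x in lebesgue_on halfspace. u x = 0)"
  obtains \<phi> :: "(real^'m) \<times> real \<Rightarrow> real" and x where "test_function \<phi>" "\<phi> x \<noteq> 0"
proof (rule ccontr)
  assume "\<not> thesis"
  then have z: "\<phi> x = 0" if "test_function \<phi>" for \<phi> :: "(real^'m) \<times> real \<Rightarrow> real" and x
    using that by (metis \<open>\<And>x \<phi>. test_function \<phi> \<Longrightarrow> \<phi> x \<noteq> 0 \<Longrightarrow> thesis\<close>)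
  obtain \<phi> where \<phi>: "D12_approx \<phi> u G \<tau>" using u by (auto simp: D12_limit_iff)
  note [measurable] = D12_limit_measurable[OF u]
  have "\<phi> k x = 0" for k x using \<phi> z by (auto simp: D12_approx_def)
  then have "(\<lambda>k :: nat. \<integral>\<^sup>+x. ennreal (norm (u x) powr sobolev_exponent TYPE('m)) \<partial>lebesgue_on halfspace) \<longlonglongrightarrow> 0"
    using \<phi> by (simp add: D12_approx_def Lp_tendsto_def)
  then have "powr_norm_on (lebesgue_on halfspace) (sobolev_exponent TYPE('m)) u = 0"
    by (simp add: LIMSEQ_const_iff)
  then have "AE x in lebesgue_on halfspace. ennreal (norm (u x) powr sobolev_exponent TYPE('m)) = 0"
    by (subst (asm) nn_integral_0_iff_AE) auto
  then have "AE x in lebesgue_on halfspace. u x = 0"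
    by (rule eventually_mono) auto
  then show False using nz by simp
qed

text \<open>By continuity |phi| exceeds half of |phi x0| near x0. Zooming into that neighbourhood
  turns an arbitrary nonzero test function into one bounded away from 0 on a given bounded
  set.\<close>

lemma test_function_cutoff:
  fixes \<phi> :: "(real^'m) \<times> real \<Rightarrow> real"
  assumes \<phi>: "test_function \<phi>" and x0: "\<phi> x0 \<noteq> 0" and Q: "bounded Q"
  obtains \<psi> :: "(real^'m) \<times> real \<Rightarrow> real" and c where "test_function \<psi>" "0 < c" "\<And>x. x \<in> Q \<Longrightarrow> c \<le> (\<psi> x)\<^sup>2"
proof -
  obtain M where M: "0 < M" "\<And>x. x \<in> Q \<Longrightarrow> norm x \<le> M" using Q by (auto simp: bounded_pos)
  have "isCont \<phi> x0"
    using smooth_continuous_on[OF test_functionD(1)[OF \<phi>], of UNIV] continuous_on_eq_continuous_at[OF open_UNIV]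
    by blast
  then obtain d where d: "0 < d" "\<And>y. dist y x0 < d \<Longrightarrow> dist (\<phi> y) (\<phi> x0) < \<bar>\<phi> x0\<bar> / 2"
    using x0 unfolding continuous_at_eps_delta by (metis half_gt_zero zero_less_abs_iff)
  \<comment> \<open>Sends \<open>Q\<close> into the ball of radius d/2 about x0, strictly inside the
    radius d of continuity.\<close>
  define r where "r = d / (2 * M)"
  have r: "0 < r" "r * M < d" using d M by (auto simp: r_def)
  define \<psi> where "\<psi> x = \<phi> (x0 + r *\<^sub>R x)" for x
  have "compact ((\<lambda>y. (1 / r) *\<^sub>R (y - x0)) ` closure {x. \<phi> x \<noteq> 0})"
    by (intro compact_continuous_image test_functionD[OF \<phi>] continuous_intros)
  moreover have "closure {x. \<psi> x \<noteq> 0} \<subseteq> (\<lambda>y. (1 / r) *\<^sub>R (y - x0)) ` closure {x. \<phi> x \<noteq> 0}"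
  proof (rule closure_minimal)
    show "closed ((\<lambda>y. (1 / r) *\<^sub>R (y - x0)) ` closure {x. \<phi> x \<noteq> 0})"
      using calculation by (rule compact_imp_closed)
    show "{x. \<psi> x \<noteq> 0} \<subseteq> (\<lambda>y. (1 / r) *\<^sub>R (y - x0)) ` closure {x. \<phi> x \<noteq> 0}"
    proof
      fix x assume "x \<in> {x. \<psi> x \<noteq> 0}"
      then have "x0 + r *\<^sub>R x \<in> closure {x. \<phi> x \<noteq> 0}"
        using closure_subset[of "{x. \<phi> x \<noteq> 0}"] by (auto simp: \<psi>_def)
      moreover have "x = (1 / r) *\<^sub>R (x0 + r *\<^sub>R x - x0)" using r by simp
      ultimately show "x \<in> (\<lambda>y. (1 / r) *\<^sub>R (y - x0)) ` closure {x. \<phi> x \<noteq> 0}" by blast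
    qed
  qed
  ultimately have "compact (closure {x. \<psi> x \<noteq> 0})"
    using compact_Int_closed[OF _ closed_closure] by (metis inf.absorb2)
  moreover have "smooth \<psi>"
    unfolding \<psi>_def[abs_def] using test_functionD(1)[OF \<phi>] by (intro allI times_cont_diff_affine) blast
  ultimately have "test_function \<psi>" by (simp add: test_function_def)
  moreover have "(\<phi> x0 / 2)\<^sup>2 \<le> (\<psi> x)\<^sup>2" if "x \<in> Q" for x
  proof -
    have "r * norm x \<le> r * M" using M(2)[OF that] r by (intro mult_left_mono) auto
    then have "r * norm x < d" using r by linarith
    then have "dist (x0 + r *\<^sub>R x) x0 < d" using r by (simp add: dist_norm)
    from d(2)[OF this] have "\<bar>\<phi> x0 / 2\<bar> \<le> \<bar>\<psi> x\<bar>" unfolding \<psi>_def dist_real_def by arith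
    then show ?thesis by (rule abs_le_square_iff[THEN iffD1])
  qed
  moreover have "0 < (\<phi> x0 / 2)\<^sup>2" using x0 by simp
  ultimately show ?thesis by (intro that) auto
qed

lemma set_nn_integral_norm_triangle:
  fixes f g h :: "'a \<Rightarrow> 'b::euclidean_space"
  assumes [measurable]: "A \<in> sets M" "f \<in> borel_measurable M" "g \<in> borel_measurable M" "h \<in> borel_measurable M"
  shows "L1_on M A (\<lambda>x. f x - h x)
    \<le> L1_on M A (\<lambda>x. f x - g x) + L1_on M A (\<lambda>x. g x - h x)"
proof -
  have "L1_on M A (\<lambda>x. f x - h x)
    \<le> (\<integral>\<^sup>+x. ennreal (norm (f x - g x)) * indicator A x + ennreal (norm (g x - h x)) * indicator A x \<partial>M)"
  proof (rule nn_integral_mono)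
    fix x
    have "norm (f x - h x) \<le> norm (f x - g x) + norm (g x - h x)"
      using norm_triangle_ineq[of "f x - g x" "g x - h x"] by simp
    then show "ennreal (norm (f x - h x)) * indicator A x
      \<le> ennreal (norm (f x - g x)) * indicator A x + ennreal (norm (g x - h x)) * indicator A x"
      by (auto simp: indicator_def simp flip: ennreal_plus intro!: ennreal_leI)
  qed
  also have "\<dots> = L1_on M A (\<lambda>x. f x - g x) + L1_on M A (\<lambda>x. g x - h x)"
    by (rule nn_integral_add) measurable
  finally show ?thesis .
qed

text \<open>As l grows the right-hand side of the logarithmic estimate tends to 0, since 1 - tanh(l
  u) does so wherever u > 0. Its left-hand side dominates the squared gradient of tanh(l u^+) on
  \<open>Q\<close>, because (1 - tanh^2)^2 <= 1 - tanh^2 and the squared cutoff is at least c there.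
  Meanwhile tanh(l u^+) itself converges to the indicator.\<close>

lemma extremal_indicator_approx:
  fixes u :: "(real^'m) \<times> real \<Rightarrow> real"
  assumes dim: "2 \<le> CARD('m)" and u: "D12_limit u G \<tau>" and \<psi>: "test_function \<psi>"
    and super: "\<And>v V \<sigma>. D12_limit v V \<sigma> \<Longrightarrow> (\<And>y. 0 \<le> \<sigma> y) \<Longrightarrow>
      0 \<le> (\<integral>x. (if 0 < u x then G x \<bullet> V x else 0) \<partial>lebesgue_on halfspace)"
    and grad: "AE x in lebesgue_on halfspace. u x = 0 \<longrightarrow> G x = 0"
    and Q: "Q \<in> lmeasurable" "Q \<subseteq> halfspace"
    and c: "0 < c" "\<And>x. x \<in> Q \<Longrightarrow> c \<le> (\<psi> x)\<^sup>2" and e: "0 < e"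
  shows "\<exists>\<phi>. smooth \<phi> \<and>
    L1_on lebesgue Q (\<lambda>x. \<phi> x - indicator {x \<in> halfspace. 0 < u x} x) \<le> ennreal e \<and>
    L1_on lebesgue Q (\<lambda>x. gradient \<phi> x) \<le> ennreal e"
proof -
  let ?H = "lebesgue_on halfspace :: ((real^'m) \<times> real) measure"
  let ?l = "\<lambda>j :: nat. real (Suc j)"
  note [measurable] = D12_limit_measurable[OF u] test_function_measurable[OF \<psi>]
  have tb: "- 1 < tanh s" "tanh s < 1" for s :: real using tanh_real_bounds[of s] by auto
  have QH [measurable]: "Q \<in> sets ?H" and EQ: "emeasure ?H Q = emeasure lebesgue Q"
    using Q by (auto simp: sets_restrict_space_iff emeasure_restrict_space fmeasurableD)
  define X where "X j x = (if 0 < u x then (\<psi> x)\<^sup>2 * (?l j)\<^sup>2 * (1 - (tanh (?l j * u x))\<^sup>2) * (norm (G x))\<^sup>2 else 0)" for j x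
  define Y where "Y j x = (if 0 < u x then (1 - tanh (?l j * u x)) * (norm (gradient \<psi> x))\<^sup>2 else 0)" for j x
  have XY: "integral\<^sup>L ?H (X j) \<le> 4 * integral\<^sup>L ?H (Y j)" "integrable ?H (X j)" for j
    unfolding X_def[abs_def] Y_def[abs_def]
    by (rule extremal_caccioppoli[OF dim u \<psi>], simp, rule super, assumption+)+
  have X0: "0 \<le> X j x" for j x
    using tb[of "?l j * u x"] by (auto simp: X_def abs_square_le_1 abs_le_iff)
  have Ylim: "(\<lambda>j. integral\<^sup>L ?H (Y j)) \<longlonglongrightarrow> (\<integral>x. 0 \<partial>?H)"
  proof (rule integral_dominated_convergence[where w = "\<lambda>x. 2 * (norm (gradient \<psi> x))\<^sup>2"])
    show "integrable ?H (\<lambda>x. 2 * (norm (gradient \<psi> x))\<^sup>2)"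
      by (intro integrable_mult_right Lp_fun_2_integrable test_function_Lp_fun_halfspace \<psi>) simp
    show "Y j \<in> borel_measurable ?H" for j unfolding Y_def[abs_def] by measurable
    show "AE x in ?H. (\<lambda>j. Y j x) \<longlonglongrightarrow> 0"
    proof (rule AE_I2)
      fix x
      show "(\<lambda>j. Y j x) \<longlonglongrightarrow> 0"
      proof (cases "0 < u x")
        case True
        have "(\<lambda>j. (1 - tanh (?l j * u x)) * (norm (gradient \<psi> x))\<^sup>2) \<longlonglongrightarrow> (1 - sgn (u x)) * (norm (gradient \<psi> x))\<^sup>2"
          by (intro tendsto_intros tanh_mult_tendsto_sgn)
        then show ?thesis using True by (simp add: Y_def)
      qed (simp add: Y_def)
    qed
    show "AE x in ?H. norm (Y j x) \<le> 2 * (norm (gradient \<psi> x))\<^sup>2" for j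
    proof (rule AE_I2)
      fix x
      have "\<bar>1 - tanh (?l j * u x)\<bar> \<le> 2" using tb[of "?l j * u x"] by linarith
      then show "norm (Y j x) \<le> 2 * (norm (gradient \<psi> x))\<^sup>2"
        by (auto simp: Y_def abs_mult intro!: mult_right_mono)
    qed
  qed simp
  \<comment> \<open>The positive part is taken because tanh(l u) would converge to sgn u instead of
    the indicator.\<close>
  define f where "f j x = tanh (?l j * max (u x) 0)" for j x
  define F where "F j x = (?l j * (1 - (f j x)\<^sup>2)) *\<^sub>R (((1 + sgn (u x)) / 2) *\<^sub>R G x)" for j x
  have f: "D12_limit (f j) (F j) (\<lambda>y. tanh (?l j * max (\<tau> y) 0))" for j
    using D12_limit_tanh[OF dim D12_limit_pos_part[OF dim u], of "\<lambda>_. 1" 1 "?l j"]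
    by (simp add: gradient_const[abs_def] times_cont_diff_const Lp_fun_def f_def[abs_def] F_def[abs_def])
  note fm [measurable] = D12_limit_measurable(1,2)[OF f]
  \<comment> \<open>Outside {u > 0} the left-hand side is 0: on {u < 0} by the weight, on {u = 0}
    because \<open>G\<close> vanishes there.\<close>
  have FX: "AE x in ?H. (norm (indicator Q x *\<^sub>R F j x))\<^sup>2 \<le> X j x / c" for j
    using grad
  proof eventually_elim
    case (elim x)
    show ?case
    proof (cases "x \<in> Q \<and> 0 < u x")
      case True
      let ?T = "tanh (?l j * u x)"
      have T: "0 \<le> 1 - ?T\<^sup>2" "1 - ?T\<^sup>2 \<le> 1" using tb[of "?l j * u x"] by (auto simp: abs_square_le_1 abs_le_iff)
      have T2: "(1 - ?T\<^sup>2)\<^sup>2 \<le> 1 - ?T\<^sup>2"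
        unfolding power2_eq_square[of "1 - ?T\<^sup>2"] by (rule mult_left_le[OF T(2) T(1)])
      have "(norm (indicator Q x *\<^sub>R F j x))\<^sup>2 = (?l j)\<^sup>2 * (1 - ?T\<^sup>2)\<^sup>2 * (norm (G x))\<^sup>2"
        using True by (simp add: F_def f_def power_mult_distrib)
      also have "\<dots> \<le> (?l j)\<^sup>2 * (1 - ?T\<^sup>2) * (norm (G x))\<^sup>2"
        by (intro mult_right_mono mult_left_mono T2) auto
      finally have "c * (norm (indicator Q x *\<^sub>R F j x))\<^sup>2 \<le> (\<psi> x)\<^sup>2 * ((?l j)\<^sup>2 * (1 - ?T\<^sup>2) * (norm (G x))\<^sup>2)"
        using c True by (intro mult_mono) auto
      then show ?thesis using True c by (simp add: X_def field_simps)
    next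
      case False
      then have z: "indicator Q x *\<^sub>R F j x = 0"
        using elim by (cases "u x = 0") (auto simp: F_def sgn_if indicator_def)
      show ?thesis unfolding z using X0[of j x] c by simp
    qed
  qed
  have "Lp_tendsto ?H 2 (\<lambda>j x. indicator Q x *\<^sub>R F j x) (\<lambda>_. 0)"
    unfolding Lp_tendsto_def
  proof (rule tendsto_sandwich[OF _ _ tendsto_const])
    show "\<forall>\<^sub>F j in sequentially. 0 \<le> powr_norm_on ?H 2 (\<lambda>x. indicator Q x *\<^sub>R F j x - 0)"
      by simp
    show "\<forall>\<^sub>F j in sequentially. (powr_norm_on ?H 2 (\<lambda>x. indicator Q x *\<^sub>R F j x - 0))
       \<le> ennreal (4 / c * integral\<^sup>L ?H (Y j))"
    proof (rule always_eventually, rule allI)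
      fix j
      have "powr_norm_on ?H 2 (\<lambda>x. indicator Q x *\<^sub>R F j x - 0) \<le> (\<integral>\<^sup>+x. ennreal (X j x / c) \<partial>?H)"
        by (rule nn_integral_mono_AE, rule eventually_mono[OF FX[of j]]) (auto intro: ennreal_leI)
      also have "\<dots> = ennreal (\<integral>x. X j x / c \<partial>?H)"
        using XY(2) X0 c by (intro nn_integral_eq_integral) auto
      also have "\<dots> \<le> ennreal (4 / c * integral\<^sup>L ?H (Y j))"
        using XY(1)[of j] c by (intro ennreal_leI) (simp add: field_simps)
      finally show "powr_norm_on ?H 2 (\<lambda>x. indicator Q x *\<^sub>R F j x - 0)
         \<le> ennreal (4 / c * integral\<^sup>L ?H (Y j))" .
    qed
    have "(\<lambda>j. 4 / c * integral\<^sup>L ?H (Y j)) \<longlonglongrightarrow> 4 / c * 0"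
      using Ylim by (intro tendsto_mult tendsto_const) simp
    then show "(\<lambda>j. ennreal (4 / c * integral\<^sup>L ?H (Y j))) \<longlonglongrightarrow> 0"
      using tendsto_ennrealI[of _ 0] by fastforce
  qed
  note conv1 = this
  let ?E = "{x \<in> halfspace. 0 < u x}"
  have Em [measurable]: "indicat_real ?E \<in> borel_measurable ?H"
  proof -
    have "{x \<in> space ?H. 0 < u x} \<in> sets ?H" by measurable
    then have "?E \<in> sets ?H" by (simp add: space_restrict_space)
    then show ?thesis by (rule borel_measurable_indicator)
  qed
  \<comment> \<open>Both functions take values in [0, 1] and \<open>Q\<close> has finite measure, so
    its indicator dominates the difference.\<close>
  have conv2: "Lp_tendsto ?H 1 (\<lambda>j x. indicator Q x *\<^sub>R f j x) (\<lambda>x. indicator Q x *\<^sub>R indicat_real ?E x)"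
  proof (rule Lp_tendsto_dominated[where F = "indicat_real Q"])
    show "Lp_fun ?H 1 (indicat_real Q)"
    proof -
      have "powr_norm_on ?H 1 (\<lambda>x. indicat_real Q x) = (\<integral>\<^sup>+x. indicator Q x \<partial>?H)"
        by (intro nn_integral_cong) (simp add: indicator_def)
      also have "\<dots> = emeasure lebesgue Q" unfolding EQ[symmetric] by (rule nn_integral_indicator[OF QH])
      also have "\<dots> < \<infinity>" using Q(1) by (auto simp: fmeasurable_def)
      finally show ?thesis by (simp only: Lp_fun_def) measurable
    qed
    show "AE x in ?H. (\<lambda>j. indicator Q x *\<^sub>R f j x) \<longlonglongrightarrow> indicator Q x *\<^sub>R indicat_real ?E x"
    proof (rule AE_I2)
      fix x assume "x \<in> space ?H"
      then have "sgn (max (u x) 0) = indicat_real ?E x"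
        by (auto simp: space_restrict_space indicator_def sgn_if)
      then show "(\<lambda>j. indicator Q x *\<^sub>R f j x) \<longlonglongrightarrow> indicator Q x *\<^sub>R indicat_real ?E x"
        unfolding f_def using tanh_mult_tendsto_sgn[of "max (u x) 0"] by (intro tendsto_intros) simp
    qed
    show "norm (indicator Q x *\<^sub>R f j x - indicator Q x *\<^sub>R indicat_real ?E x) \<le> norm (indicat_real Q x)" for j x
    proof -
      have "0 \<le> f j x" "f j x \<le> 1" using tb[of "?l j * max (u x) 0"] by (auto simp: f_def)
      then show ?thesis by (auto simp: indicator_def)
    qed
  qed measurable
  define V where "V = measure lebesgue Q"
  have V: "0 \<le> V" "emeasure ?H Q \<le> ennreal V"
    using Q(1) EQ by (auto simp: V_def emeasure_eq_measure2)
  have e2: "0 < e / 2" using e by simp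
  have m1: "(\<lambda>x. indicator Q x *\<^sub>R F j x) \<in> borel_measurable ?H"
    "(\<lambda>x. indicator Q x *\<^sub>R f j x) \<in> borel_measurable ?H" for j by measurable
  have m2: "(\<lambda>x. indicator Q x *\<^sub>R indicat_real ?E x) \<in> borel_measurable ?H" by measurable
  have ev1: "\<forall>\<^sub>F j in sequentially. \<forall>A\<in>sets ?H. emeasure ?H A \<le> ennreal V \<longrightarrow>
    L1_on ?H A (\<lambda>x. indicator Q x *\<^sub>R F j x - 0) \<le> ennreal (e / 2)"
    by (rule Lp_tendsto_imp_L1_uniform[OF conv1 _ e2 V(1) m1(1)]) auto
  have ev2: "\<forall>\<^sub>F j in sequentially. \<forall>A\<in>sets ?H. emeasure ?H A \<le> ennreal V \<longrightarrow>
    L1_on ?H A (\<lambda>x. indicator Q x *\<^sub>R f j x - indicator Q x *\<^sub>R indicat_real ?E x) \<le> ennreal (e / 2)"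
    by (rule Lp_tendsto_imp_L1_uniform[OF conv2 _ e2 V(1) m1(2) m2]) auto
  from eventually_happens'[OF sequentially_bot eventually_conj[OF ev1 ev2]] obtain j where
    j1: "L1_on ?H Q (\<lambda>x. indicator Q x *\<^sub>R F j x - 0) \<le> ennreal (e / 2)" and
    j2: "L1_on ?H Q (\<lambda>x. indicator Q x *\<^sub>R f j x - indicator Q x *\<^sub>R indicat_real ?E x) \<le> ennreal (e / 2)"
    using QH V(2) by blast
  have j1: "L1_on ?H Q (\<lambda>x. F j x - 0) \<le> ennreal (e / 2)"
    by (rule order_trans[OF _ j1]) (auto intro!: nn_integral_mono simp: indicator_def)
  have j2: "L1_on ?H Q (\<lambda>x. f j x - indicat_real ?E x) \<le> ennreal (e / 2)"
    by (rule order_trans[OF _ j2]) (auto intro!: nn_integral_mono simp: indicator_def)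
  note L = set_nn_integral_lebesgue_on[OF halfspace_measurable Q(2)]
  have ee: "ennreal (e / 2) + ennreal (e / 2) = ennreal e" using e by (simp flip: ennreal_plus)
  \<comment> \<open>\<open>f j\<close> is only a limit of test functions; one more approximation
    provides smoothness. The boundary set is empty, as no trace enters here.\<close>
  obtain \<phi> where t: "test_function \<phi>" and
    k: "L1_on lebesgue Q (\<lambda>x. gradient \<phi> x - F j x) \<le> ennreal (e / 2)"
      "L1_on lebesgue Q (\<lambda>x. \<phi> x - f j x) \<le> ennreal (e / 2)"
    by (rule D12_limit_L1_approx[OF dim f[of j] Q fmeasurable.empty_sets e2])
  note [measurable] = test_function_measurable[OF t]
  have "L1_on ?H Q (\<lambda>x. \<phi> x - indicat_real ?E x)
    \<le> L1_on ?H Q (\<lambda>x. \<phi> x - f j x) + L1_on ?H Q (\<lambda>x. f j x - indicat_real ?E x)"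
    by (rule set_nn_integral_norm_triangle) measurable
  also have "\<dots> \<le> ennreal (e / 2) + ennreal (e / 2)"
    using k(2) j2 unfolding L by (rule add_mono)
  finally have 1: "L1_on lebesgue Q (\<lambda>x. \<phi> x - indicat_real ?E x) \<le> ennreal e"
    unfolding ee L .
  have "L1_on ?H Q (\<lambda>x. gradient \<phi> x - 0)
    \<le> L1_on ?H Q (\<lambda>x. gradient \<phi> x - F j x) + L1_on ?H Q (\<lambda>x. F j x - 0)"
    by (rule set_nn_integral_norm_triangle) measurable
  also have "\<dots> \<le> ennreal (e / 2) + ennreal (e / 2)"
    using k(1) j1 unfolding L by (rule add_mono)
  finally have 2: "L1_on lebesgue Q (\<lambda>x. gradient \<phi> x) \<le> ennreal e"
    unfolding ee L by simp
  show ?thesis using 1 2 test_functionD(1)[OF t] by blast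
qed

text \<open>Here \<open>K\<close> stands for the trace constant, and \<open>ext\<close> closes the
  chain D <= T <= K T^(2/p) <= D for u^+. Hence u^+ minimises the quotient, the gradient vanishes on
  the zero set and the logarithmic estimate applies. A box that meets {u > 0} and {u < 0} in
  positive measure then contradicts the dichotomy.\<close>

lemma extremal_pos_part_not_sign_changing:
  fixes u :: "(real^'m) \<times> real \<Rightarrow> real"
  assumes dim: "2 \<le> CARD('m)" and sol: "weak_solution u" and sc: "sign_changing u"
    and K: "0 \<le> K" "\<And>v :: (real^'m) \<times> real \<Rightarrow> real. v \<in> D12 \<Longrightarrow>
       K * trace_integral v powr (2 / trace_exponent TYPE('m)) \<le> dirichlet_integral v"
    and ext: "trace_integral (\<lambda>x. max (u x) 0)
       \<le> K * trace_integral (\<lambda>x. max (u x) 0) powr (2 / trace_exponent TYPE('m))"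
  shows False
proof -
  let ?H = "lebesgue_on halfspace :: ((real^'m) \<times> real) measure"
  let ?u = "\<lambda>x. max (u x) 0"
  obtain G \<tau> where u: "D12_limit u G \<tau>" using sol D12_obtain unfolding weak_solution_def by blast
  note [measurable] = D12_limit_measurable[OF u]
  have pos: "\<not> (AE x in ?H. max (u x) 0 = 0)" and neg: "\<not> (AE x in ?H. max (- u x) 0 = 0)"
    using sc by (auto simp: sign_changing_def)
  have DT: "dirichlet_integral ?u \<le> trace_integral ?u"
    by (rule weak_solution_pos_part_bounds[OF dim sol pos])
  have KD: "K * trace_integral ?u powr (2 / trace_exponent TYPE('m)) \<le> dirichlet_integral ?u"
    by (rule K(2)[OF D12_limit_D12[OF D12_limit_pos_part[OF dim u]]])
  have grad: "AE x in ?H. u x = 0 \<longrightarrow> G x = 0"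
    by (rule extremal_pos_part_gradient_eq_0[OF dim sol u]) (use ext KD in linarith)
  have super: "0 \<le> (\<integral>x. (if 0 < u x then G x \<bullet> V x else 0) \<partial>?H)"
    if "D12_limit v V \<sigma>" "\<And>y. 0 \<le> \<sigma> y" for v V \<sigma>
    by (rule extremal_pos_part_supersolution[OF dim sol u K _ grad that]) (assumption, rule order_trans[OF DT ext])
  \<comment> \<open>Nested boxes that exhaust the closed half-space, so that a single one carries
    positive measure of both sign sets.\<close>
  define Q :: "nat \<Rightarrow> ((real^'m) \<times> real) set"
    where "Q n = cbox (- real n *\<^sub>R One, 0) (real n *\<^sub>R One, real n)" for n
  have QH: "Q n \<subseteq> halfspace" for n by (auto simp: Q_def cbox_Pair_eq halfspace_def)
  have Qmono: "Q m \<subseteq> Q n" if "m \<le> n" for m n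
    using that by (auto simp: Q_def cbox_Pair_eq mem_box) force+
  have Qex: "\<exists>n. x \<in> Q n" if "x \<in> halfspace" for x
  proof -
    obtain n :: nat where n: "norm (fst x) + \<bar>snd x\<bar> \<le> real n" using real_arch_simple by blast
    have "\<bar>fst x \<bullet> b\<bar> \<le> real n" if "b \<in> Basis" for b
      using Basis_le_norm[OF that, of "fst x"] n by linarith
    then have "fst x \<in> cbox (- real n *\<^sub>R One) (real n *\<^sub>R One)"
      by (simp add: mem_box abs_le_iff minus_le_iff)
    moreover have "snd x \<le> real n" using n norm_ge_zero[of "fst x"] by linarith
    then have "snd x \<in> {0..real n}" using that by (simp add: halfspace_def)
    ultimately show ?thesis by (auto simp: Q_def cbox_Pair_eq mem_Times_iff intro!: exI[of _ n])
  qed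
  have lm: "Q n \<in> lmeasurable" for n by (simp add: Q_def lmeasurable_cbox)
  have leb: "{x \<in> halfspace. P x} \<in> sets lebesgue" if "{x \<in> space ?H. P x} \<in> sets ?H" for P
    using that by (auto simp: space_restrict_space sets_restrict_space_iff)
  have nonnull: "\<exists>n. emeasure lebesgue (Q n \<inter> {x \<in> halfspace. P x}) \<noteq> 0"
    if P: "\<not> (AE x in ?H. \<not> P x)" "{x \<in> space ?H. P x} \<in> sets ?H" for P
  proof (rule ccontr)
    assume "\<not> ?thesis"
    then have "Q n \<inter> {x \<in> halfspace. P x} \<in> null_sets lebesgue" for n
      using leb[OF P(2)] lm[of n] by (auto simp: null_sets_def fmeasurableD)
    then have "AE x in lebesgue. x \<notin> Q n \<inter> {x \<in> halfspace. P x}" for n by (rule AE_not_in)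
    then have "AE x in lebesgue. \<forall>n. x \<notin> Q n \<inter> {x \<in> halfspace. P x}"
      unfolding AE_all_countable ..
    then have "AE x in lebesgue. x \<in> halfspace \<longrightarrow> \<not> P x"
      by (rule eventually_mono) (use Qex in blast)
    then show False using P(1) by (subst (asm) AE_restrict_space_iff) auto
  qed
  let ?E = "{x \<in> halfspace. 0 < u x}" and ?F = "{x \<in> halfspace. u x < 0}"
  have mE: "{x \<in> space ?H. 0 < u x} \<in> sets ?H" and mF: "{x \<in> space ?H. u x < 0} \<in> sets ?H"
    by measurable
  have "\<not> (AE x in ?H. \<not> 0 < u x)" by (rule contrapos_nn[OF pos], erule eventually_mono) auto
  from nonnull[OF this mE] obtain m where m: "emeasure lebesgue (Q m \<inter> ?E) \<noteq> 0" ..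
  have "\<not> (AE x in ?H. \<not> u x < 0)" by (rule contrapos_nn[OF neg], erule eventually_mono) auto
  from nonnull[OF this mF] obtain n where n: "emeasure lebesgue (Q n \<inter> ?F) \<noteq> 0" ..
  define R where "R = Q (max m n)"
  have "\<not> (AE x in ?H. u x = 0)" by (rule contrapos_nn[OF pos], erule eventually_mono) auto
  then obtain \<phi> :: "(real^'m) \<times> real \<Rightarrow> real" and x0 where \<phi>: "test_function \<phi>" "\<phi> x0 \<noteq> 0"
    by (rule D12_limit_nonzero_test_function[OF dim u])
  have "bounded R" by (simp add: R_def Q_def)
  then obtain \<psi> :: "(real^'m) \<times> real \<Rightarrow> real" and c
    where \<psi>: "test_function \<psi>" "0 < c" "\<And>x. x \<in> R \<Longrightarrow> c \<le> (\<psi> x)\<^sup>2"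
    by (rule test_function_cutoff[OF \<phi>]) (rule that)
  have "\<exists>\<phi>. smooth \<phi> \<and>
    L1_on lebesgue R (\<lambda>x. \<phi> x - indicator ?E x) \<le> ennreal e \<and>
    L1_on lebesgue R (\<lambda>x. gradient \<phi> x) \<le> ennreal e" if "0 < e" for e
    unfolding R_def
    by (rule extremal_indicator_approx[OF dim u \<psi>(1) super grad lm QH \<psi>(2) _ that])
      (assumption+, rule \<psi>(3)[unfolded R_def])
  then have "emeasure lebesgue (R \<inter> ?E) = 0 \<or> emeasure lebesgue (R - ?E) = 0"
    unfolding R_def Q_def by (intro poincare_dichotomy leb[OF mE])
  then show False
  proof
    assume "emeasure lebesgue (R \<inter> ?E) = 0"
    moreover have "emeasure lebesgue (Q m \<inter> ?E) \<le> emeasure lebesgue (R \<inter> ?E)"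
      using Qmono[of m "max m n"] leb[OF mE] lm[of "max m n"]
      by (intro emeasure_mono) (auto simp: R_def fmeasurableD)
    ultimately show False using m by simp
  next
    assume "emeasure lebesgue (R - ?E) = 0"
    moreover have "emeasure lebesgue (Q n \<inter> ?F) \<le> emeasure lebesgue (R - ?E)"
      using Qmono[of n "max m n"] leb[OF mE] lm[of "max m n"]
      by (intro emeasure_mono) (auto simp: R_def fmeasurableD)
    ultimately show False using n by simp
  qed
qed

text \<open>The exponent (n-2)/(n-1) is 2/2^*. Cancelling this power of \<open>A\<close> leaves S <=
  A^(1/(n-1)).\<close>

lemma power_le_of_mult_powr_le:
  fixes S A :: real and n :: nat
  assumes "3 \<le> n" "0 \<le> S" "0 < A" "S * A powr ((real n - 2) / (real n - 1)) \<le> A"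
  shows "S ^ (n - 1) \<le> A"
proof -
  have "S * A powr ((real n - 2) / (real n - 1)) \<le> A powr (1 / (real n - 1)) * A powr ((real n - 2) / (real n - 1))"
  proof -
    have "1 / (real n - 1) + (real n - 2) / (real n - 1) = 1" using assms(1) by (simp add: field_simps)
    then show ?thesis using assms(3,4) by (simp flip: powr_add)
  qed
  then have "S \<le> A powr (1 / (real n - 1))" using assms(3) by simp
  then have "S ^ (n - 1) \<le> (A powr (1 / (real n - 1))) ^ (n - 1)" using assms(2) by (intro power_mono)
  also have "\<dots> = (A powr (1 / (real n - 1))) powr real (n - 1)" using assms(3) by (simp add: powr_realpow)
  also have "\<dots> = A" using assms(1,3) by (simp add: powr_powr of_nat_diff)
  finally show ?thesis .
qed

theorem proposition1p3:
  fixes u :: "(real^'m) \<times> real \<Rightarrow> real"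
    and n :: nat
  assumes "n = ambient_dim TYPE('m)"
    and "n \<ge> 3"
    and "weak_solution u"
    and "sign_changing u"
  shows "energy u > 1 / (real n - 1) * trace_constant TYPE('m) ^ (n - 1)"
proof -
  let ?p = "trace_exponent TYPE('m)"
  have dim: "2 \<le> CARD('m)" using assms(1,2) by (simp add: ambient_dim_eq)
  have p1: "?p = 2 * (real n - 1) / (real n - 2)"
    using assms(1) by (simp add: trace_exponent_def)
  \<comment> \<open>Valid for vanishing a or b as well, since division by zero yields 0.\<close>
  have "2 / (2 * a / b) = b / a" for a b :: real by simp
  then have p2: "2 / ?p = (real n - 2) / (real n - 1)" unfolding p1 .
  define S where "S = trace_constant TYPE('m)"
  define A where "A = trace_integral (\<lambda>x. max (u x) 0)"
  define B where "B = trace_integral (\<lambda>x. max (- u x) 0)"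
  obtain G \<tau> where u: "D12_limit u G \<tau>" using assms(3) D12_obtain unfolding weak_solution_def by blast
  have mu: "D12_limit (\<lambda>x. - u x) (\<lambda>x. - G x) (\<lambda>y. - \<tau> y)"
    using D12_limit_cmult[OF dim u, of "- 1"] by simp
  note msol = weak_solution_uminus[OF dim assms(3)]
  have pos: "\<not> (AE x in lebesgue_on halfspace. max (u x) 0 = 0)"
    and neg: "\<not> (AE x in lebesgue_on halfspace. max (- u x) 0 = 0)"
    using assms(4) by (auto simp: sign_changing_def)
  have A: "dirichlet_integral (\<lambda>x. max (u x) 0) \<le> A" "0 < A"
    unfolding A_def by (rule weak_solution_pos_part_bounds[OF dim assms(3) pos])+
  have B: "dirichlet_integral (\<lambda>x. max (- u x) 0) \<le> B" "0 < B"
    unfolding B_def by (rule weak_solution_pos_part_bounds[OF dim msol neg])+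
  note pD = D12_limit_D12[OF D12_limit_pos_part[OF dim u]] and mD = D12_limit_D12[OF D12_limit_pos_part[OF dim mu]]
  have S: "0 \<le> S" "\<And>v :: (real^'m) \<times> real \<Rightarrow> real. v \<in> D12 \<Longrightarrow> S * trace_integral v powr (2 / ?p) \<le> dirichlet_integral v"
    unfolding S_def by (rule trace_constant_bounds[OF pD A(2)[unfolded A_def]]; assumption?)+
  have SA: "S ^ (n - 1) \<le> A"
    using S(2)[OF pD] A unfolding A_def[symmetric] p2 by (intro power_le_of_mult_powr_le[OF assms(2) S(1)]) auto
  have SB: "S ^ (n - 1) \<le> B"
    using S(2)[OF mD] B unfolding B_def[symmetric] p2 by (intro power_le_of_mult_powr_le[OF assms(2) S(1)]) auto
  \<comment> \<open>Strictness for one of the two parts is enough. In case of equality S A^(2/p) = S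
    S^(n-2) = A, which is the extremality refuted above.\<close>
  have "A \<noteq> S ^ (n - 1)"
  proof
    assume eq: "A = S ^ (n - 1)"
    then have "0 < S" using A(2) S(1) assms(2) by (cases "S = 0") (auto simp: power_0_left)
    then have "A powr (2 / ?p) = S powr (real n - 2)"
      using assms(2) by (simp add: eq p2 powr_powr of_nat_diff flip: powr_realpow)
    then have "S * A powr (2 / ?p) = S powr (1 + (real n - 2))" using \<open>0 < S\<close> powr_add[of S 1 "real n - 2"] by simp
    also have "\<dots> = A" using \<open>0 < S\<close> assms(2) by (simp add: eq of_nat_diff flip: powr_realpow)
    finally have le: "A \<le> S * A powr (2 / ?p)" by simp
    show False
      by (rule extremal_pos_part_not_sign_changing[OF dim assms(3,4) S(1)])
        (rule S(2), assumption, rule le[unfolded A_def])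
  qed
  then have AB: "2 * S ^ (n - 1) < A + B" using SA SB by linarith
  \<comment> \<open>The weights (1 + sgn u) / 2 and (1 - sgn u) / 2 add up to 1 on the zero set too,
    so the identities for u and -u sum to the full Dirichlet integral even though the gradient is
    not known to vanish there.\<close>
  have "dirichlet_integral u = A + B"
  proof -
    let ?H = "lebesgue_on halfspace :: ((real^'m) \<times> real) measure"
    note [measurable] = D12_limit_measurable[OF u]
    have i: "integrable ?H (\<lambda>x. (1 + sgn (u x)) / 2 * (norm (G x))\<^sup>2)" "integrable ?H (\<lambda>x. (1 - sgn (u x)) / 2 * (norm (G x))\<^sup>2)"
      by (rule integrable_weight_gradient[OF dim u, where c = 1]; auto simp: sgn_if)+
    have "A + B = (\<integral>x. (1 + sgn (u x)) / 2 * (norm (G x))\<^sup>2 \<partial>?H) + (\<integral>x. (1 - sgn (u x)) / 2 * (norm (G x))\<^sup>2 \<partial>?H)"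
      using weak_solution_test_pos_part(1)[OF dim assms(3) u] weak_solution_test_pos_part(1)[OF dim msol mu]
      by (simp add: A_def B_def sgn_minus)
    also have "\<dots> = (\<integral>x. (1 + sgn (u x)) / 2 * (norm (G x))\<^sup>2 + (1 - sgn (u x)) / 2 * (norm (G x))\<^sup>2 \<partial>?H)"
      by (rule Bochner_Integration.integral_add[OF i, symmetric])
    also have "\<dots> = (\<integral>x. (norm (G x))\<^sup>2 \<partial>?H)"
      by (rule Bochner_Integration.integral_cong) (auto simp: field_simps)
    finally show ?thesis by (simp add: dirichlet_integral_eq[OF dim u])
  qed
  then have "energy u = (1 / 2 - 1 / ?p) * (A + B)"
    using weak_solution_test_pos_part(2)[OF dim assms(3) u]
    by (simp add: energy_def A_def B_def algebra_simps)
  \<comment> \<open>The 2 in this denominator is compensated by the two parts, each contributing at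
    least S^(n-1).\<close>
  also have "1 / 2 - 1 / ?p = 1 / (2 * (real n - 1))"
    using assms(2) unfolding p1 by (simp add: field_simps)
  finally have E: "energy u = (A + B) / (2 * (real n - 1))" by simp
  have "2 * S ^ (n - 1) / (2 * (real n - 1)) < (A + B) / (2 * (real n - 1))"
    using AB assms(2) by (intro divide_strict_right_mono) auto
  moreover have "2 * S ^ (n - 1) / (2 * (real n - 1)) = 1 / (real n - 1) * S ^ (n - 1)"
    by (subst mult_divide_mult_cancel_left) simp_all
  ultimately show ?thesis unfolding E S_def[symmetric] by (simp only:)
qed

end
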